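(* Let $\ell\in\tfrac12\mathbb{N}_0$ and let $\mathfrak{g}=\mathfrak{cga}_\ell(2,\mathbb{C})$ be the complex conformal Galilei algebra with $d=2$. Then \begin{align*} \dim H^2(\mathfrak{g},\mathfrak{g})&=2\quad\text{if } \ell\in\{0,\tfrac12,1\},\\ \dim H^2(\mathfrak{g},\mathfrak{g})&=1\quad\text{otherwise.} \end{align*}
   Context: $\mathbb{N}_0=\{0,1,2,\dots\}$. For $\ell\in\frac12\mathbb{N}_0$, the conformal Galilei algebra $\mathfrak{cga}_\ell(2,\mathbb{C})$ is the complex Lie algebra of dimension $4\ell+6$ with basis $C,D,H,M_{1,2}$ and $P_i,Q_i$ ($0\le i\le 2\ell$), with non-trivial brackets \begin{align*} [D,H]&=2H,\quad [C,H]=D,\quad [D,C]=-2C,\\ [M_{1,2},P_i]&=-Q_i,\quad [M_{1,2},Q_i]=P_i,\\ [H,P_i]&=-iP_{i-1},\quad [D,P_i]=2(\ell-i)P_i,\quad [C,P_i]=(2\ell-i)P_{i+1},\\ [H,Q_i]&=-iQ_{i-1},\quad [D,Q_i]=2(\ell-i)Q_i,\quad [C,Q_i]=(2\ell-i)Q_{i+1}. \end{align*} All other brackets of basis elements (not following by antisymmetry) vanish. $H^2(\mathfrak{g},\mathfrak{g})$ is the second Chevalley–Eilenberg cohomology space of $\mathfrak{g}$ with coefficients in the adjoint module; dimensions are over $\mathbb{C}$. *)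

theory Defs
  imports "Jordan_Normal_Form.VS_Connect" "HOL-Algebra.QuotRing"
begin

section \<open>Lie algebras and their adjoint cohomology in degree two\<close>

record ('a, 'b) lie_alg = "('a, 'b) module" +
  lie_bracket :: "'b \<Rightarrow> 'b \<Rightarrow> 'b"  (\<open>\<langle>_,/ _\<rangle>\<index>\<close>)

locale lie_algebra = vectorspace K L
  for K :: "('a, 'd) ring_scheme" and L :: "('a, 'b, 'c) lie_alg_scheme" (structure) +
  assumes lie_closed: "\<lbrakk>x \<in> carrier L; y \<in> carrier L\<rbrakk> \<Longrightarrow> \<langle>x, y\<rangle> \<in> carrier L"
    and lie_add_left: "\<lbrakk>x \<in> carrier L; y \<in> carrier L; z \<in> carrier L\<rbrakk>
          \<Longrightarrow> \<langle>x \<oplus> y, z\<rangle> = \<langle>x, z\<rangle> \<oplus> \<langle>y, z\<rangle>"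
    and lie_add_right: "\<lbrakk>x \<in> carrier L; y \<in> carrier L; z \<in> carrier L\<rbrakk>
          \<Longrightarrow> \<langle>x, y \<oplus> z\<rangle> = \<langle>x, y\<rangle> \<oplus> \<langle>x, z\<rangle>"
    and lie_smult_left: "\<lbrakk>c \<in> carrier K; x \<in> carrier L; y \<in> carrier L\<rbrakk>
          \<Longrightarrow> \<langle>c \<odot> x, y\<rangle> = c \<odot> \<langle>x, y\<rangle>"
    and lie_smult_right: "\<lbrakk>c \<in> carrier K; x \<in> carrier L; y \<in> carrier L\<rbrakk>
          \<Longrightarrow> \<langle>x, c \<odot> y\<rangle> = c \<odot> \<langle>x, y\<rangle>"
    and lie_alternating: "x \<in> carrier L \<Longrightarrow> \<langle>x, x\<rangle> = \<zero>"
    and lie_jacobi: "\<lbrakk>x \<in> carrier L; y \<in> carrier L; z \<in> carrier L\<rbrakk>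
          \<Longrightarrow> \<langle>x, \<langle>y, z\<rangle>\<rangle> \<oplus> \<langle>y, \<langle>z, x\<rangle>\<rangle> \<oplus> \<langle>z, \<langle>x, y\<rangle>\<rangle> = \<zero>"

text \<open>The quotient of a module by a submodule, built on the cosets of the additive group as
  \<^const>\<open>A_FactGroup\<close> and \<^const>\<open>FactRing\<close> do. The multiplicative part of a module record
  carries no meaning and is left unspecified.\<close>

definition quotient_module :: "('a, 'b, 'c) module_scheme \<Rightarrow> 'b set \<Rightarrow> ('a, 'b set) module" where
  "quotient_module V W =
     \<lparr>carrier = a_rcosets\<^bsub>V\<^esub> W, mult = undefined, one = undefined,
      zero = W, add = set_add V, smult = (\<lambda>c X. \<Union>x\<in>X. W +>\<^bsub>V\<^esub> (c \<odot>\<^bsub>V\<^esub> x))\<rparr>"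

text \<open>Cochains are extensional (\<^const>\<open>undefined\<close> off the carrier), so that equal cochains are
  equal functions.\<close>

definition ce_C1 :: "('a, 'd) ring_scheme \<Rightarrow> ('a, 'b, 'c) lie_alg_scheme \<Rightarrow> ('b \<Rightarrow> 'b) set" where
  "ce_C1 K L = LinearCombinations.module_hom K L L \<inter> extensional (carrier L)"

definition ce_C2 :: "('a, 'd) ring_scheme \<Rightarrow> ('a, 'b, 'c) lie_alg_scheme
    \<Rightarrow> ('a, 'b \<Rightarrow> 'b \<Rightarrow> 'b) module" where
  "ce_C2 K L =
     \<lparr>carrier = {f \<in> carrier L \<rightarrow>\<^sub>E carrier L \<rightarrow>\<^sub>E carrier L.
        (\<forall>x\<in>carrier L. f x \<in> LinearCombinations.module_hom K L L) \<and>
        (\<forall>y\<in>carrier L. (\<lambda>x. f x y) \<in> LinearCombinations.module_hom K L L) \<and>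
        (\<forall>x\<in>carrier L. f x x = \<zero>\<^bsub>L\<^esub>)},
      mult = undefined, one = undefined,
      zero = (\<lambda>x\<in>carrier L. \<lambda>y\<in>carrier L. \<zero>\<^bsub>L\<^esub>),
      add = (\<lambda>f g. \<lambda>x\<in>carrier L. \<lambda>y\<in>carrier L. f x y \<oplus>\<^bsub>L\<^esub> g x y),
      smult = (\<lambda>c f. \<lambda>x\<in>carrier L. \<lambda>y\<in>carrier L. c \<odot>\<^bsub>L\<^esub> f x y)\<rparr>"

definition ce_d1 :: "('a, 'b, 'c) lie_alg_scheme \<Rightarrow> ('b \<Rightarrow> 'b) \<Rightarrow> 'b \<Rightarrow> 'b \<Rightarrow> 'b" where
  "ce_d1 L \<phi> = (\<lambda>x\<in>carrier L. \<lambda>y\<in>carrier L.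
     \<langle>x, \<phi> y\<rangle>\<^bsub>L\<^esub> \<ominus>\<^bsub>L\<^esub> \<langle>y, \<phi> x\<rangle>\<^bsub>L\<^esub> \<ominus>\<^bsub>L\<^esub> \<phi> \<langle>x, y\<rangle>\<^bsub>L\<^esub>)"

definition ce_d2 :: "('a, 'b, 'c) lie_alg_scheme \<Rightarrow> ('b \<Rightarrow> 'b \<Rightarrow> 'b) \<Rightarrow> 'b \<Rightarrow> 'b \<Rightarrow> 'b \<Rightarrow> 'b" where
  "ce_d2 L f = (\<lambda>x\<in>carrier L. \<lambda>y\<in>carrier L. \<lambda>z\<in>carrier L.
     \<langle>x, f y z\<rangle>\<^bsub>L\<^esub> \<ominus>\<^bsub>L\<^esub> \<langle>y, f x z\<rangle>\<^bsub>L\<^esub> \<oplus>\<^bsub>L\<^esub> \<langle>z, f x y\<rangle>\<^bsub>L\<^esub>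
     \<ominus>\<^bsub>L\<^esub> f \<langle>x, y\<rangle>\<^bsub>L\<^esub> z \<oplus>\<^bsub>L\<^esub> f \<langle>x, z\<rangle>\<^bsub>L\<^esub> y \<ominus>\<^bsub>L\<^esub> f \<langle>y, z\<rangle>\<^bsub>L\<^esub> x)"

definition ce_Z2 :: "('a, 'd) ring_scheme \<Rightarrow> ('a, 'b, 'c) lie_alg_scheme
    \<Rightarrow> ('b \<Rightarrow> 'b \<Rightarrow> 'b) set" where
  "ce_Z2 K L = {f \<in> carrier (ce_C2 K L).
     \<forall>x\<in>carrier L. \<forall>y\<in>carrier L. \<forall>z\<in>carrier L. ce_d2 L f x y z = \<zero>\<^bsub>L\<^esub>}"

definition ce_B2 :: "('a, 'd) ring_scheme \<Rightarrow> ('a, 'b, 'c) lie_alg_scheme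
    \<Rightarrow> ('b \<Rightarrow> 'b \<Rightarrow> 'b) set" where
  "ce_B2 K L = ce_d1 L ` ce_C1 K L"

definition ce_H2 :: "('a, 'd) ring_scheme \<Rightarrow> ('a, 'b, 'c) lie_alg_scheme
    \<Rightarrow> ('a, ('b \<Rightarrow> 'b \<Rightarrow> 'b) set) module" where
  "ce_H2 K L = quotient_module ((ce_C2 K L)\<lparr>carrier := ce_Z2 K L\<rparr>) (ce_B2 K L)"

section \<open>The conformal Galilei algebra for d = 2\<close>

datatype cga_gen = gC | gD | gH | gM | gP nat | gQ nat

definition cga_gens :: "real \<Rightarrow> cga_gen set" where
  "cga_gens l = {gC, gD, gH, gM} \<union> gP ` {i. real i \<le> 2 * l} \<union> gQ ` {i. real i \<le> 2 * l}"

text \<open>Elements are coordinate functions; \<open>cga_term c b\<close> is the multiple \<open>c b\<close> of the generator \<open>b\<close>.\<close>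

definition cga_term :: "complex \<Rightarrow> cga_gen \<Rightarrow> cga_gen \<Rightarrow> complex" where
  "cga_term c b = (\<lambda>a. if a = b then c else 0)"

text \<open>Each non-trivial bracket is listed in one of its two orientations. Where the index
  \<open>i - 1\<close> or \<open>i + 1\<close> would leave the range \<open>0 \<le> i \<le> 2 l\<close>, the coefficient is 0.\<close>

fun cga_rel :: "real \<Rightarrow> cga_gen \<Rightarrow> cga_gen \<Rightarrow> cga_gen \<Rightarrow> complex" where
  "cga_rel l gD gH = cga_term 2 gH"
| "cga_rel l gC gH = cga_term 1 gD"
| "cga_rel l gD gC = cga_term (- 2) gC"
| "cga_rel l gM (gP i) = cga_term (- 1) (gQ i)"
| "cga_rel l gM (gQ i) = cga_term 1 (gP i)"
| "cga_rel l gH (gP i) = cga_term (- of_nat i) (gP (i - 1))"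
| "cga_rel l gD (gP i) = cga_term (of_real (2 * (l - real i))) (gP i)"
| "cga_rel l gC (gP i) = cga_term (of_real (2 * l - real i)) (gP (i + 1))"
| "cga_rel l gH (gQ i) = cga_term (- of_nat i) (gQ (i - 1))"
| "cga_rel l gD (gQ i) = cga_term (of_real (2 * (l - real i))) (gQ i)"
| "cga_rel l gC (gQ i) = cga_term (of_real (2 * l - real i)) (gQ (i + 1))"
| "cga_rel l _ _ = (\<lambda>_. 0)"

definition cga_struct :: "real \<Rightarrow> cga_gen \<Rightarrow> cga_gen \<Rightarrow> cga_gen \<Rightarrow> complex" where
  "cga_struct l a b = (\<lambda>c. cga_rel l a b c - cga_rel l b a c)"

definition cga :: "real \<Rightarrow> (complex, cga_gen \<Rightarrow> complex) lie_alg" where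
  "cga l =
     \<lparr>carrier = {x. \<forall>a. a \<notin> cga_gens l \<longrightarrow> x a = 0}, mult = undefined, one = undefined,
      zero = (\<lambda>_. 0), add = (\<lambda>x y a. x a + y a), smult = (\<lambda>c x a. c * x a),
      lie_bracket = (\<lambda>x y c. \<Sum>a\<in>cga_gens l. \<Sum>b\<in>cga_gens l. x a * y b * cga_struct l a b c)\<rparr>"

section \<open>Consistency of the definitions\<close>

lemma (in abelian_group) minus_simps:
  assumes "a \<in> carrier G" "b \<in> carrier G" "c \<in> carrier G"
  shows "a \<oplus> (b \<ominus> c) = (a \<oplus> b) \<ominus> c" "(a \<ominus> b) \<oplus> c = (a \<oplus> c) \<ominus> b"
    "a \<ominus> (b \<ominus> c) = (a \<oplus> c) \<ominus> b" "(a \<ominus> b) \<ominus> c = a \<ominus> (b \<oplus> c)"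
    "a \<ominus> b = c \<longleftrightarrow> a = c \<oplus> b" "c = a \<ominus> b \<longleftrightarrow> c \<oplus> b = a"
proof -
  show "a \<ominus> b = c \<longleftrightarrow> a = c \<oplus> b"
    using assms by (auto simp: a_minus_def a_assoc l_neg r_neg)
  then show "c = a \<ominus> b \<longleftrightarrow> c \<oplus> b = a" by metis
qed (use assms in \<open>simp_all add: a_minus_def minus_add a_ac\<close>)

lemma (in Module.module) module_hom_minus:
  assumes f: "f \<in> LinearCombinations.module_hom R M N" and N: "Module.module R N"
    and ab: "a \<in> carrier M" "b \<in> carrier M"
  shows "f (a \<ominus>\<^bsub>M\<^esub> b) = f a \<ominus>\<^bsub>N\<^esub> f b"
proof -
  interpret N: Module.module R N by (rule N)
  have cl: "f x \<in> carrier N" if "x \<in> carrier M" for x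
    using f that by (auto simp: LinearCombinations.module_hom_def)
  have "f (a \<ominus>\<^bsub>M\<^esub> b) \<oplus>\<^bsub>N\<^esub> f b = f (a \<ominus>\<^bsub>M\<^esub> b \<oplus>\<^bsub>M\<^esub> b)"
    using f ab by (simp add: LinearCombinations.module_hom_def)
  also have "\<dots> = f a" using ab by (simp add: M.minus_eq M.a_assoc M.l_neg)
  finally show ?thesis using ab cl N.M.minus_simps(5,6) by simp
qed

lemma quotient_vectorspace:
  assumes V: "vectorspace K V" and W: "subspace K W V"
  shows "vectorspace K (quotient_module V W)"
proof -
  interpret vectorspace K V by (rule V)
  have sub: "submodule K W V" using W by (simp add: subspace_def)
  have WV: "W \<subseteq> carrier V" and W0: "\<zero>\<^bsub>V\<^esub> \<in> W"
    and Wadd: "\<And>v w. \<lbrakk>v \<in> W; w \<in> W\<rbrakk> \<Longrightarrow> v \<oplus>\<^bsub>V\<^esub> w \<in> W"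
    and Wsm: "\<And>c v. \<lbrakk>c \<in> carrier K; v \<in> W\<rbrakk> \<Longrightarrow> c \<odot>\<^bsub>V\<^esub> v \<in> W"
    using sub unfolding submodule_def by auto
  have Wneg: "\<ominus>\<^bsub>V\<^esub> w \<in> W" if "w \<in> W" for w
    using Wsm[of "\<ominus>\<^bsub>K\<^esub> \<one>\<^bsub>K\<^esub>" w] that WV smult_minus_1[of w] by auto
  have sg: "subgroup W (add_monoid V)"
  proof (rule group.subgroupI)
    show "group (add_monoid V)" by (rule M.a_group)
    show "inv\<^bsub>add_monoid V\<^esub> a \<in> W" if "a \<in> W" for a
      using Wneg[OF that] by (simp add: a_inv_def)
  qed (use WV W0 Wadd in auto)
  then have "additive_subgroup W V" by (simp add: additive_subgroup_def)
  then interpret W: abelian_subgroup W V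
    by (rule abelian_subgroupI3) (rule M.abelian_group_axioms)
  have rep: "\<exists>x\<in>carrier V. X = W +>\<^bsub>V\<^esub> x" if "X \<in> carrier (quotient_module V W)" for X
    using that by (auto simp: quotient_module_def A_RCOSETS_def')
  have car: "W +>\<^bsub>V\<^esub> x \<in> carrier (quotient_module V W)" if "x \<in> carrier V" for x
    using that by (auto simp: quotient_module_def A_RCOSETS_def')
  have add: "(W +>\<^bsub>V\<^esub> x) \<oplus>\<^bsub>quotient_module V W\<^esub> (W +>\<^bsub>V\<^esub> y) = W +>\<^bsub>V\<^esub> (x \<oplus>\<^bsub>V\<^esub> y)"
    if "x \<in> carrier V" "y \<in> carrier V" for x y
    using that by (simp add: quotient_module_def W.a_rcos_sum)
  have smult: "c \<odot>\<^bsub>quotient_module V W\<^esub> (W +>\<^bsub>V\<^esub> x) = W +>\<^bsub>V\<^esub> (c \<odot>\<^bsub>V\<^esub> x)"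
    if "c \<in> carrier K" "x \<in> carrier V" for c x
  proof -
    have eq: "W +>\<^bsub>V\<^esub> (c \<odot>\<^bsub>V\<^esub> y) = W +>\<^bsub>V\<^esub> (c \<odot>\<^bsub>V\<^esub> x)" if y: "y \<in> W +>\<^bsub>V\<^esub> x" for y
    proof -
      obtain w where w: "w \<in> W" "y = w \<oplus>\<^bsub>V\<^esub> x" using y by (auto simp: a_r_coset_def')
      have "c \<odot>\<^bsub>V\<^esub> y = c \<odot>\<^bsub>V\<^esub> w \<oplus>\<^bsub>V\<^esub> c \<odot>\<^bsub>V\<^esub> x"
        using w WV \<open>c \<in> carrier K\<close> \<open>x \<in> carrier V\<close> by (auto simp: smult_r_distr)
      then have "c \<odot>\<^bsub>V\<^esub> y \<in> W +>\<^bsub>V\<^esub> (c \<odot>\<^bsub>V\<^esub> x)"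
        using Wsm[OF \<open>c \<in> carrier K\<close> w(1)] by (auto simp: a_r_coset_def')
      then show ?thesis
        using M.a_repr_independence[OF _ _ sg] \<open>c \<in> carrier K\<close> \<open>x \<in> carrier V\<close> by simp
    qed
    have x: "x \<in> W +>\<^bsub>V\<^esub> x" using W.a_rcos_self that by simp
    have "(\<Union>y\<in>W +>\<^bsub>V\<^esub> x. W +>\<^bsub>V\<^esub> (c \<odot>\<^bsub>V\<^esub> y)) = (\<Union>y\<in>W +>\<^bsub>V\<^esub> x. W +>\<^bsub>V\<^esub> (c \<odot>\<^bsub>V\<^esub> x))"
      by (rule SUP_cong[OF refl eq])
    also have "\<dots> = W +>\<^bsub>V\<^esub> (c \<odot>\<^bsub>V\<^esub> x)" using x by blast
    finally show ?thesis by (simp add: quotient_module_def)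
  qed
  have zero: "\<zero>\<^bsub>quotient_module V W\<^esub> = W +>\<^bsub>V\<^esub> \<zero>\<^bsub>V\<^esub>"
    using WV by (simp add: quotient_module_def M.a_coset_add_zero)
  have "abelian_group (quotient_module V W)"
  proof (rule abelian_groupI)
    fix X assume "X \<in> carrier (quotient_module V W)"
    then obtain x where x: "x \<in> carrier V" "X = W +>\<^bsub>V\<^esub> x" using rep by blast
    then show "\<exists>Y\<in>carrier (quotient_module V W).
        Y \<oplus>\<^bsub>quotient_module V W\<^esub> X = \<zero>\<^bsub>quotient_module V W\<^esub>"
      by (intro bexI[of _ "W +>\<^bsub>V\<^esub> (\<ominus>\<^bsub>V\<^esub> x)"]) (simp_all add: add zero car M.l_neg)
  next
    fix X Y Z
    assume "X \<in> carrier (quotient_module V W)" "Y \<in> carrier (quotient_module V W)"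
      "Z \<in> carrier (quotient_module V W)"
    then obtain x y z where "x \<in> carrier V" "X = W +>\<^bsub>V\<^esub> x" "y \<in> carrier V" "Y = W +>\<^bsub>V\<^esub> y"
      "z \<in> carrier V" "Z = W +>\<^bsub>V\<^esub> z" using rep by metis
    then show "X \<oplus>\<^bsub>quotient_module V W\<^esub> Y \<oplus>\<^bsub>quotient_module V W\<^esub> Z =
        X \<oplus>\<^bsub>quotient_module V W\<^esub> (Y \<oplus>\<^bsub>quotient_module V W\<^esub> Z)"
      by (simp add: add M.a_assoc)
  next
    fix X Y
    assume "X \<in> carrier (quotient_module V W)" "Y \<in> carrier (quotient_module V W)"
    then obtain x y where "x \<in> carrier V" "X = W +>\<^bsub>V\<^esub> x" "y \<in> carrier V" "Y = W +>\<^bsub>V\<^esub> y"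
      using rep by metis
    then show "X \<oplus>\<^bsub>quotient_module V W\<^esub> Y \<in> carrier (quotient_module V W)"
      "X \<oplus>\<^bsub>quotient_module V W\<^esub> Y = Y \<oplus>\<^bsub>quotient_module V W\<^esub> X"
      by (simp_all add: add car M.a_comm)
  next
    fix X assume "X \<in> carrier (quotient_module V W)"
    then obtain x where "x \<in> carrier V" "X = W +>\<^bsub>V\<^esub> x" using rep by metis
    then show "\<zero>\<^bsub>quotient_module V W\<^esub> \<oplus>\<^bsub>quotient_module V W\<^esub> X = X"
      by (simp add: add zero)
  qed (simp add: zero car)
  then have "Module.module K (quotient_module V W)"
  proof (rule moduleI[OF R.cring_axioms])
    fix c d X assume "c \<in> carrier K" "d \<in> carrier K" "X \<in> carrier (quotient_module V W)"
    moreover from this obtain x where "x \<in> carrier V" "X = W +>\<^bsub>V\<^esub> x" using rep by metis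
    ultimately show "(c \<oplus>\<^bsub>K\<^esub> d) \<odot>\<^bsub>quotient_module V W\<^esub> X =
        c \<odot>\<^bsub>quotient_module V W\<^esub> X \<oplus>\<^bsub>quotient_module V W\<^esub> d \<odot>\<^bsub>quotient_module V W\<^esub> X"
      "(c \<otimes>\<^bsub>K\<^esub> d) \<odot>\<^bsub>quotient_module V W\<^esub> X =
        c \<odot>\<^bsub>quotient_module V W\<^esub> (d \<odot>\<^bsub>quotient_module V W\<^esub> X)"
      by (simp_all add: add smult car smult_l_distr smult_assoc1)
  next
    fix c X assume "c \<in> carrier K" "X \<in> carrier (quotient_module V W)"
    moreover from this obtain x where "x \<in> carrier V" "X = W +>\<^bsub>V\<^esub> x" using rep by metis
    ultimately show "c \<odot>\<^bsub>quotient_module V W\<^esub> X \<in> carrier (quotient_module V W)"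
      by (simp add: smult car)
  next
    fix c X Y assume "c \<in> carrier K" "X \<in> carrier (quotient_module V W)"
      "Y \<in> carrier (quotient_module V W)"
    moreover from this obtain x y where "x \<in> carrier V" "X = W +>\<^bsub>V\<^esub> x"
      "y \<in> carrier V" "Y = W +>\<^bsub>V\<^esub> y" using rep by metis
    ultimately show "c \<odot>\<^bsub>quotient_module V W\<^esub> (X \<oplus>\<^bsub>quotient_module V W\<^esub> Y) =
        c \<odot>\<^bsub>quotient_module V W\<^esub> X \<oplus>\<^bsub>quotient_module V W\<^esub> c \<odot>\<^bsub>quotient_module V W\<^esub> Y"
      by (simp add: add smult smult_r_distr)
  next
    fix X assume "X \<in> carrier (quotient_module V W)"
    then obtain x where "x \<in> carrier V" "X = W +>\<^bsub>V\<^esub> x" using rep by metis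
    then show "\<one>\<^bsub>K\<^esub> \<odot>\<^bsub>quotient_module V W\<^esub> X = X" by (simp add: smult)
  qed
  then show ?thesis using V by (simp add: vectorspace_def)
qed

lemma ce_C2_vectorspace:
  assumes "vectorspace K L"
  shows "vectorspace K (ce_C2 K L)"
proof -
  interpret vectorspace K L by (rule assms)
  let ?L = "carrier L"
  let ?C = "ce_C2 K L"
  have cl: "f x y \<in> ?L" if "f \<in> carrier ?C" "x \<in> ?L" "y \<in> ?L" for f x y
    using that by (auto simp: ce_C2_def PiE_iff)
  have ext: "f = g" if "f \<in> carrier ?C" "g \<in> carrier ?C" "\<And>x y. \<lbrakk>x \<in> ?L; y \<in> ?L\<rbrakk> \<Longrightarrow> f x y = g x y" for f g
    using that unfolding ce_C2_def
    by (intro ext) (auto simp: PiE_iff extensional_def, metis)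
  have memI: "(\<lambda>x\<in>?L. \<lambda>y\<in>?L. F x y) \<in> carrier ?C"
    if "\<And>x y. \<lbrakk>x \<in> ?L; y \<in> ?L\<rbrakk> \<Longrightarrow> F x y \<in> ?L"
      "\<And>x y z. \<lbrakk>x \<in> ?L; y \<in> ?L; z \<in> ?L\<rbrakk> \<Longrightarrow> F x (y \<oplus>\<^bsub>L\<^esub> z) = F x y \<oplus>\<^bsub>L\<^esub> F x z"
      "\<And>x y z. \<lbrakk>x \<in> ?L; y \<in> ?L; z \<in> ?L\<rbrakk> \<Longrightarrow> F (x \<oplus>\<^bsub>L\<^esub> y) z = F x z \<oplus>\<^bsub>L\<^esub> F y z"
      "\<And>c x y. \<lbrakk>c \<in> carrier K; x \<in> ?L; y \<in> ?L\<rbrakk> \<Longrightarrow> F x (c \<odot>\<^bsub>L\<^esub> y) = c \<odot>\<^bsub>L\<^esub> F x y"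
      "\<And>c x y. \<lbrakk>c \<in> carrier K; x \<in> ?L; y \<in> ?L\<rbrakk> \<Longrightarrow> F (c \<odot>\<^bsub>L\<^esub> x) y = c \<odot>\<^bsub>L\<^esub> F x y"
      "\<And>x. x \<in> ?L \<Longrightarrow> F x x = \<zero>\<^bsub>L\<^esub>" for F
    using that by (auto simp: ce_C2_def LinearCombinations.module_hom_def)
  have bil: "f x (y \<oplus>\<^bsub>L\<^esub> z) = f x y \<oplus>\<^bsub>L\<^esub> f x z" "f (x \<oplus>\<^bsub>L\<^esub> y) z = f x z \<oplus>\<^bsub>L\<^esub> f y z"
      "c \<in> carrier K \<Longrightarrow> f x (c \<odot>\<^bsub>L\<^esub> y) = c \<odot>\<^bsub>L\<^esub> f x y"
      "c \<in> carrier K \<Longrightarrow> f (c \<odot>\<^bsub>L\<^esub> x) y = c \<odot>\<^bsub>L\<^esub> f x y" "f x x = \<zero>\<^bsub>L\<^esub>"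
    if "f \<in> carrier ?C" "x \<in> ?L" "y \<in> ?L" "z \<in> ?L" for f x y z c
    using that by (auto simp: ce_C2_def LinearCombinations.module_hom_def)
  have smc: "a \<odot>\<^bsub>L\<^esub> (b \<odot>\<^bsub>L\<^esub> x) = b \<odot>\<^bsub>L\<^esub> (a \<odot>\<^bsub>L\<^esub> x)" if "a \<in> carrier K" "b \<in> carrier K" "x \<in> ?L" for a b x
    using that by (metis smult_assoc1 R.m_comm)
  have zero: "\<zero>\<^bsub>?C\<^esub> = (\<lambda>x\<in>?L. \<lambda>y\<in>?L. \<zero>\<^bsub>L\<^esub>)"
    and add: "f \<oplus>\<^bsub>?C\<^esub> g = (\<lambda>x\<in>?L. \<lambda>y\<in>?L. f x y \<oplus>\<^bsub>L\<^esub> g x y)"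
    and smult: "c \<odot>\<^bsub>?C\<^esub> f = (\<lambda>x\<in>?L. \<lambda>y\<in>?L. c \<odot>\<^bsub>L\<^esub> f x y)" for f g c
    by (simp_all add: ce_C2_def)
  have mem: "\<zero>\<^bsub>?C\<^esub> \<in> carrier ?C"
    "\<lbrakk>f \<in> carrier ?C; g \<in> carrier ?C\<rbrakk> \<Longrightarrow> f \<oplus>\<^bsub>?C\<^esub> g \<in> carrier ?C"
    "\<lbrakk>c \<in> carrier K; f \<in> carrier ?C\<rbrakk> \<Longrightarrow> c \<odot>\<^bsub>?C\<^esub> f \<in> carrier ?C" for f g c
    unfolding zero add smult
    by (rule memI; simp add: bil cl smult_r_distr smc M.a_ac)+
  have "abelian_group ?C"
  proof (rule abelian_groupI)
    fix f assume f: "f \<in> carrier ?C"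
    show "\<exists>g\<in>carrier ?C. g \<oplus>\<^bsub>?C\<^esub> f = \<zero>\<^bsub>?C\<^esub>"
    proof
      show m: "(\<ominus>\<^bsub>K\<^esub> \<one>\<^bsub>K\<^esub>) \<odot>\<^bsub>?C\<^esub> f \<in> carrier ?C" by (rule mem) (use f in auto)
      show "(\<ominus>\<^bsub>K\<^esub> \<one>\<^bsub>K\<^esub>) \<odot>\<^bsub>?C\<^esub> f \<oplus>\<^bsub>?C\<^esub> f = \<zero>\<^bsub>?C\<^esub>"
        using f by (intro ext mem m) (simp_all add: add smult zero cl smult_minus_1 M.l_neg)
    qed
  next
    fix f g h assume "f \<in> carrier ?C" "g \<in> carrier ?C" "h \<in> carrier ?C"
    then show "f \<oplus>\<^bsub>?C\<^esub> g \<oplus>\<^bsub>?C\<^esub> h = f \<oplus>\<^bsub>?C\<^esub> (g \<oplus>\<^bsub>?C\<^esub> h)"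
      by (intro ext mem) (simp_all add: add cl M.a_assoc)
  next
    fix f g assume "f \<in> carrier ?C" "g \<in> carrier ?C"
    then show "f \<oplus>\<^bsub>?C\<^esub> g = g \<oplus>\<^bsub>?C\<^esub> f"
      by (intro ext mem) (simp_all add: add cl M.a_comm)
  next
    fix f assume "f \<in> carrier ?C"
    then show "\<zero>\<^bsub>?C\<^esub> \<oplus>\<^bsub>?C\<^esub> f = f"
      by (intro ext mem) (simp_all add: add zero cl)
  qed (rule mem; assumption)+
  then have "Module.module K ?C"
  proof (rule moduleI[OF R.cring_axioms])
    fix c d f assume "c \<in> carrier K" "d \<in> carrier K" "f \<in> carrier ?C"
    then show "(c \<oplus>\<^bsub>K\<^esub> d) \<odot>\<^bsub>?C\<^esub> f = c \<odot>\<^bsub>?C\<^esub> f \<oplus>\<^bsub>?C\<^esub> d \<odot>\<^bsub>?C\<^esub> f"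
      "(c \<otimes>\<^bsub>K\<^esub> d) \<odot>\<^bsub>?C\<^esub> f = c \<odot>\<^bsub>?C\<^esub> (d \<odot>\<^bsub>?C\<^esub> f)"
      by (intro ext mem; simp add: add smult cl smult_l_distr smult_assoc1)+
  next
    fix c f g assume "c \<in> carrier K" "f \<in> carrier ?C" "g \<in> carrier ?C"
    then show "c \<odot>\<^bsub>?C\<^esub> (f \<oplus>\<^bsub>?C\<^esub> g) = c \<odot>\<^bsub>?C\<^esub> f \<oplus>\<^bsub>?C\<^esub> c \<odot>\<^bsub>?C\<^esub> g"
      by (intro ext mem; simp add: add smult cl smult_r_distr)
  next
    fix f assume "f \<in> carrier ?C"
    then show "\<one>\<^bsub>K\<^esub> \<odot>\<^bsub>?C\<^esub> f = f"
      by (intro ext mem; simp add: smult cl)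
  qed (rule mem; assumption)
  then show ?thesis using assms by (simp add: vectorspace_def)
qed

lemma (in abelian_group) minus_zero_eq: "\<ominus> \<zero> = \<zero>"
  by (simp add: minus_equality)

lemma (in abelian_group) add_pairs:
  assumes "a \<in> carrier G" "b \<in> carrier G" "c \<in> carrier G" "d \<in> carrier G"
  shows "(a \<oplus> b) \<oplus> (c \<oplus> d) = (a \<oplus> c) \<oplus> (b \<oplus> d)" "(a \<oplus> b) \<ominus> (c \<oplus> d) = (a \<ominus> c) \<oplus> (b \<ominus> d)"
  using assms by (simp_all add: minus_eq minus_add a_ac)

lemma (in abelian_group) six_terms_add:
  assumes "a \<in> carrier G" "b \<in> carrier G" "c \<in> carrier G" "d \<in> carrier G" "e \<in> carrier G" "f \<in> carrier G"
    "a' \<in> carrier G" "b' \<in> carrier G" "c' \<in> carrier G" "d' \<in> carrier G" "e' \<in> carrier G" "f' \<in> carrier G"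
  shows "(a \<oplus> a') \<ominus> (b \<oplus> b') \<oplus> (c \<oplus> c') \<ominus> (d \<oplus> d') \<oplus> (e \<oplus> e') \<ominus> (f \<oplus> f')
    = (a \<ominus> b \<oplus> c \<ominus> d \<oplus> e \<ominus> f) \<oplus> (a' \<ominus> b' \<oplus> c' \<ominus> d' \<oplus> e' \<ominus> f')"
  by (simp only: add_pairs(2)[of a a' b b'] add_pairs(1)[of "a \<ominus> b" "a' \<ominus> b'" c c']
      add_pairs(2)[of "a \<ominus> b \<oplus> c" "a' \<ominus> b' \<oplus> c'" d d']
      add_pairs(1)[of "a \<ominus> b \<oplus> c \<ominus> d" "a' \<ominus> b' \<oplus> c' \<ominus> d'" e e']
      add_pairs(2)[of "a \<ominus> b \<oplus> c \<ominus> d \<oplus> e" "a' \<ominus> b' \<oplus> c' \<ominus> d' \<oplus> e'" f f']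
      assms a_closed minus_closed)

lemma (in abelian_group) d_squared_terms:
  assumes "a1 \<in> carrier G" "a2 \<in> carrier G" "a3 \<in> carrier G" "b1 \<in> carrier G" "b2 \<in> carrier G"
    "b3 \<in> carrier G" "c1 \<in> carrier G" "c2 \<in> carrier G" "c3 \<in> carrier G" "p \<in> carrier G" "q \<in> carrier G"
  shows "(a1 \<ominus> a2 \<ominus> a3) \<ominus> (b1 \<ominus> b2 \<ominus> b3) \<oplus> (c1 \<ominus> c2 \<ominus> c3) \<ominus> (a1 \<ominus> b1 \<ominus> c3 \<ominus> (p \<ominus> q))
    \<oplus> (a2 \<ominus> c1 \<ominus> b3 \<ominus> p) \<ominus> (b2 \<ominus> c2 \<ominus> a3 \<ominus> q) = \<zero>"
  using assms by (simp add: minus_simps a_ac)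

lemma (in lie_algebra) lie_minus_right:
  assumes "x \<in> carrier L" "y \<in> carrier L" "z \<in> carrier L"
  shows "\<langle>x, y \<ominus>\<^bsub>L\<^esub> z\<rangle> = \<langle>x, y\<rangle> \<ominus>\<^bsub>L\<^esub> \<langle>x, z\<rangle>"
proof -
  have "\<langle>x, y \<ominus>\<^bsub>L\<^esub> z\<rangle> \<oplus>\<^bsub>L\<^esub> \<langle>x, z\<rangle> = \<langle>x, y \<ominus>\<^bsub>L\<^esub> z \<oplus>\<^bsub>L\<^esub> z\<rangle>"
    using assms by (simp add: lie_add_right)
  also have "\<dots> = \<langle>x, y\<rangle>" using assms by (simp add: M.minus_eq M.a_assoc M.l_neg)
  finally show ?thesis using assms by (simp add: M.minus_simps(6) lie_closed)
qed

lemma (in lie_algebra) lie_anti: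
  assumes "x \<in> carrier L" "y \<in> carrier L"
  shows "\<langle>x, y\<rangle> \<oplus>\<^bsub>L\<^esub> \<langle>y, x\<rangle> = \<zero>\<^bsub>L\<^esub>"
proof -
  have "\<zero>\<^bsub>L\<^esub> = \<langle>x \<oplus>\<^bsub>L\<^esub> y, x \<oplus>\<^bsub>L\<^esub> y\<rangle>" using assms by (simp add: lie_alternating)
  also have "\<dots> = (\<langle>x, x\<rangle> \<oplus>\<^bsub>L\<^esub> \<langle>x, y\<rangle>) \<oplus>\<^bsub>L\<^esub> (\<langle>y, x\<rangle> \<oplus>\<^bsub>L\<^esub> \<langle>y, y\<rangle>)"
    using assms by (simp add: lie_add_left lie_add_right lie_closed M.a_ac)
  finally show ?thesis using assms by (simp add: lie_alternating lie_closed)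
qed

lemma (in lie_algebra) lie_leibniz:
  assumes "x \<in> carrier L" "y \<in> carrier L" "z \<in> carrier L"
  shows "\<langle>\<langle>x, y\<rangle>, z\<rangle> = \<langle>x, \<langle>y, z\<rangle>\<rangle> \<ominus>\<^bsub>L\<^esub> \<langle>y, \<langle>x, z\<rangle>\<rangle>"
    and "\<langle>\<langle>x, y\<rangle>, z\<rangle> = \<langle>\<langle>x, z\<rangle>, y\<rangle> \<ominus>\<^bsub>L\<^esub> \<langle>\<langle>y, z\<rangle>, x\<rangle>"
proof -
  have neg: "\<langle>v, u\<rangle> = \<ominus>\<^bsub>L\<^esub> \<langle>u, v\<rangle>" if "u \<in> carrier L" "v \<in> carrier L" for u v
    using lie_anti[OF that(2,1)] that by (simp add: M.minus_equality lie_closed)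
  have neg_right: "\<langle>u, \<ominus>\<^bsub>L\<^esub> v\<rangle> = \<ominus>\<^bsub>L\<^esub> \<langle>u, v\<rangle>" if "u \<in> carrier L" "v \<in> carrier L" for u v
    using lie_smult_right[of "\<ominus>\<^bsub>K\<^esub> \<one>\<^bsub>K\<^esub>" u v] that by (simp add: smult_minus_1 lie_closed)
  have jac: "\<langle>x, \<langle>y, z\<rangle>\<rangle> \<oplus>\<^bsub>L\<^esub> \<ominus>\<^bsub>L\<^esub> \<langle>y, \<langle>x, z\<rangle>\<rangle> \<oplus>\<^bsub>L\<^esub> \<ominus>\<^bsub>L\<^esub> \<langle>\<langle>x, y\<rangle>, z\<rangle> = \<zero>\<^bsub>L\<^esub>"
    using lie_jacobi[OF assms] neg[of x z] neg[of "\<langle>x, y\<rangle>" z] neg_right[of y "\<langle>x, z\<rangle>"] assms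
    by (simp add: lie_closed)
  show 1: "\<langle>\<langle>x, y\<rangle>, z\<rangle> = \<langle>x, \<langle>y, z\<rangle>\<rangle> \<ominus>\<^bsub>L\<^esub> \<langle>y, \<langle>x, z\<rangle>\<rangle>"
    using jac assms M.minus_equality[of "\<langle>x, \<langle>y, z\<rangle>\<rangle> \<ominus>\<^bsub>L\<^esub> \<langle>y, \<langle>x, z\<rangle>\<rangle>" "\<ominus>\<^bsub>L\<^esub> \<langle>\<langle>x, y\<rangle>, z\<rangle>"]
    by (simp add: M.minus_eq lie_closed)
  show "\<langle>\<langle>x, y\<rangle>, z\<rangle> = \<langle>\<langle>x, z\<rangle>, y\<rangle> \<ominus>\<^bsub>L\<^esub> \<langle>\<langle>y, z\<rangle>, x\<rangle>"
    using neg[of y "\<langle>x, z\<rangle>"] neg[of x "\<langle>y, z\<rangle>"] 1 assms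
    by (simp add: M.minus_eq lie_closed M.a_comm)
qed

lemma (in lie_algebra) ce_Z2_subspace: "subspace K (ce_Z2 K L) (ce_C2 K L)"
proof -
  interpret C: vectorspace K "ce_C2 K L"
    by (rule ce_C2_vectorspace) (rule vectorspace_axioms)
  have cl: "f x y \<in> carrier L" if "f \<in> carrier (ce_C2 K L)" "x \<in> carrier L" "y \<in> carrier L" for f x y
    using that by (auto simp: ce_C2_def PiE_iff)
  have zero: "\<zero>\<^bsub>ce_C2 K L\<^esub> = (\<lambda>x\<in>carrier L. \<lambda>y\<in>carrier L. \<zero>\<^bsub>L\<^esub>)"
    and add: "f \<oplus>\<^bsub>ce_C2 K L\<^esub> g = (\<lambda>x\<in>carrier L. \<lambda>y\<in>carrier L. f x y \<oplus>\<^bsub>L\<^esub> g x y)"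
    and smult: "c \<odot>\<^bsub>ce_C2 K L\<^esub> f = (\<lambda>x\<in>carrier L. \<lambda>y\<in>carrier L. c \<odot>\<^bsub>L\<^esub> f x y)" for f g c
    by (simp_all add: ce_C2_def)
  have lie_0: "\<langle>x, \<zero>\<^bsub>L\<^esub>\<rangle> = \<zero>\<^bsub>L\<^esub>" if "x \<in> carrier L" for x
    using lie_minus_right[of x "\<zero>\<^bsub>L\<^esub>" "\<zero>\<^bsub>L\<^esub>"] that by (simp add: M.minus_eq lie_closed M.r_neg)
  have smult_minus: "c \<odot>\<^bsub>L\<^esub> (u \<ominus>\<^bsub>L\<^esub> v) = c \<odot>\<^bsub>L\<^esub> u \<ominus>\<^bsub>L\<^esub> c \<odot>\<^bsub>L\<^esub> v"
    if "c \<in> carrier K" "u \<in> carrier L" "v \<in> carrier L" for c u v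
    using that by (simp add: M.minus_eq smult_r_distr smult_r_minus)
  show ?thesis
  proof (intro subspace.intro submodule.intro)
    show "vectorspace K (ce_C2 K L)" "Module.module K (ce_C2 K L)" by unfold_locales
    show "ce_Z2 K L \<subseteq> carrier (ce_C2 K L)" by (auto simp: ce_Z2_def)
    show "\<zero>\<^bsub>ce_C2 K L\<^esub> \<in> ce_Z2 K L"
      by (auto simp: ce_Z2_def) (simp add: zero ce_d2_def lie_0 lie_closed M.minus_eq M.minus_zero_eq)
  next
    fix f g assume "f \<in> ce_Z2 K L" "g \<in> ce_Z2 K L"
    then have f: "f \<in> carrier (ce_C2 K L)" and g: "g \<in> carrier (ce_C2 K L)"
      and 0: "\<And>x y z. \<lbrakk>x \<in> carrier L; y \<in> carrier L; z \<in> carrier L\<rbrakk> \<Longrightarrow> ce_d2 L f x y z = \<zero>\<^bsub>L\<^esub>"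
        "\<And>x y z. \<lbrakk>x \<in> carrier L; y \<in> carrier L; z \<in> carrier L\<rbrakk> \<Longrightarrow> ce_d2 L g x y z = \<zero>\<^bsub>L\<^esub>"
      by (auto simp: ce_Z2_def)
    have "ce_d2 L (f \<oplus>\<^bsub>ce_C2 K L\<^esub> g) x y z = ce_d2 L f x y z \<oplus>\<^bsub>L\<^esub> ce_d2 L g x y z"
      if "x \<in> carrier L" "y \<in> carrier L" "z \<in> carrier L" for x y z
      using that f g cl
      by (simp add: ce_d2_def add lie_closed lie_add_right M.six_terms_add)
    then show "f \<oplus>\<^bsub>ce_C2 K L\<^esub> g \<in> ce_Z2 K L"
      using f g 0 by (simp add: ce_Z2_def)
  next
    fix c f assume c: "c \<in> carrier K" and "f \<in> ce_Z2 K L"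
    then have f: "f \<in> carrier (ce_C2 K L)"
      and 0: "\<And>x y z. \<lbrakk>x \<in> carrier L; y \<in> carrier L; z \<in> carrier L\<rbrakk> \<Longrightarrow> ce_d2 L f x y z = \<zero>\<^bsub>L\<^esub>"
      by (auto simp: ce_Z2_def)
    have "ce_d2 L (c \<odot>\<^bsub>ce_C2 K L\<^esub> f) x y z = c \<odot>\<^bsub>L\<^esub> ce_d2 L f x y z"
      if "x \<in> carrier L" "y \<in> carrier L" "z \<in> carrier L" for x y z
      using that f c cl
      by (simp add: ce_d2_def smult lie_closed lie_smult_right smult_r_distr smult_minus)
    then show "c \<odot>\<^bsub>ce_C2 K L\<^esub> f \<in> ce_Z2 K L"
      using f c 0 by (simp add: ce_Z2_def)
  qed
qed

lemma (in lie_algebra) ce_d1_in_Z2: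
  assumes "\<phi> \<in> ce_C1 K L"
  shows "ce_d1 L \<phi> \<in> ce_Z2 K L"
proof -
  have cl: "\<phi> x \<in> carrier L" if "x \<in> carrier L" for x
    using that assms by (auto simp: ce_C1_def LinearCombinations.module_hom_def)
  have hom: "\<phi> (x \<oplus>\<^bsub>L\<^esub> y) = \<phi> x \<oplus>\<^bsub>L\<^esub> \<phi> y" "c \<in> carrier K \<Longrightarrow> \<phi> (c \<odot>\<^bsub>L\<^esub> x) = c \<odot>\<^bsub>L\<^esub> \<phi> x"
    "\<phi> (x \<ominus>\<^bsub>L\<^esub> y) = \<phi> x \<ominus>\<^bsub>L\<^esub> \<phi> y"
    if "x \<in> carrier L" "y \<in> carrier L" for x y c
    using that assms module_hom_minus[of \<phi> L x y] module_axioms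
    by (auto simp: ce_C1_def LinearCombinations.module_hom_def)
  have phi0: "\<phi> \<zero>\<^bsub>L\<^esub> = \<zero>\<^bsub>L\<^esub>"
    using hom(3)[of "\<zero>\<^bsub>L\<^esub>" "\<zero>\<^bsub>L\<^esub>"] cl by (simp add: M.minus_eq M.r_neg)
  have smult_minus: "c \<odot>\<^bsub>L\<^esub> (u \<ominus>\<^bsub>L\<^esub> v) = c \<odot>\<^bsub>L\<^esub> u \<ominus>\<^bsub>L\<^esub> c \<odot>\<^bsub>L\<^esub> v"
    if "c \<in> carrier K" "u \<in> carrier L" "v \<in> carrier L" for c u v
    using that by (simp add: M.minus_eq smult_r_distr smult_r_minus)
  have "ce_d1 L \<phi> \<in> carrier (ce_C2 K L)"
    by (auto simp: ce_C2_def ce_d1_def LinearCombinations.module_hom_def cl lie_closed hom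
        lie_add_left lie_add_right lie_smult_left lie_smult_right smult_minus lie_alternating phi0
        M.minus_eq M.minus_add M.r_neg smult_r_distr smult_r_minus M.a_ac)
  moreover have "ce_d2 L (ce_d1 L \<phi>) x y z = \<zero>\<^bsub>L\<^esub>"
    if xyz: "x \<in> carrier L" "y \<in> carrier L" "z \<in> carrier L" for x y z
  proof -
    note lb = lie_leibniz(1)[OF xyz(1,2) cl[OF xyz(3)]] lie_leibniz(1)[OF xyz(1,3) cl[OF xyz(2)]]
      lie_leibniz(1)[OF xyz(2,3) cl[OF xyz(1)]]
    have phi: "\<phi> \<langle>\<langle>x, y\<rangle>, z\<rangle> = \<phi> \<langle>\<langle>x, z\<rangle>, y\<rangle> \<ominus>\<^bsub>L\<^esub> \<phi> \<langle>\<langle>y, z\<rangle>, x\<rangle>"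
      using xyz by (simp add: lie_leibniz(2)[OF xyz] hom lie_closed)
    show ?thesis
      using xyz cl
      by (simp add: ce_d2_def ce_d1_def lie_closed lie_minus_right lb phi M.d_squared_terms)
  qed
  ultimately show ?thesis by (simp add: ce_Z2_def)
qed

lemma (in lie_algebra) ce_B2_subspace:
  "subspace K (ce_B2 K L) ((ce_C2 K L)\<lparr>carrier := ce_Z2 K L\<rparr>)"
proof -
  interpret C: vectorspace K "ce_C2 K L"
    by (rule ce_C2_vectorspace) (rule vectorspace_axioms)
  have Z: "vectorspace K ((ce_C2 K L)\<lparr>carrier := ce_Z2 K L\<rparr>)"
    by (rule C.subspace_is_vs[OF ce_Z2_subspace])
  have cl: "\<phi> x \<in> carrier L" if "\<phi> \<in> ce_C1 K L" "x \<in> carrier L" for \<phi> x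
    using that by (auto simp: ce_C1_def LinearCombinations.module_hom_def)
  have smult_minus: "c \<odot>\<^bsub>L\<^esub> (u \<ominus>\<^bsub>L\<^esub> v) = c \<odot>\<^bsub>L\<^esub> u \<ominus>\<^bsub>L\<^esub> c \<odot>\<^bsub>L\<^esub> v"
    if "c \<in> carrier K" "u \<in> carrier L" "v \<in> carrier L" for c u v
    using that by (simp add: M.minus_eq smult_r_distr smult_r_minus)
  have lie_0: "\<langle>x, \<zero>\<^bsub>L\<^esub>\<rangle> = \<zero>\<^bsub>L\<^esub>" if "x \<in> carrier L" for x
    using lie_minus_right[of x "\<zero>\<^bsub>L\<^esub>" "\<zero>\<^bsub>L\<^esub>"] that by (simp add: M.minus_eq lie_closed M.r_neg)
  show ?thesis
  proof (intro subspace.intro submodule.intro)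
    show "vectorspace K ((ce_C2 K L)\<lparr>carrier := ce_Z2 K L\<rparr>)" by (rule Z)
    then show "Module.module K ((ce_C2 K L)\<lparr>carrier := ce_Z2 K L\<rparr>)" by (simp add: vectorspace_def)
    show "ce_B2 K L \<subseteq> carrier ((ce_C2 K L)\<lparr>carrier := ce_Z2 K L\<rparr>)"
      by (auto simp: ce_B2_def ce_d1_in_Z2)
    have "(\<lambda>x\<in>carrier L. \<zero>\<^bsub>L\<^esub>) \<in> ce_C1 K L"
      by (auto simp: ce_C1_def LinearCombinations.module_hom_def)
    moreover have "ce_d1 L (\<lambda>x\<in>carrier L. \<zero>\<^bsub>L\<^esub>) = \<zero>\<^bsub>ce_C2 K L\<^esub>"
      by (auto simp: ce_d1_def ce_C2_def lie_0 lie_closed M.minus_eq M.minus_zero_eq fun_eq_iff restrict_def)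
    ultimately show "\<zero>\<^bsub>(ce_C2 K L)\<lparr>carrier := ce_Z2 K L\<rparr>\<^esub> \<in> ce_B2 K L"
      by (auto simp: ce_B2_def intro: rev_image_eqI)
  next
    fix f g assume "f \<in> ce_B2 K L" "g \<in> ce_B2 K L"
    then obtain \<phi> \<psi> where fg: "\<phi> \<in> ce_C1 K L" "\<psi> \<in> ce_C1 K L" "f = ce_d1 L \<phi>" "g = ce_d1 L \<psi>"
      by (auto simp: ce_B2_def)
    have "(\<lambda>x\<in>carrier L. \<phi> x \<oplus>\<^bsub>L\<^esub> \<psi> x) \<in> ce_C1 K L"
      using fg(1,2) cl[OF fg(1)] cl[OF fg(2)]
      by (auto simp: ce_C1_def LinearCombinations.module_hom_def M.a_ac smult_r_distr)
    moreover have "ce_d1 L (\<lambda>x\<in>carrier L. \<phi> x \<oplus>\<^bsub>L\<^esub> \<psi> x) = f \<oplus>\<^bsub>ce_C2 K L\<^esub> g"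
      using cl[OF fg(1)] cl[OF fg(2)] unfolding fg(3,4)
      by (auto simp: ce_d1_def ce_C2_def lie_closed lie_add_right M.minus_eq M.minus_add M.a_ac
          fun_eq_iff restrict_def)
    ultimately show "f \<oplus>\<^bsub>(ce_C2 K L)\<lparr>carrier := ce_Z2 K L\<rparr>\<^esub> g \<in> ce_B2 K L"
      by (auto simp: ce_B2_def intro: rev_image_eqI)
  next
    fix c f assume c: "c \<in> carrier K" and "f \<in> ce_B2 K L"
    then obtain \<phi> where f: "\<phi> \<in> ce_C1 K L" "f = ce_d1 L \<phi>" by (auto simp: ce_B2_def)
    have smc: "c \<odot>\<^bsub>L\<^esub> (b \<odot>\<^bsub>L\<^esub> x) = b \<odot>\<^bsub>L\<^esub> (c \<odot>\<^bsub>L\<^esub> x)" if "b \<in> carrier K" "x \<in> carrier L" for b x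
      using that c by (metis smult_assoc1 R.m_comm)
    have "(\<lambda>x\<in>carrier L. c \<odot>\<^bsub>L\<^esub> \<phi> x) \<in> ce_C1 K L"
      using f(1) cl[OF f(1)] c
      by (auto simp: ce_C1_def LinearCombinations.module_hom_def smult_r_distr smc)
    moreover have "ce_d1 L (\<lambda>x\<in>carrier L. c \<odot>\<^bsub>L\<^esub> \<phi> x) = c \<odot>\<^bsub>ce_C2 K L\<^esub> f"
      using cl[OF f(1)] c unfolding f(2)
      by (auto simp: ce_d1_def ce_C2_def lie_closed lie_smult_right smult_minus fun_eq_iff restrict_def)
    ultimately show "c \<odot>\<^bsub>(ce_C2 K L)\<lparr>carrier := ce_Z2 K L\<rparr>\<^esub> f \<in> ce_B2 K L"
      by (auto simp: ce_B2_def intro: rev_image_eqI)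
  qed
qed

lemma (in lie_algebra) ce_H2_vectorspace: "vectorspace K (ce_H2 K L)"
  unfolding ce_H2_def
  by (rule quotient_vectorspace[OF subspace.vs[OF ce_B2_subspace] ce_B2_subspace])

lemma finite_cga_gens: "finite (cga_gens l)"
proof -
  have "{i. real i \<le> 2 * l} \<subseteq> {..nat \<lfloor>2 * l\<rfloor>}" by (auto simp: le_nat_floor)
  then have "finite {i. real i \<le> 2 * l}" by (rule finite_subset) simp
  then show ?thesis by (simp add: cga_gens_def)
qed

lemma cga_vectorspace: "vectorspace class_ring (cga l)"
proof -
  have "abelian_group (cga l)"
  proof (rule abelian_groupI)
    fix x assume x: "x \<in> carrier (cga l)"
    then show "\<exists>y\<in>carrier (cga l). y \<oplus>\<^bsub>cga l\<^esub> x = \<zero>\<^bsub>cga l\<^esub>"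
      by (intro bexI[of _ "\<lambda>a. - x a"]) (auto simp: cga_def)
  qed (auto simp: cga_def algebra_simps)
  then have "module class_ring (cga l)"
    by (intro moduleI class_cring.is_cring) (auto simp: cga_def algebra_simps)
  then show ?thesis
    by (simp add: vectorspace_def class_field)
qed

lemma cga_struct_cases:
  "cga_struct l gC gD = cga_term 2 gC" "cga_struct l gD gC = cga_term (- 2) gC"
  "cga_struct l gC gH = cga_term 1 gD" "cga_struct l gH gC = cga_term (- 1) gD"
  "cga_struct l gD gH = cga_term 2 gH" "cga_struct l gH gD = cga_term (- 2) gH"
  "cga_struct l gC gM = cga_term 0 gM" "cga_struct l gM gC = cga_term 0 gM"
  "cga_struct l gD gM = cga_term 0 gM" "cga_struct l gM gD = cga_term 0 gM"
  "cga_struct l gH gM = cga_term 0 gM" "cga_struct l gM gH = cga_term 0 gM"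
  "cga_struct l a a = cga_term 0 gM"
  "cga_struct l gM (gP i) = cga_term (- 1) (gQ i)" "cga_struct l (gP i) gM = cga_term 1 (gQ i)"
  "cga_struct l gM (gQ i) = cga_term 1 (gP i)" "cga_struct l (gQ i) gM = cga_term (- 1) (gP i)"
  "cga_struct l gH (gP i) = cga_term (- of_nat i) (gP (i - 1))"
  "cga_struct l (gP i) gH = cga_term (of_nat i) (gP (i - 1))"
  "cga_struct l gH (gQ i) = cga_term (- of_nat i) (gQ (i - 1))"
  "cga_struct l (gQ i) gH = cga_term (of_nat i) (gQ (i - 1))"
  "cga_struct l gD (gP i) = cga_term (of_real (2 * (l - real i))) (gP i)"
  "cga_struct l (gP i) gD = cga_term (- of_real (2 * (l - real i))) (gP i)"
  "cga_struct l gD (gQ i) = cga_term (of_real (2 * (l - real i))) (gQ i)"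
  "cga_struct l (gQ i) gD = cga_term (- of_real (2 * (l - real i))) (gQ i)"
  "cga_struct l gC (gP i) = cga_term (of_real (2 * l - real i)) (gP (i + 1))"
  "cga_struct l (gP i) gC = cga_term (- of_real (2 * l - real i)) (gP (i + 1))"
  "cga_struct l gC (gQ i) = cga_term (of_real (2 * l - real i)) (gQ (i + 1))"
  "cga_struct l (gQ i) gC = cga_term (- of_real (2 * l - real i)) (gQ (i + 1))"
  "cga_struct l (gP i) (gP j) = cga_term 0 gM" "cga_struct l (gQ i) (gQ j) = cga_term 0 gM"
  "cga_struct l (gP i) (gQ j) = cga_term 0 gM" "cga_struct l (gQ i) (gP j) = cga_term 0 gM"
  by (auto simp: cga_struct_def cga_term_def fun_eq_iff)

lemma cga_struct_outside:
  assumes l: "2 * l \<in> \<nat>" and "a \<in> cga_gens l" "b \<in> cga_gens l" "c \<notin> cga_gens l"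
  shows "cga_struct l a b c = 0"
proof -
  obtain n where n: "2 * l = real n" using l by (auto simp: Nats_def)
  show ?thesis
    using assms(2-) n
    by (cases a; cases b) (auto simp: cga_struct_cases cga_term_def cga_gens_def)
qed

lemma cga_term_sum:
  assumes "k \<noteq> 0 \<Longrightarrow> g \<in> cga_gens l"
  shows "(\<Sum>d\<in>cga_gens l. cga_term k g d * h d) = k * h g"
  using assms finite_cga_gens[of l]
  by (cases "k = 0") (auto simp: cga_term_def if_distrib[of "\<lambda>t. t * _"] cong: if_cong)

lemma cga_gen_cases:
  obtains "a = gC" | "a = gD" | "a = gH" | "a = gM"
    | "a = gP 0" | i where "a = gP (Suc i)" | "a = gQ 0" | i where "a = gQ (Suc i)"
  by (metis cga_gen.exhaust not0_implies_Suc)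

text \<open>The sums over the basis below collapse, since a bracket of basis elements is a multiple of
  a single basis element.\<close>

lemma cga_struct_sum:
  fixes h :: "cga_gen \<Rightarrow> complex"
  assumes l: "2 * l \<in> \<nat>"
  defines "S a b \<equiv> \<Sum>d\<in>cga_gens l. cga_struct l a b d * h d"
  shows "S gC gD = 2 * h gC" "S gD gC = - 2 * h gC" "S gC gH = h gD" "S gH gC = - h gD"
    "S gD gH = 2 * h gH" "S gH gD = - 2 * h gH"
    "S gC gM = 0" "S gM gC = 0" "S gD gM = 0" "S gM gD = 0" "S gH gM = 0" "S gM gH = 0" "S a a = 0"
    "S (gP i) (gP j) = 0" "S (gQ i) (gQ j) = 0" "S (gP i) (gQ j) = 0" "S (gQ i) (gP j) = 0"
    "gP i \<in> cga_gens l \<Longrightarrow> S gM (gP i) = - h (gQ i)"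
    "gP i \<in> cga_gens l \<Longrightarrow> S (gP i) gM = h (gQ i)"
    "gQ i \<in> cga_gens l \<Longrightarrow> S gM (gQ i) = h (gP i)"
    "gQ i \<in> cga_gens l \<Longrightarrow> S (gQ i) gM = - h (gP i)"
    "gP i \<in> cga_gens l \<Longrightarrow> S gH (gP i) = - of_nat i * h (gP (i - 1))"
    "gP i \<in> cga_gens l \<Longrightarrow> S (gP i) gH = of_nat i * h (gP (i - 1))"
    "gQ i \<in> cga_gens l \<Longrightarrow> S gH (gQ i) = - of_nat i * h (gQ (i - 1))"
    "gQ i \<in> cga_gens l \<Longrightarrow> S (gQ i) gH = of_nat i * h (gQ (i - 1))"
    "gP i \<in> cga_gens l \<Longrightarrow> S gD (gP i) = of_real (2 * (l - real i)) * h (gP i)"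
    "gP i \<in> cga_gens l \<Longrightarrow> S (gP i) gD = - of_real (2 * (l - real i)) * h (gP i)"
    "gQ i \<in> cga_gens l \<Longrightarrow> S gD (gQ i) = of_real (2 * (l - real i)) * h (gQ i)"
    "gQ i \<in> cga_gens l \<Longrightarrow> S (gQ i) gD = - of_real (2 * (l - real i)) * h (gQ i)"
    "gP i \<in> cga_gens l \<Longrightarrow> S gC (gP i) = of_real (2 * l - real i) * h (gP (i + 1))"
    "gP i \<in> cga_gens l \<Longrightarrow> S (gP i) gC = - of_real (2 * l - real i) * h (gP (i + 1))"
    "gQ i \<in> cga_gens l \<Longrightarrow> S gC (gQ i) = of_real (2 * l - real i) * h (gQ (i + 1))"
    "gQ i \<in> cga_gens l \<Longrightarrow> S (gQ i) gC = - of_real (2 * l - real i) * h (gQ (i + 1))"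
proof -
  obtain n where n: "2 * l = real n" using l by (auto simp: Nats_def)
  have mem: "gC \<in> cga_gens l" "gD \<in> cga_gens l" "gH \<in> cga_gens l" "gM \<in> cga_gens l"
    "\<And>i. gP i \<in> cga_gens l \<longleftrightarrow> i \<le> n" "\<And>i. gQ i \<in> cga_gens l \<longleftrightarrow> i \<le> n"
    by (auto simp: cga_gens_def n)
  have up: "i = n \<or> Suc i \<le> n" if "i \<le> n" for i using that by auto
  have k: "complex_of_real (2 * l - real i) = of_nat n - of_nat i" for i
    unfolding n by simp
  note [simp] = mem k n
  show "S gC gD = 2 * h gC" "S gD gC = - 2 * h gC" "S gC gH = h gD" "S gH gC = - h gD"
    "S gD gH = 2 * h gH" "S gH gD = - 2 * h gH"
    "S gC gM = 0" "S gM gC = 0" "S gD gM = 0" "S gM gD = 0" "S gH gM = 0" "S gM gH = 0" "S a a = 0"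
    "S (gP i) (gP j) = 0" "S (gQ i) (gQ j) = 0" "S (gP i) (gQ j) = 0" "S (gQ i) (gP j) = 0"
    unfolding S_def cga_struct_cases by (subst cga_term_sum; simp)+
  show "S gM (gP i) = - h (gQ i)" "S (gP i) gM = h (gQ i)"
    "S gH (gP i) = - of_nat i * h (gP (i - 1))" "S (gP i) gH = of_nat i * h (gP (i - 1))"
    "S gD (gP i) = of_real (2 * (l - real i)) * h (gP i)"
    "S (gP i) gD = - of_real (2 * (l - real i)) * h (gP i)"
    "S gC (gP i) = of_real (2 * l - real i) * h (gP (i + 1))"
    "S (gP i) gC = - of_real (2 * l - real i) * h (gP (i + 1))" if "gP i \<in> cga_gens l"
    unfolding S_def cga_struct_cases by (subst cga_term_sum; use that up[of i] in auto)+
  show "S gM (gQ i) = h (gP i)" "S (gQ i) gM = - h (gP i)"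
    "S gH (gQ i) = - of_nat i * h (gQ (i - 1))" "S (gQ i) gH = of_nat i * h (gQ (i - 1))"
    "S gD (gQ i) = of_real (2 * (l - real i)) * h (gQ i)"
    "S (gQ i) gD = - of_real (2 * (l - real i)) * h (gQ i)"
    "S gC (gQ i) = of_real (2 * l - real i) * h (gQ (i + 1))"
    "S (gQ i) gC = - of_real (2 * l - real i) * h (gQ (i + 1))" if "gQ i \<in> cga_gens l"
    unfolding S_def cga_struct_cases by (subst cga_term_sum; use that up[of i] in auto)+
qed

lemma cga_struct_jacobi:
  assumes l: "2 * l \<in> \<nat>" and abc: "a \<in> cga_gens l" "b \<in> cga_gens l" "c \<in> cga_gens l"
  shows "(\<Sum>d\<in>cga_gens l. cga_struct l b c d * cga_struct l a d e)
       + (\<Sum>d\<in>cga_gens l. cga_struct l c a d * cga_struct l b d e)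
       + (\<Sum>d\<in>cga_gens l. cga_struct l a b d * cga_struct l c d e) = 0"
proof -
  obtain n where n: "2 * l = real n" using l by (auto simp: Nats_def)
  have l2: "l = real n / 2" using n by simp
  have mem: "gC \<in> cga_gens l" "gD \<in> cga_gens l" "gH \<in> cga_gens l" "gM \<in> cga_gens l"
    "\<And>i. gP i \<in> cga_gens l \<longleftrightarrow> i \<le> n" "\<And>i. gQ i \<in> cga_gens l \<longleftrightarrow> i \<le> n"
    by (auto simp: cga_gens_def n)
  show ?thesis
    using abc
    by (cases a rule: cga_gen_cases; cases b rule: cga_gen_cases; cases c rule: cga_gen_cases;
        simp add: cga_struct_sum[OF l] mem; simp add: cga_struct_cases cga_term_def)
      (auto simp add: algebra_simps l2)
qed

lemma cga_term_closed: "b \<in> cga_gens l \<Longrightarrow> cga_term c b \<in> carrier (cga l)"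
  by (auto simp: cga_def cga_term_def)

lemma cga_bracket_gens:
  assumes "a \<in> cga_gens l" "b \<in> cga_gens l"
  shows "\<langle>cga_term 1 a, cga_term 1 b\<rangle>\<^bsub>cga l\<^esub> = cga_struct l a b"
  using assms finite_cga_gens[of l]
  by (simp add: cga_def cga_term_def if_distrib[of "\<lambda>t. t * _"] if_distrib[of "\<lambda>t. _ * t"]
      sum.If_cases cong: if_cong)

lemma cga_lie_algebra:
  assumes l: "2 * l \<in> \<nat>"
  shows "lie_algebra class_ring (cga l)"
proof -
  interpret vectorspace class_ring "cga l" by (rule cga_vectorspace)
  let ?S = "cga_gens l"
  let ?\<beta> = "cga_struct l"
  have anti: "?\<beta> a b c = - ?\<beta> b a c" for a b c by (simp add: cga_struct_def)
  have nest: "(\<Sum>a\<in>?S. \<Sum>d\<in>?S. x a * (\<Sum>b\<in>?S. \<Sum>c\<in>?S. y b * z c * ?\<beta> b c d) * ?\<beta> a d e)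
      = (\<Sum>a\<in>?S. \<Sum>b\<in>?S. \<Sum>c\<in>?S. x a * y b * z c * (\<Sum>d\<in>?S. ?\<beta> b c d * ?\<beta> a d e))"
    for x y z e
  proof -
    have "(\<Sum>d\<in>?S. x a * (\<Sum>b\<in>?S. \<Sum>c\<in>?S. y b * z c * ?\<beta> b c d) * ?\<beta> a d e)
        = (\<Sum>b\<in>?S. \<Sum>c\<in>?S. x a * y b * z c * (\<Sum>d\<in>?S. ?\<beta> b c d * ?\<beta> a d e))" for a
    proof -
      have "(\<Sum>d\<in>?S. x a * (\<Sum>b\<in>?S. \<Sum>c\<in>?S. y b * z c * ?\<beta> b c d) * ?\<beta> a d e)
          = (\<Sum>d\<in>?S. \<Sum>b\<in>?S. \<Sum>c\<in>?S. x a * y b * z c * (?\<beta> b c d * ?\<beta> a d e))"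
        by (simp add: sum_distrib_left sum_distrib_right mult_ac)
      also have "\<dots> = (\<Sum>b\<in>?S. \<Sum>d\<in>?S. \<Sum>c\<in>?S. x a * y b * z c * (?\<beta> b c d * ?\<beta> a d e))"
        by (rule sum.swap)
      also have "\<dots> = (\<Sum>b\<in>?S. \<Sum>c\<in>?S. \<Sum>d\<in>?S. x a * y b * z c * (?\<beta> b c d * ?\<beta> a d e))"
        by (intro sum.cong refl sum.swap)
      finally show ?thesis by (simp add: sum_distrib_left)
    qed
    then show ?thesis by simp
  qed
  show ?thesis
  proof
    fix x y assume "x \<in> carrier (cga l)" "y \<in> carrier (cga l)"
    then show "\<langle>x, y\<rangle>\<^bsub>cga l\<^esub> \<in> carrier (cga l)"
      by (auto simp: cga_def cga_struct_outside[OF l] intro!: sum.neutral)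
  next
    fix x assume "x \<in> carrier (cga l)"
    have "(\<Sum>a\<in>?S. \<Sum>b\<in>?S. x a * x b * ?\<beta> a b c) = 0" for c
    proof -
      have "(\<Sum>a\<in>?S. \<Sum>b\<in>?S. x a * x b * ?\<beta> a b c) = (\<Sum>b\<in>?S. \<Sum>a\<in>?S. x a * x b * ?\<beta> a b c)"
        by (rule sum.swap)
      also have "\<dots> = - (\<Sum>a\<in>?S. \<Sum>b\<in>?S. x a * x b * ?\<beta> a b c)"
        by (subst anti) (simp add: sum_negf mult_ac)
      finally show ?thesis by simp
    qed
    then show "\<langle>x, x\<rangle>\<^bsub>cga l\<^esub> = \<zero>\<^bsub>cga l\<^esub>" by (simp add: cga_def)
  next
    fix x y z
    have rot: "(\<Sum>a\<in>?S. \<Sum>b\<in>?S. \<Sum>c\<in>?S. F a b c) = (\<Sum>c\<in>?S. \<Sum>a\<in>?S. \<Sum>b\<in>?S. F a b c)"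
      for F :: "cga_gen \<Rightarrow> cga_gen \<Rightarrow> cga_gen \<Rightarrow> complex"
      by (subst (2) sum.swap, subst sum.swap) (rule refl)
    let ?J = "\<lambda>a b c e. \<Sum>d\<in>?S. ?\<beta> b c d * ?\<beta> a d e"
    have "(\<Sum>a\<in>?S. \<Sum>b\<in>?S. \<Sum>c\<in>?S. x a * y b * z c * ?J a b c e)
        + (\<Sum>b\<in>?S. \<Sum>c\<in>?S. \<Sum>a\<in>?S. y b * z c * x a * ?J b c a e)
        + (\<Sum>c\<in>?S. \<Sum>a\<in>?S. \<Sum>b\<in>?S. z c * x a * y b * ?J c a b e) = 0" (is "?A + ?B + ?C = 0") for e
    proof -
      have "?B = (\<Sum>a\<in>?S. \<Sum>b\<in>?S. \<Sum>c\<in>?S. x a * y b * z c * ?J b c a e)"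
        by (subst rot) (simp add: mult_ac)
      moreover have "?C = (\<Sum>a\<in>?S. \<Sum>b\<in>?S. \<Sum>c\<in>?S. x a * y b * z c * ?J c a b e)"
        by (subst rot[symmetric]) (simp add: mult_ac)
      ultimately have "?A + ?B + ?C = (\<Sum>a\<in>?S. \<Sum>b\<in>?S. \<Sum>c\<in>?S.
          x a * y b * z c * (?J a b c e + ?J b c a e + ?J c a b e))"
        by (simp add: sum.distrib distrib_left)
      also have "\<dots> = 0"
        by (intro sum.neutral ballI) (simp add: cga_struct_jacobi[OF l])
      finally show ?thesis .
    qed
    then show "\<langle>x, \<langle>y, z\<rangle>\<^bsub>cga l\<^esub>\<rangle>\<^bsub>cga l\<^esub> \<oplus>\<^bsub>cga l\<^esub> \<langle>y, \<langle>z, x\<rangle>\<^bsub>cga l\<^esub>\<rangle>\<^bsub>cga l\<^esub>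
        \<oplus>\<^bsub>cga l\<^esub> \<langle>z, \<langle>x, y\<rangle>\<^bsub>cga l\<^esub>\<rangle>\<^bsub>cga l\<^esub> = \<zero>\<^bsub>cga l\<^esub>"
      by (simp add: cga_def nest)
  qed (auto simp: cga_def fun_eq_iff distrib_left distrib_right sum.distrib sum_distrib_left mult_ac)
qed

lemma card_cga_gens:
  assumes "2 * l \<in> \<nat>"
  shows "real (card (cga_gens l)) = 4 * l + 6"
proof -
  obtain n where n: "2 * l = real n" using assms by (auto simp: Nats_def)
  have "{i. real i \<le> 2 * l} = {..n}" by (auto simp: n)
  then have "cga_gens l = {gC, gD, gH, gM} \<union> (gP ` {..n} \<union> gQ ` {..n})"
    by (simp only: cga_gens_def Un_assoc)
  moreover have "card (gP ` {..n} \<union> gQ ` {..n}) = 2 * n + 2"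
    by (subst card_Un_disjoint) (auto simp: card_image inj_on_def)
  moreover have "{gC, gD, gH, gM} \<inter> (gP ` {..n} \<union> gQ ` {..n}) = {}" by auto
  ultimately have "card (cga_gens l) = 4 + (2 * n + 2)" by (simp add: card_Un_disjoint)
  then show ?thesis using n by simp
qed

lemma cga_H2_vectorspace:
  "2 * l \<in> \<nat> \<Longrightarrow> vectorspace class_ring (ce_H2 class_ring (cga l))"
  by (rule lie_algebra.ce_H2_vectorspace[OF cga_lie_algebra])

end

theory Submission
  imports Defs
begin

text \<open>Put \<open>n = 2 l\<close> and \<open>R\<^sup>\<plusminus>\<^sub>i = P\<^sub>i \<plusminus> \<i> Q\<^sub>i\<close>. The algebra is
  \<open>r \<ltimes> V\<close> with \<open>r = sl\<^sub>2 \<oplus> \<complex>M\<close> reductive, and the abelian ideal \<open>V\<close> is the sum of two copies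
  \<open>V\<^sup>\<plusminus>\<close> of the \<open>(n + 1)\<close>-dimensional irreducible \<open>sl\<^sub>2\<close>-module, on which \<open>M\<close> acts by
  \<open>\<plusminus>\<i>\<close>. Up to coboundaries a cocycle can therefore be made \<open>r\<close>-invariant, and two kinds of classes
  remain.

  The first kind lets \<open>M\<close> act on \<open>V\<close> with an additional multiple of the identity. Invariant endomorphisms of
  \<open>V\<close> scale \<open>V\<^sup>+\<close> and \<open>V\<^sup>-\<close> separately, but scaling them by opposite numbers only replaces \<open>M\<close> by a
  multiple, so this contributes one dimension for every \<open>l\<close>.

  The second kind is an invariant map \<open>V\<^sup>+ \<times> V\<^sup>- \<rightarrow> r\<close>. It is determined by its value \<open>a D + b M\<close> on
  \<open>(R\<^sup>+\<^sub>0, R\<^sup>-\<^sub>n)\<close>, and invariance together with the cocycle identity on triples in \<open>V\<close> gives linear relations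
  between \<open>a\<close> and \<open>b\<close>.
  For \<open>n \<le> 2\<close> they leave a line, on which \<open>b\<close> is a coordinate; for \<open>n \<ge> 3\<close> the vector \<open>a D + b M\<close> has to
  annihilate both \<open>R\<^sup>+\<^sub>2\<close> and \<open>R\<^sup>+\<^sub>3\<close>, on which \<open>D\<close> has different eigenvalues, and hence vanishes. The
  surviving classes for \<open>n = 0, 1, 2\<close> are the first-order terms of deformations of the algebra into
  \<open>sl\<^sub>2 \<oplus> sl\<^sub>2\<close>, \<open>sl\<^sub>3\<close> and \<open>so\<^sub>5\<close>.

  The reduction to invariant cocycles is carried out by hand, in coordinates with respect to the eigenbasis. The
  torus element \<open>D + M\<close> acts diagonally, so Cartan's homotopy formula removes every component of
  nonzero weight (\<open>weight_zero_representative\<close>). A weight-preserving cochain then normalises finitely many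
  coefficients, and the cocycle identities force a normalised cocycle without class to vanish
  (\<open>normalised_cocycle_zero\<close>). Two linear functionals that vanish on coboundaries detect the two classes;
  \<open>cocycle_is_coboundary\<close> says that they detect everything.\<close>

section \<open>The dimension of a quotient\<close>

text \<open>Composed with the projection, \<open>s\<close> is a linear isomorphism from \<open>U\<close> onto the quotient: \<open>U\<close> parametrises
  representatives of the cosets.\<close>

lemma quotient_dim_by_section:
  assumes V: "vectorspace K V" and W: "subspace K W V"
    and U: "vectorspace K U" "vectorspace.fin_dim K U"
    and s: "s \<in> LinearCombinations.module_hom K U V"
    and onto: "\<And>v. v \<in> carrier V \<Longrightarrow> \<exists>u\<in>carrier U. v \<ominus>\<^bsub>V\<^esub> s u \<in> W"
    and inj: "\<And>u. u \<in> carrier U \<Longrightarrow> s u \<in> W \<Longrightarrow> u = \<zero>\<^bsub>U\<^esub>"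
  shows "vectorspace.fin_dim K (quotient_module V W) \<and>
    vectorspace.dim K (quotient_module V W) = vectorspace.dim K U"
proof -
  interpret V: vectorspace K V by (rule V)
  interpret U: vectorspace K U by (rule U(1))
  interpret Q: vectorspace K "quotient_module V W" by (rule quotient_vectorspace[OF V W])
  have sub: "submodule K W V" using W by (simp add: subspace_def)
  have WV: "W \<subseteq> carrier V" and W0: "\<zero>\<^bsub>V\<^esub> \<in> W"
    and Wadd: "\<And>v w. \<lbrakk>v \<in> W; w \<in> W\<rbrakk> \<Longrightarrow> v \<oplus>\<^bsub>V\<^esub> w \<in> W"
    and Wsm: "\<And>c v. \<lbrakk>c \<in> carrier K; v \<in> W\<rbrakk> \<Longrightarrow> c \<odot>\<^bsub>V\<^esub> v \<in> W"
    using sub unfolding submodule_def by auto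
  have Wneg: "\<ominus>\<^bsub>V\<^esub> w \<in> W" if "w \<in> W" for w
    using Wsm[of "\<ominus>\<^bsub>K\<^esub> \<one>\<^bsub>K\<^esub>" w] that WV V.smult_minus_1[of w] by auto
  have sg: "subgroup W (add_monoid V)"
  proof (rule group.subgroupI)
    show "group (add_monoid V)" by (rule V.M.a_group)
    show "inv\<^bsub>add_monoid V\<^esub> a \<in> W" if "a \<in> W" for a
      using Wneg[OF that] by (simp add: a_inv_def)
  qed (use WV W0 Wadd in auto)
  then have "additive_subgroup W V" by (simp add: additive_subgroup_def)
  then interpret W: abelian_subgroup W V
    by (rule abelian_subgroupI3) (rule V.M.abelian_group_axioms)
  have coset_eq: "W +>\<^bsub>V\<^esub> x = W +>\<^bsub>V\<^esub> y" if "x \<in> carrier V" "y \<in> carrier V" "x \<ominus>\<^bsub>V\<^esub> y \<in> W" for x y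
  proof -
    have "x = (x \<ominus>\<^bsub>V\<^esub> y) \<oplus>\<^bsub>V\<^esub> y" using that by (simp add: V.M.minus_eq V.M.a_assoc V.M.l_neg)
    then have "x \<in> W +>\<^bsub>V\<^esub> y" using that(3) by (auto simp: a_r_coset_def')
    then show ?thesis using V.M.a_repr_independence[OF _ that(2) sg] by simp
  qed
  have in_W: "x \<in> W" if "x \<in> carrier V" "W +>\<^bsub>V\<^esub> x = W" for x
    using that W.a_rcos_self by blast
  have sc: "s u \<in> carrier V" if "u \<in> carrier U" for u
    using s that by (auto simp: LinearCombinations.module_hom_def)
  have smult: "c \<odot>\<^bsub>quotient_module V W\<^esub> (W +>\<^bsub>V\<^esub> x) = W +>\<^bsub>V\<^esub> (c \<odot>\<^bsub>V\<^esub> x)"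
    if cx: "c \<in> carrier K" "x \<in> carrier V" for c x
  proof -
    have eq: "W +>\<^bsub>V\<^esub> (c \<odot>\<^bsub>V\<^esub> y) = W +>\<^bsub>V\<^esub> (c \<odot>\<^bsub>V\<^esub> x)" if y: "y \<in> W +>\<^bsub>V\<^esub> x" for y
    proof -
      obtain w where w: "w \<in> W" "y = w \<oplus>\<^bsub>V\<^esub> x" using y by (auto simp: a_r_coset_def')
      have "c \<odot>\<^bsub>V\<^esub> y \<ominus>\<^bsub>V\<^esub> c \<odot>\<^bsub>V\<^esub> x = c \<odot>\<^bsub>V\<^esub> w"
        using w WV cx
        by (simp add: subset_iff V.smult_r_distr V.M.minus_eq V.M.a_assoc V.M.r_neg)
      then show ?thesis
        using w WV cx Wsm[OF cx(1) w(1)] by (intro coset_eq) auto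
    qed
    have "(\<Union>y\<in>W +>\<^bsub>V\<^esub> x. W +>\<^bsub>V\<^esub> (c \<odot>\<^bsub>V\<^esub> y)) = (\<Union>y\<in>W +>\<^bsub>V\<^esub> x. W +>\<^bsub>V\<^esub> (c \<odot>\<^bsub>V\<^esub> x))"
      by (rule SUP_cong[OF refl eq])
    moreover have "x \<in> W +>\<^bsub>V\<^esub> x" using W.a_rcos_self cx by simp
    ultimately show ?thesis unfolding quotient_module_def by simp blast
  qed
  let ?T = "\<lambda>u. W +>\<^bsub>V\<^esub> s u"
  have "?T \<in> LinearCombinations.module_hom K U (quotient_module V W)"
    unfolding LinearCombinations.module_hom_def
  proof (intro CollectI conjI Pi_I allI impI; (elim conjE)?)
    fix u assume "u \<in> carrier U"
    then show "?T u \<in> carrier (quotient_module V W)"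
      using sc by (auto simp: quotient_module_def A_RCOSETS_def')
  next
    fix u v assume "u \<in> carrier U" "v \<in> carrier U"
    then show "?T (u \<oplus>\<^bsub>U\<^esub> v) = ?T u \<oplus>\<^bsub>quotient_module V W\<^esub> ?T v"
      using s sc by (simp add: LinearCombinations.module_hom_def quotient_module_def W.a_rcos_sum)
  next
    fix c u assume "c \<in> carrier K" "u \<in> carrier U"
    then show "?T (c \<odot>\<^bsub>U\<^esub> u) = c \<odot>\<^bsub>quotient_module V W\<^esub> ?T u"
      using s sc by (simp add: LinearCombinations.module_hom_def smult)
  qed
  then interpret T: linear_map K U "quotient_module V W" ?T
    by unfold_locales
  have surj: "?T ` carrier U = carrier (quotient_module V W)"
  proof
    show "?T ` carrier U \<subseteq> carrier (quotient_module V W)" by auto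
    show "carrier (quotient_module V W) \<subseteq> ?T ` carrier U"
    proof
      fix X assume "X \<in> carrier (quotient_module V W)"
      then obtain v where v: "v \<in> carrier V" "X = W +>\<^bsub>V\<^esub> v"
        by (auto simp: quotient_module_def A_RCOSETS_def')
      with onto obtain u where "u \<in> carrier U" "v \<ominus>\<^bsub>V\<^esub> s u \<in> W" by blast
      with v sc show "X \<in> ?T ` carrier U" using coset_eq by blast
    qed
  qed
  have zero: "\<zero>\<^bsub>quotient_module V W\<^esub> = W" by (simp add: quotient_module_def)
  have inj_T: "inj_on ?T (carrier U)"
  proof (rule T.Ke0_imp_inj)
    have "u = \<zero>\<^bsub>U\<^esub>" if "u \<in> carrier U" "?T u = W" for u
      using that inj in_W sc by blast
    moreover have "?T \<zero>\<^bsub>U\<^esub> = W" using T.f0_is_0 by (simp add: zero)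
    ultimately show "carrier (U.vs T.kerT) = {\<zero>\<^bsub>U\<^esub>}"
      by (auto simp: T.ker_def zero)
  qed
  show ?thesis using T.surj_fin_dim[OF U(2) surj] T.dim_eq[OF U(2) inj_T surj] by simp
qed

section \<open>Adjoint cochains in coordinates\<close>

text \<open>The coordinate \<open>k\<close> of the Chevalley--Eilenberg differential of a 2-cochain on three basis elements, where
  \<open>t a b\<close> and \<open>F a b\<close> are the coordinate vectors of the bracket and of the cochain.\<close>

definition cocycle_defect :: "'i set \<Rightarrow> ('i \<Rightarrow> 'i \<Rightarrow> 'i \<Rightarrow> 'k::field)
    \<Rightarrow> ('i \<Rightarrow> 'i \<Rightarrow> 'i \<Rightarrow> 'k) \<Rightarrow> 'i \<Rightarrow> 'i \<Rightarrow> 'i \<Rightarrow> 'i \<Rightarrow> 'k" where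
  "cocycle_defect I t F a b c k =
      (\<Sum>d\<in>I. F b c d * t a d k) - (\<Sum>d\<in>I. F a c d * t b d k) + (\<Sum>d\<in>I. F a b d * t c d k)
    - (\<Sum>d\<in>I. t a b d * F d c k) + (\<Sum>d\<in>I. t a c d * F d b k) - (\<Sum>d\<in>I. t b c d * F d a k)"

definition coboundary :: "'i set \<Rightarrow> ('i \<Rightarrow> 'i \<Rightarrow> 'i \<Rightarrow> 'k::field)
    \<Rightarrow> ('i \<Rightarrow> 'i \<Rightarrow> 'k) \<Rightarrow> 'i \<Rightarrow> 'i \<Rightarrow> 'i \<Rightarrow> 'k" where
  "coboundary I t \<psi> a b k =
      (\<Sum>d\<in>I. \<psi> b d * t a d k) - (\<Sum>d\<in>I. \<psi> a d * t b d k) - (\<Sum>d\<in>I. t a b d * \<psi> d k)"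

definition alternating_on :: "'i set \<Rightarrow> ('i \<Rightarrow> 'i \<Rightarrow> 'i \<Rightarrow> 'k::field) \<Rightarrow> bool" where
  "alternating_on I F \<longleftrightarrow> (\<forall>a\<in>I. \<forall>b\<in>I. \<forall>k\<in>I. F a a k = 0 \<and> F a b k = - F b a k)"

text \<open>A basis is encoded by the mutually inverse maps between vectors and coordinate families: \<open>mk\<close> builds the vector
  with given coordinates, and vectors with equal coordinates are equal. No linear combinations in \<open>L\<close> have to be
  formed.\<close>

locale lie_coordinates = lie_algebra class_ring L
  for L :: "('k::field, 'v, 'm) lie_alg_scheme" (structure) +
  fixes I :: "'i set" and co :: "'v \<Rightarrow> 'i \<Rightarrow> 'k" and mk :: "('i \<Rightarrow> 'k) \<Rightarrow> 'v"
  assumes finite_I: "finite I"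
    and mk_closed: "mk u \<in> carrier L"
    and co_mk: "i \<in> I \<Longrightarrow> co (mk u) i = u i"
    and co_add: "\<lbrakk>x \<in> carrier L; y \<in> carrier L; i \<in> I\<rbrakk> \<Longrightarrow> co (x \<oplus> y) i = co x i + co y i"
    and co_smult: "\<lbrakk>x \<in> carrier L; i \<in> I\<rbrakk> \<Longrightarrow> co (c \<odot> x) i = c * co x i"
    and co_inject: "\<lbrakk>x \<in> carrier L; y \<in> carrier L; \<And>i. i \<in> I \<Longrightarrow> co x i = co y i\<rbrakk> \<Longrightarrow> x = y"
begin

definition e :: "'i \<Rightarrow> 'v" where "e a = mk (\<lambda>b. if b = a then 1 else 0)"

definition struct_co :: "'i \<Rightarrow> 'i \<Rightarrow> 'i \<Rightarrow> 'k" where "struct_co a b k = co \<langle>e a, e b\<rangle> k"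

definition cochain_co :: "('v \<Rightarrow> 'v \<Rightarrow> 'v) \<Rightarrow> 'i \<Rightarrow> 'i \<Rightarrow> 'i \<Rightarrow> 'k" where
  "cochain_co f a b k = co (f (e a) (e b)) k"

definition cochain_of :: "('i \<Rightarrow> 'i \<Rightarrow> 'i \<Rightarrow> 'k) \<Rightarrow> 'v \<Rightarrow> 'v \<Rightarrow> 'v" where
  "cochain_of F = (\<lambda>x\<in>carrier L. \<lambda>y\<in>carrier L.
     mk (\<lambda>k. \<Sum>a\<in>I. \<Sum>b\<in>I. co x a * co y b * F a b k))"

lemma e_closed [simp]: "e a \<in> carrier L"
  by (simp add: e_def mk_closed)

lemma co_e: "b \<in> I \<Longrightarrow> co (e a) b = (if b = a then 1 else 0)"
  by (simp add: e_def co_mk)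

lemma smult_closed_class_ring [simp]: "x \<in> carrier L \<Longrightarrow> c \<odot> x \<in> carrier L"
  by (rule smult_closed) simp

lemma co_zero: "i \<in> I \<Longrightarrow> co \<zero> i = 0"
  using co_smult[of \<zero> i 0] by simp

lemma co_uminus: "x \<in> carrier L \<Longrightarrow> i \<in> I \<Longrightarrow> co (\<ominus>\<^bsub>L\<^esub> x) i = - co x i"
  using co_add[of "\<ominus>\<^bsub>L\<^esub> x" x i] by (simp add: M.l_neg co_zero eq_neg_iff_add_eq_0)

lemma co_minus: "x \<in> carrier L \<Longrightarrow> y \<in> carrier L \<Longrightarrow> i \<in> I \<Longrightarrow> co (x \<ominus>\<^bsub>L\<^esub> y) i = co x i - co y i"
  by (simp add: M.minus_eq co_add co_uminus)

text \<open>By induction on the support of the coordinates of \<open>x\<close>; this replaces an expansion of \<open>x\<close> itself.\<close>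

lemma linear_expand:
  assumes add: "\<And>x y. \<lbrakk>x \<in> carrier L; y \<in> carrier L\<rbrakk> \<Longrightarrow> \<chi> (x \<oplus> y) = \<chi> x + (\<chi> y :: 'k)"
    and smult: "\<And>c x. x \<in> carrier L \<Longrightarrow> \<chi> (c \<odot> x) = c * \<chi> x"
    and x: "x \<in> carrier L"
  shows "\<chi> x = (\<Sum>a\<in>I. co x a * \<chi> (e a))"
proof -
  have "finite A \<Longrightarrow> A \<subseteq> I \<Longrightarrow> x \<in> carrier L \<Longrightarrow> \<forall>b\<in>I - A. co x b = 0
      \<Longrightarrow> \<chi> x = (\<Sum>a\<in>A. co x a * \<chi> (e a))" for A x
  proof (induction A arbitrary: x rule: finite_induct)
    case empty
    then have "x = \<zero>" by (intro co_inject) (auto simp: co_zero)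
    moreover have "\<chi> \<zero> = \<chi> \<zero> + \<chi> \<zero>" using add[of \<zero> \<zero>] by simp
    then have "\<chi> \<zero> = 0" by (metis add_cancel_right_left)
    ultimately show ?case by simp
  next
    case (insert a A)
    let ?y = "x \<oplus> (- co x a) \<odot> e a"
    have a: "a \<in> I" using insert.prems by simp
    have coy: "co ?y b = (if b = a then 0 else co x b)" if "b \<in> I" for b
      using that insert.prems by (simp add: co_add co_smult co_e)
    have "\<chi> ?y = (\<Sum>b\<in>A. co ?y b * \<chi> (e b))"
      using insert.prems coy by (intro insert.IH) auto
    also have "\<dots> = (\<Sum>b\<in>A. co x b * \<chi> (e b))"
      using insert.prems insert.hyps by (intro sum.cong refl) (auto simp: coy subset_iff)
    finally have "\<chi> ?y = (\<Sum>b\<in>A. co x b * \<chi> (e b))" .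
    moreover have "x = ?y \<oplus> co x a \<odot> e a"
      using insert.prems by (intro co_inject) (auto simp: co_add co_smult)
    then have "\<chi> x = \<chi> ?y + co x a * \<chi> (e a)"
      using insert.prems by (metis add smult e_closed smult_closed_class_ring M.a_closed)
    ultimately show ?case using insert.hyps by simp
  qed
  from this[OF finite_I subset_refl x] show ?thesis by simp
qed

lemma linear_eqI:
  assumes "\<And>x y. \<lbrakk>x \<in> carrier L; y \<in> carrier L\<rbrakk> \<Longrightarrow> \<chi> (x \<oplus> y) = \<chi> x + (\<chi> y :: 'k)"
    and "\<And>c x. x \<in> carrier L \<Longrightarrow> \<chi> (c \<odot> x) = c * \<chi> x"
    and "\<And>a. a \<in> I \<Longrightarrow> \<chi> (e a) = 0" and "x \<in> carrier L"
  shows "\<chi> x = 0"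
  using linear_expand[of \<chi> x] assms by simp

lemma C2_closed:
  assumes "f \<in> carrier (ce_C2 class_ring L)" "x \<in> carrier L" "y \<in> carrier L"
  shows "f x y \<in> carrier L"
  using assms by (auto simp: ce_C2_def PiE_iff)

lemma C2_bilinear:
  assumes "f \<in> carrier (ce_C2 class_ring L)"
  shows "\<lbrakk>x \<in> carrier L; y \<in> carrier L; z \<in> carrier L\<rbrakk> \<Longrightarrow> f x (y \<oplus> z) = f x y \<oplus> f x z"
    "\<lbrakk>x \<in> carrier L; y \<in> carrier L; z \<in> carrier L\<rbrakk> \<Longrightarrow> f (x \<oplus> y) z = f x z \<oplus> f y z"
    "\<lbrakk>x \<in> carrier L; y \<in> carrier L\<rbrakk> \<Longrightarrow> f x (c \<odot> y) = c \<odot> f x y"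
    "\<lbrakk>x \<in> carrier L; y \<in> carrier L\<rbrakk> \<Longrightarrow> f (c \<odot> x) y = c \<odot> f x y"
    "x \<in> carrier L \<Longrightarrow> f x x = \<zero>"
  using assms by (auto simp: ce_C2_def LinearCombinations.module_hom_def)

lemma co_bracket:
  assumes "x \<in> carrier L" "k \<in> I"
  shows "co \<langle>e a, x\<rangle> k = (\<Sum>d\<in>I. co x d * struct_co a d k)"
  using linear_expand[of "\<lambda>x. co \<langle>e a, x\<rangle> k" x] assms
  by (simp add: struct_co_def lie_add_right lie_smult_right lie_closed co_add co_smult)

lemma co_cochain:
  assumes "f \<in> carrier (ce_C2 class_ring L)" "x \<in> carrier L" "k \<in> I"
  shows "co (f x (e b)) k = (\<Sum>d\<in>I. co x d * cochain_co f d b k)"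
  using linear_expand[of "\<lambda>x. co (f x (e b)) k" x] assms
  by (simp add: cochain_co_def C2_closed C2_bilinear co_add co_smult)

lemma co_d2:
  assumes "f \<in> carrier (ce_C2 class_ring L)" "x \<in> carrier L" "y \<in> carrier L" "z \<in> carrier L" "k \<in> I"
  shows "co (ce_d2 L f x y z) k = co \<langle>x, f y z\<rangle> k - co \<langle>y, f x z\<rangle> k + co \<langle>z, f x y\<rangle> k
     - co (f \<langle>x, y\<rangle> z) k + co (f \<langle>x, z\<rangle> y) k - co (f \<langle>y, z\<rangle> x) k"
  using assms by (simp add: ce_d2_def co_add co_minus C2_closed lie_closed)

lemma co_d2_basis:
  assumes "f \<in> carrier (ce_C2 class_ring L)" "k \<in> I"
  shows "co (ce_d2 L f (e a) (e b) (e c)) k = cocycle_defect I struct_co (cochain_co f) a b c k"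
  unfolding co_d2[OF assms(1) e_closed e_closed e_closed assms(2)]
    co_bracket[OF C2_closed[OF assms(1) e_closed e_closed] assms(2)]
    co_cochain[OF assms(1) lie_closed[OF e_closed e_closed] assms(2)]
  by (simp only: cocycle_defect_def cochain_co_def struct_co_def)

lemma C2_alternating:
  assumes "f \<in> carrier (ce_C2 class_ring L)"
  shows "alternating_on I (cochain_co f)"
proof -
  have "co (f (e a) (e b)) k = - co (f (e b) (e a)) k" if "k \<in> I" for a b k
  proof -
    have "\<zero> = f (e a \<oplus> e b) (e a \<oplus> e b)" using assms by (simp add: C2_bilinear(5))
    also have "\<dots> = (\<zero> \<oplus> f (e a) (e b)) \<oplus> (f (e b) (e a) \<oplus> \<zero>)"
      using assms C2_bilinear(5)[OF assms e_closed, of a] 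
        C2_bilinear(5)[OF assms e_closed, of b]
      by (simp add: C2_bilinear(1,2) C2_closed M.a_ac)
    finally have "co \<zero> k = co ((\<zero> \<oplus> f (e a) (e b)) \<oplus> (f (e b) (e a) \<oplus> \<zero>)) k" by simp
    then show ?thesis using assms that by (simp add: co_zero co_add C2_closed eq_neg_iff_add_eq_0)
  qed
  moreover have "co (f (e a) (e a)) k = 0" if "k \<in> I" for a k
    using C2_bilinear(5)[OF assms e_closed, of a] that by (simp add: co_zero)
  ultimately show ?thesis unfolding alternating_on_def cochain_co_def by blast
qed

text \<open>The differential of a bilinear cochain is trilinear, so it may be tested on basis elements.\<close>

lemma Z2_iff:
  "f \<in> ce_Z2 class_ring L \<longleftrightarrow> f \<in> carrier (ce_C2 class_ring L) \<and>
    (\<forall>a\<in>I. \<forall>b\<in>I. \<forall>c\<in>I. \<forall>k\<in>I. cocycle_defect I struct_co (cochain_co f) a b c k = 0)"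
proof (intro iffI conjI ballI)
  fix a b c k assume "f \<in> ce_Z2 class_ring L" "k \<in> I"
  then show "cocycle_defect I struct_co (cochain_co f) a b c k = 0"
    by (auto simp: ce_Z2_def co_zero simp flip: co_d2_basis)
next
  assume f: "f \<in> carrier (ce_C2 class_ring L) \<and>
    (\<forall>a\<in>I. \<forall>b\<in>I. \<forall>c\<in>I. \<forall>k\<in>I. cocycle_defect I struct_co (cochain_co f) a b c k = 0)"
  then have C2: "f \<in> carrier (ce_C2 class_ring L)" by blast
  note lin = co_d2 C2_closed C2_bilinear(1-4) lie_closed lie_add_left lie_add_right
    lie_smult_left lie_smult_right co_add co_smult algebra_simps
  have "co (ce_d2 L f x y z) k = 0"
    if xyz: "x \<in> carrier L" "y \<in> carrier L" "z \<in> carrier L" and k: "k \<in> I" for x y z k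
  proof (rule linear_eqI[OF _ _ _ xyz(1)])
    fix a assume a: "a \<in> I"
    show "co (ce_d2 L f (e a) y z) k = 0"
    proof (rule linear_eqI[OF _ _ _ xyz(2)])
      fix b assume b: "b \<in> I"
      show "co (ce_d2 L f (e a) (e b) z) k = 0"
      proof (rule linear_eqI[OF _ _ _ xyz(3)])
        show "co (ce_d2 L f (e a) (e b) (e c)) k = 0" if "c \<in> I" for c
          using f a b k that by (simp add: co_d2_basis)
      qed (use C2 k in \<open>simp_all add: lin\<close>)
    qed (use C2 k xyz in \<open>simp_all add: lin\<close>)
  qed (use C2 k xyz in \<open>simp_all add: lin\<close>)
  then have "ce_d2 L f x y z = \<zero>" if "x \<in> carrier L" "y \<in> carrier L" "z \<in> carrier L" for x y z
    using that C2 by (intro co_inject) (simp_all add: co_zero ce_d2_def C2_closed lie_closed)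
  with C2 show "f \<in> ce_Z2 class_ring L" by (simp add: ce_Z2_def)
qed (simp add: ce_Z2_def)

lemma co_cochain_of:
  assumes "x \<in> carrier L" "y \<in> carrier L" "k \<in> I"
  shows "co (cochain_of F x y) k = (\<Sum>a\<in>I. \<Sum>b\<in>I. co x a * co y b * F a b k)"
  using assms by (simp add: cochain_of_def co_mk)

lemma cochain_of_closed:
  "x \<in> carrier L \<Longrightarrow> y \<in> carrier L \<Longrightarrow> cochain_of F x y \<in> carrier L"
  by (simp add: cochain_of_def mk_closed)

lemma cochain_co_of:
  assumes "a \<in> I" "b \<in> I" "k \<in> I"
  shows "cochain_co (cochain_of F) a b k = F a b k"
proof -
  have "(\<Sum>i\<in>I. \<Sum>j\<in>I. co (e a) i * co (e b) j * F i j k) = (\<Sum>i\<in>I. if i = a then F a b k else 0)"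
    using assms finite_I by (intro sum.cong refl) (simp add: co_e if_distrib[of "\<lambda>t. t * _"] cong: if_cong)
  then show ?thesis using assms finite_I by (simp add: cochain_co_def co_cochain_of)
qed

text \<open>Alternation on all of \<open>L\<close> holds because off-diagonal terms of the double sum cancel in pairs; this also works in
  characteristic two.\<close>

lemma cochain_of_C2:
  assumes alt: "alternating_on I F"
  shows "cochain_of F \<in> carrier (ce_C2 class_ring L)"
proof -
  have diag: "cochain_of F x x = \<zero>" if x: "x \<in> carrier L" for x
  proof (rule co_inject)
    fix k assume k: "k \<in> I"
    let ?S = "\<Sum>a\<in>I. \<Sum>b\<in>I. co x a * co x b * F a b k"
    have *: "(\<Sum>a\<in>A. \<Sum>b\<in>A. G a b) = 0"
      if "finite A" "\<forall>a\<in>A. \<forall>b\<in>A. G a b = - G b a" "\<forall>a\<in>A. G a a = 0"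
      for A and G :: "'i \<Rightarrow> 'i \<Rightarrow> 'k"
      using that
    proof (induction A rule: finite_induct)
      case (insert i A)
      have "(\<Sum>a\<in>A. G a i) = (\<Sum>a\<in>A. - G i a)"
        using insert.prems by (intro sum.cong refl) blast
      moreover have "(\<Sum>a\<in>A. \<Sum>b\<in>A. G a b) = 0" using insert.prems by (intro insert.IH) blast+
      moreover have "G i i = 0" using insert.prems by blast
      ultimately show ?case using insert.hyps by (simp add: sum.distrib sum_negf)
    qed simp
    have "?S = 0"
    proof (rule *[OF finite_I]; intro ballI)
      fix a b assume "a \<in> I" "b \<in> I"
      then have "F a b k = - F b a k" using alt k unfolding alternating_on_def by blast
      then show "co x a * co x b * F a b k = - (co x b * co x a * F b a k)" by simp
    next
      fix a assume "a \<in> I"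
      then have "F a a k = 0" using alt k unfolding alternating_on_def by blast
      then show "co x a * co x a * F a a k = 0" by simp
    qed
    then show "co (cochain_of F x x) k = co \<zero> k" using x k by (simp add: co_cochain_of co_zero)
  qed (simp_all add: cochain_of_closed x)
  have add: "cochain_of F x (y \<oplus> z) = cochain_of F x y \<oplus> cochain_of F x z"
      "cochain_of F (x \<oplus> y) z = cochain_of F x z \<oplus> cochain_of F y z"
      "cochain_of F x (c \<odot> y) = c \<odot> cochain_of F x y"
      "cochain_of F (c \<odot> x) y = c \<odot> cochain_of F x y"
    if "x \<in> carrier L" "y \<in> carrier L" "z \<in> carrier L" for x y z c
    using that by (intro co_inject; simp add: cochain_of_closed co_cochain_of co_add co_smult
        sum.distrib distrib_left distrib_right sum_distrib_left mult_ac)+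
  have "cochain_of F \<in> carrier L \<rightarrow>\<^sub>E carrier L \<rightarrow>\<^sub>E carrier L"
    by (auto simp: cochain_of_def mk_closed)
  then show ?thesis
    using diag add cochain_of_closed
    by (auto simp: ce_C2_def LinearCombinations.module_hom_def)
qed

lemma C2_eqI:
  assumes "f \<in> carrier (ce_C2 class_ring L)" "g \<in> carrier (ce_C2 class_ring L)"
    and "\<And>a b k. \<lbrakk>a \<in> I; b \<in> I; k \<in> I\<rbrakk> \<Longrightarrow> cochain_co f a b k = cochain_co g a b k"
  shows "f = g"
proof -
  have "co (f x y) k - co (g x y) k = 0" if xy: "x \<in> carrier L" "y \<in> carrier L" and k: "k \<in> I" for x y k
  proof (rule linear_eqI[OF _ _ _ xy(1)])
    fix a assume a: "a \<in> I"
    show "co (f (e a) y) k - co (g (e a) y) k = 0"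
      by (rule linear_eqI[OF _ _ _ xy(2)])
        (use assms a k in \<open>simp_all add: cochain_co_def C2_bilinear(1-4) C2_closed co_add co_smult algebra_simps\<close>)
  qed (use assms xy k in \<open>simp_all add: C2_bilinear(1-4) C2_closed co_add co_smult algebra_simps\<close>)
  then have "f x y = g x y" if "x \<in> carrier L" "y \<in> carrier L" for x y
    using that assms(1,2) by (intro co_inject) (simp_all add: C2_closed)
  then show ?thesis
    using assms(1,2) unfolding ce_C2_def
    by (intro ext) (auto simp: PiE_iff extensional_def, metis)
qed

lemma C1_hom:
  assumes "\<phi> \<in> ce_C1 class_ring L" "x \<in> carrier L"
  shows "\<phi> x \<in> carrier L" "y \<in> carrier L \<Longrightarrow> \<phi> (x \<oplus> y) = \<phi> x \<oplus> \<phi> y" "\<phi> (c \<odot> x) = c \<odot> \<phi> x"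
  using assms by (auto simp: ce_C1_def LinearCombinations.module_hom_def)

lemma d1_C2: "\<phi> \<in> ce_C1 class_ring L \<Longrightarrow> ce_d1 L \<phi> \<in> carrier (ce_C2 class_ring L)"
  using ce_d1_in_Z2 by (auto simp: ce_Z2_def)

lemma cochain_co_d1:
  assumes \<phi>: "\<phi> \<in> ce_C1 class_ring L" and k: "k \<in> I"
  shows "cochain_co (ce_d1 L \<phi>) a b k = coboundary I struct_co (\<lambda>a. co (\<phi> (e a))) a b k"
proof -
  have "co (\<phi> \<langle>e a, e b\<rangle>) k = (\<Sum>d\<in>I. struct_co a b d * co (\<phi> (e d)) k)"
    using linear_expand[of "\<lambda>x. co (\<phi> x) k" "\<langle>e a, e b\<rangle>"] \<phi> k
    by (simp add: C1_hom co_add co_smult lie_closed struct_co_def)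
  then show ?thesis
    using \<phi> k by (simp add: cochain_co_def ce_d1_def coboundary_def co_minus C1_hom lie_closed co_bracket)
qed

lemma C1_of:
  fixes \<psi> :: "'i \<Rightarrow> 'i \<Rightarrow> 'k"
  obtains \<phi> where "\<phi> \<in> ce_C1 class_ring L" "\<And>a k. \<lbrakk>a \<in> I; k \<in> I\<rbrakk> \<Longrightarrow> co (\<phi> (e a)) k = \<psi> a k"
proof
  let ?\<phi> = "\<lambda>x\<in>carrier L. mk (\<lambda>k. \<Sum>a\<in>I. co x a * \<psi> a k)"
  have "?\<phi> (x \<oplus> y) = ?\<phi> x \<oplus> ?\<phi> y" "?\<phi> (c \<odot> x) = c \<odot> ?\<phi> x"
    if "x \<in> carrier L" "y \<in> carrier L" for x y c
    using that by (intro co_inject; simp add: mk_closed co_mk co_add co_smult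
        sum.distrib distrib_left distrib_right sum_distrib_left mult_ac)+
  then show "?\<phi> \<in> ce_C1 class_ring L"
    by (auto simp: ce_C1_def LinearCombinations.module_hom_def mk_closed)
  show "co (?\<phi> (e a)) k = \<psi> a k" if "a \<in> I" "k \<in> I" for a k
    using that finite_I by (simp add: co_mk co_e if_distrib[of "\<lambda>t. t * _"] cong: if_cong)
qed

lemma B2_iff:
  "f \<in> ce_B2 class_ring L \<longleftrightarrow> f \<in> carrier (ce_C2 class_ring L) \<and>
    (\<exists>\<psi>. \<forall>a\<in>I. \<forall>b\<in>I. \<forall>k\<in>I. cochain_co f a b k = coboundary I struct_co \<psi> a b k)"
proof
  assume "f \<in> ce_B2 class_ring L"
  then obtain \<phi> where "\<phi> \<in> ce_C1 class_ring L" "f = ce_d1 L \<phi>" by (auto simp: ce_B2_def)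
  then show "f \<in> carrier (ce_C2 class_ring L) \<and>
    (\<exists>\<psi>. \<forall>a\<in>I. \<forall>b\<in>I. \<forall>k\<in>I. cochain_co f a b k = coboundary I struct_co \<psi> a b k)"
    using d1_C2 cochain_co_d1 by blast
next
  assume R: "f \<in> carrier (ce_C2 class_ring L) \<and>
    (\<exists>\<psi>. \<forall>a\<in>I. \<forall>b\<in>I. \<forall>k\<in>I. cochain_co f a b k = coboundary I struct_co \<psi> a b k)"
  then obtain \<psi> where \<psi>: "\<And>a b k. \<lbrakk>a \<in> I; b \<in> I; k \<in> I\<rbrakk> \<Longrightarrow> cochain_co f a b k = coboundary I struct_co \<psi> a b k" by blast
  obtain \<phi> where \<phi>: "\<phi> \<in> ce_C1 class_ring L" "\<And>a k. \<lbrakk>a \<in> I; k \<in> I\<rbrakk> \<Longrightarrow> co (\<phi> (e a)) k = \<psi> a k"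
    using C1_of[of \<psi>] by blast
  have "f = ce_d1 L \<phi>"
    using R by (intro C2_eqI) (simp_all add: d1_C2 \<phi> cochain_co_d1 \<psi> coboundary_def cong: sum.cong)
  then show "f \<in> ce_B2 class_ring L" using \<phi>(1) by (simp add: ce_B2_def)
qed

text \<open>Inherited from \<open>d\<^sup>2 = 0\<close> for cochains, which spares a second use of the Jacobi identity in coordinates.\<close>

lemma cocycle_defect_coboundary:
  assumes "a \<in> I" "b \<in> I" "c \<in> I" "k \<in> I"
  shows "cocycle_defect I struct_co (coboundary I struct_co \<psi>) a b c k = 0"
proof -
  obtain \<phi> where \<phi>: "\<phi> \<in> ce_C1 class_ring L" "\<And>a k. \<lbrakk>a \<in> I; k \<in> I\<rbrakk> \<Longrightarrow> co (\<phi> (e a)) k = \<psi> a k"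
    using C1_of[of \<psi>] by blast
  have "cochain_co (ce_d1 L \<phi>) a b k = coboundary I struct_co \<psi> a b k" if "a \<in> I" "b \<in> I" "k \<in> I" for a b k
    using that by (simp add: \<phi> cochain_co_d1 coboundary_def cong: sum.cong)
  then have "cocycle_defect I struct_co (coboundary I struct_co \<psi>) a b c k = cocycle_defect I struct_co (cochain_co (ce_d1 L \<phi>)) a b c k"
    using assms by (simp add: cocycle_defect_def cong: sum.cong)
  also have "\<dots> = 0" using ce_d1_in_Z2[OF \<phi>(1)] assms by (simp add: Z2_iff)
  finally show ?thesis .
qed

end

section \<open>Reduction to weight zero\<close>

lemma coboundary_homogeneous:
  fixes wt :: "'i \<Rightarrow> 'k::field"
  assumes homog: "\<And>a b c. \<lbrakk>a \<in> I; b \<in> I; c \<in> I; t a b c \<noteq> 0\<rbrakk> \<Longrightarrow> wt c = wt a + wt b"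
    and \<psi>: "\<And>a b. \<lbrakk>a \<in> I; b \<in> I; \<psi> a b \<noteq> 0\<rbrakk> \<Longrightarrow> wt b = wt a"
    and abk: "a \<in> I" "b \<in> I" "k \<in> I" "wt k \<noteq> wt a + wt b"
  shows "coboundary I t \<psi> a b k = 0"
proof -
  have "\<psi> b d * t a d k = 0" "\<psi> a d * t b d k = 0" "t a b d * \<psi> d k = 0" if d: "d \<in> I" for d
    using homog[of a d k] \<psi>[of b d] homog[of b d k] \<psi>[of a d] homog[of a b d] \<psi>[of d k] abk d
    by (metis mult_eq_0_iff add.commute)+
  then show ?thesis by (simp add: coboundary_def)
qed

text \<open>Let \<open>T = \<Sum>\<tau>\<^sub>x x\<close> act diagonally with eigenvalues \<open>wt\<close>. On a cocycle \<open>F\<close>, Cartan's formula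
  \<open>L\<^sub>T = d \<iota>\<^sub>T + \<iota>\<^sub>T d\<close> gives \<open>L\<^sub>T F = d (\<iota>\<^sub>T F)\<close>, and \<open>L\<^sub>T\<close> multiplies the component of weight
  \<open>w\<close> by \<open>w\<close>. As \<open>d\<close> preserves weights, dividing the components of \<open>\<iota>\<^sub>T F\<close> by their nonzero weights
  yields a primitive for the part of \<open>F\<close> outside weight zero.\<close>

lemma weight_zero_representative:
  fixes wt :: "'i \<Rightarrow> 'k::field"
  assumes alt: "alternating_on I F"
    and coc: "\<And>a b c k. \<lbrakk>a \<in> I; b \<in> I; c \<in> I; k \<in> I\<rbrakk> \<Longrightarrow> cocycle_defect I t F a b c k = 0"
    and torus: "\<And>b k. \<lbrakk>b \<in> I; k \<in> I\<rbrakk> \<Longrightarrow> (\<Sum>x\<in>I. \<tau> x * t x b k) = (if k = b then wt b else 0)"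
    and homog: "\<And>a b c. \<lbrakk>a \<in> I; b \<in> I; c \<in> I; t a b c \<noteq> 0\<rbrakk> \<Longrightarrow> wt c = wt a + wt b"
    and fin: "finite I"
  obtains \<psi> where "\<And>a b k. \<lbrakk>a \<in> I; b \<in> I; k \<in> I\<rbrakk> \<Longrightarrow>
    coboundary I t \<psi> a b k = (if wt k = wt a + wt b then 0 else F a b k)"
proof -
  define \<phi> where "\<phi> b d = (\<Sum>x\<in>I. \<tau> x * F x b d)" for b d
  define \<psi> where "\<psi> b d = (if wt d = wt b then 0 else \<phi> b d / (wt d - wt b))" for b d
  \<comment> \<open>Cartan's formula, from the cocycle identity on the triples \<open>(T, a, b)\<close>\<close>
  have cartan: "coboundary I t \<phi> a b k = (wt k - wt a - wt b) * F a b k"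
    if abk: "a \<in> I" "b \<in> I" "k \<in> I" for a b k
  proof -
    have sw: "F x y d = - F y x d" if "x \<in> I" "y \<in> I" "d \<in> I" for x y d
      using alt that unfolding alternating_on_def by blast
    have pull: "(\<Sum>x\<in>I. \<tau> x * (\<Sum>d\<in>I. G x d * H d)) = (\<Sum>d\<in>I. (\<Sum>x\<in>I. \<tau> x * G x d) * H d)"
      for G :: "'i \<Rightarrow> 'i \<Rightarrow> 'k" and H
      by (simp add: sum_distrib_left sum_distrib_right mult.assoc) (rule sum.swap)
    have "0 = (\<Sum>x\<in>I. \<tau> x * cocycle_defect I t F x a b k)"
      using coc abk by simp
    also have "\<dots> = (\<Sum>x\<in>I. \<tau> x * (\<Sum>d\<in>I. t x d k * F a b d))
        - (\<Sum>x\<in>I. \<tau> x * (\<Sum>d\<in>I. F x b d * t a d k)) + (\<Sum>x\<in>I. \<tau> x * (\<Sum>d\<in>I. F x a d * t b d k))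
        - (\<Sum>x\<in>I. \<tau> x * (\<Sum>d\<in>I. t x a d * F d b k)) + (\<Sum>x\<in>I. \<tau> x * (\<Sum>d\<in>I. t x b d * F d a k))
        - (\<Sum>x\<in>I. \<tau> x * (\<Sum>d\<in>I. F d x k * t a b d))"
      by (simp add: cocycle_defect_def distrib_left right_diff_distrib sum.distrib sum_subtractf mult.commute)
    also have "\<dots> = wt k * F a b k - (\<Sum>d\<in>I. \<phi> b d * t a d k) + (\<Sum>d\<in>I. \<phi> a d * t b d k)
        - wt a * F a b k + wt b * F b a k - (\<Sum>d\<in>I. (\<Sum>x\<in>I. \<tau> x * F d x k) * t a b d)"
      unfolding pull using abk fin by (simp add: torus \<phi>_def if_distrib[of "\<lambda>t. t * _"] cong: if_cong)
    also have "(\<Sum>d\<in>I. (\<Sum>x\<in>I. \<tau> x * F d x k) * t a b d) = (\<Sum>d\<in>I. - (t a b d * \<phi> d k))"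
    proof (rule sum.cong[OF refl])
      fix d assume d: "d \<in> I"
      have "(\<Sum>x\<in>I. \<tau> x * F d x k) = (\<Sum>x\<in>I. - (\<tau> x * F x d k))"
        using abk d by (intro sum.cong refl) (metis sw mult_minus_right)
      then show "(\<Sum>x\<in>I. \<tau> x * F d x k) * t a b d = - (t a b d * \<phi> d k)"
        by (simp add: \<phi>_def sum_negf mult.commute)
    qed
    finally show ?thesis
      using sw[OF abk(2,1,3)] by (simp add: coboundary_def sum_negf algebra_simps)
  qed
  have "coboundary I t \<psi> a b k = (if wt k = wt a + wt b then 0 else F a b k)"
    if abk: "a \<in> I" "b \<in> I" "k \<in> I" for a b k
  proof -
    \<comment> \<open>all terms of the coboundary at \<open>a, b, k\<close> have the same weight \<open>w\<close>, so they are rescaled by one factor\<close>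
    define w where "w = wt k - wt a - wt b"
    define \<gamma> where "\<gamma> = (if w = 0 then 0 else 1 / w)"
    have scale: "\<psi> i j * s = \<gamma> * (\<phi> i j * s)" if "s \<noteq> 0 \<Longrightarrow> wt j - wt i = w" for i j s
      using that by (cases "s = 0") (auto simp: \<psi>_def \<gamma>_def)
    have scaled: "\<psi> b d * t a d k = \<gamma> * (\<phi> b d * t a d k)" "\<psi> a d * t b d k = \<gamma> * (\<phi> a d * t b d k)"
      "t a b d * \<psi> d k = \<gamma> * (t a b d * \<phi> d k)" if d: "d \<in> I" for d
      using homog[of a d k] homog[of b d k] homog[of a b d] scale[of "t a d k" d b]
        scale[of "t b d k" d a] scale[of "t a b d" k d] abk d
      by (simp_all add: w_def mult.commute)
    have "coboundary I t \<psi> a b k = \<gamma> * coboundary I t \<phi> a b k"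
      unfolding coboundary_def right_diff_distrib sum_distrib_left by (simp only: scaled cong: sum.cong)
    moreover have "w = 0 \<longleftrightarrow> wt k = wt a + wt b" by (simp add: w_def diff_diff_eq)
    ultimately show ?thesis using cartan[OF abk] by (simp add: \<gamma>_def w_def)
  qed
  then show ?thesis by (rule that)
qed

section \<open>Structure constants in the eigenbasis of D and M\<close>

text \<open>The generators now index an eigenbasis: \<open>gP i\<close> stands for \<open>P\<^sub>i + \<i> Q\<^sub>i\<close> and \<open>gQ i\<close> for
  \<open>P\<^sub>i - \<i> Q\<^sub>i\<close>, the eigenvectors of \<open>M\<close> to the eigenvalues \<open>\<i>\<close> and \<open>-\<i>\<close>. The other generators
  stand for themselves.\<close>

definition eig_rel :: "nat \<Rightarrow> cga_gen \<Rightarrow> cga_gen \<Rightarrow> cga_gen \<Rightarrow> complex" where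
  "eig_rel n a b = (case (a, b) of
      (gD, gH) \<Rightarrow> cga_term 2 gH
    | (gC, gH) \<Rightarrow> cga_term 1 gD
    | (gD, gC) \<Rightarrow> cga_term (- 2) gC
    | (gM, gP i) \<Rightarrow> cga_term \<i> (gP i)
    | (gM, gQ i) \<Rightarrow> cga_term (- \<i>) (gQ i)
    | (gH, gP i) \<Rightarrow> cga_term (- of_nat i) (gP (i - 1))
    | (gH, gQ i) \<Rightarrow> cga_term (- of_nat i) (gQ (i - 1))
    | (gD, gP i) \<Rightarrow> cga_term (of_nat n - 2 * of_nat i) (gP i)
    | (gD, gQ i) \<Rightarrow> cga_term (of_nat n - 2 * of_nat i) (gQ i)
    | (gC, gP i) \<Rightarrow> cga_term (of_nat n - of_nat i) (gP (i + 1))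
    | (gC, gQ i) \<Rightarrow> cga_term (of_nat n - of_nat i) (gQ (i + 1))
    | _ \<Rightarrow> (\<lambda>_. 0))"

definition eig_struct :: "nat \<Rightarrow> cga_gen \<Rightarrow> cga_gen \<Rightarrow> cga_gen \<Rightarrow> complex" where
  "eig_struct n a b = (\<lambda>c. eig_rel n a b c - eig_rel n b a c)"

lemma eig_struct_cases:
  "eig_struct n gC gC = cga_term 0 gM" "eig_struct n gC gD = cga_term 2 gC" "eig_struct n gC gH = cga_term 1 gD"
  "eig_struct n gC gM = cga_term 0 gM"
  "eig_struct n gC (gP i) = cga_term (of_nat n - of_nat i) (gP (i + 1))"
  "eig_struct n gC (gQ i) = cga_term (of_nat n - of_nat i) (gQ (i + 1))"
  "eig_struct n gD gC = cga_term (- 2) gC" "eig_struct n gD gD = cga_term 0 gM" "eig_struct n gD gH = cga_term 2 gH"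
  "eig_struct n gD gM = cga_term 0 gM"
  "eig_struct n gD (gP i) = cga_term (of_nat n - 2 * of_nat i) (gP i)"
  "eig_struct n gD (gQ i) = cga_term (of_nat n - 2 * of_nat i) (gQ i)"
  "eig_struct n gH gC = cga_term (- 1) gD" "eig_struct n gH gD = cga_term (- 2) gH" "eig_struct n gH gH = cga_term 0 gM"
  "eig_struct n gH gM = cga_term 0 gM"
  "eig_struct n gH (gP i) = cga_term (- of_nat i) (gP (i - 1))"
  "eig_struct n gH (gQ i) = cga_term (- of_nat i) (gQ (i - 1))"
  "eig_struct n gM gC = cga_term 0 gM" "eig_struct n gM gD = cga_term 0 gM" "eig_struct n gM gH = cga_term 0 gM"
  "eig_struct n gM gM = cga_term 0 gM"
  "eig_struct n gM (gP i) = cga_term \<i> (gP i)" "eig_struct n gM (gQ i) = cga_term (- \<i>) (gQ i)"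
  "eig_struct n (gP i) gC = cga_term (of_nat i - of_nat n) (gP (i + 1))"
  "eig_struct n (gQ i) gC = cga_term (of_nat i - of_nat n) (gQ (i + 1))"
  "eig_struct n (gP i) gD = cga_term (2 * of_nat i - of_nat n) (gP i)"
  "eig_struct n (gQ i) gD = cga_term (2 * of_nat i - of_nat n) (gQ i)"
  "eig_struct n (gP i) gH = cga_term (of_nat i) (gP (i - 1))"
  "eig_struct n (gQ i) gH = cga_term (of_nat i) (gQ (i - 1))"
  "eig_struct n (gP i) gM = cga_term (- \<i>) (gP i)" "eig_struct n (gQ i) gM = cga_term \<i> (gQ i)"
  "eig_struct n (gP i) (gP j) = cga_term 0 gM" "eig_struct n (gP i) (gQ j) = cga_term 0 gM"
  "eig_struct n (gQ i) (gP j) = cga_term 0 gM" "eig_struct n (gQ i) (gQ j) = cga_term 0 gM"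
  by (auto simp: eig_struct_def eig_rel_def cga_term_def fun_eq_iff)

definition eig_gens :: "nat \<Rightarrow> cga_gen set" where
  "eig_gens n = {gC, gD, gH, gM} \<union> gP ` {..n} \<union> gQ ` {..n}"

lemma eig_gens_iff [simp]:
  "gC \<in> eig_gens n" "gD \<in> eig_gens n" "gH \<in> eig_gens n" "gM \<in> eig_gens n"
  "gP i \<in> eig_gens n \<longleftrightarrow> i \<le> n" "gQ i \<in> eig_gens n \<longleftrightarrow> i \<le> n"
  by (auto simp: eig_gens_def)

lemma finite_eig_gens [simp]: "finite (eig_gens n)"
  by (simp add: eig_gens_def)

lemma cga_gens_eq: "2 * l = real n \<Longrightarrow> cga_gens l = eig_gens n"
  by (auto simp: cga_gens_def eig_gens_def)

lemma sum_eig_gens: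
  "(\<Sum>d\<in>eig_gens n. f d) = f gC + f gD + f gH + f gM + (\<Sum>i\<le>n. f (gP i)) + (\<Sum>i\<le>n. f (gQ i))"
  for f :: "cga_gen \<Rightarrow> 'a::comm_monoid_add"
proof -
  have "eig_gens n = {gC, gD, gH, gM} \<union> (gP ` {..n} \<union> gQ ` {..n})" by (auto simp: eig_gens_def)
  moreover have "sum f ({gC, gD, gH, gM} \<union> (gP ` {..n} \<union> gQ ` {..n}))
      = sum f {gC, gD, gH, gM} + sum f (gP ` {..n} \<union> gQ ` {..n})"
    by (rule sum.union_disjoint) auto
  moreover have "sum f (gP ` {..n} \<union> gQ ` {..n}) = sum f (gP ` {..n}) + sum f (gQ ` {..n})"
    by (rule sum.union_disjoint) auto
  ultimately show ?thesis
    by (simp add: sum.reindex inj_on_def add.assoc)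
qed

lemma sum_cga_term:
  "(k \<noteq> 0 \<Longrightarrow> g \<in> eig_gens n) \<Longrightarrow> (\<Sum>d\<in>eig_gens n. cga_term k g d * h d) = k * h g"
  by (cases "k = 0") (auto simp: cga_term_def if_distrib[of "\<lambda>t. t * _"] cong: if_cong)

text \<open>The sums over the basis in \<^const>\<open>cocycle_defect\<close> and \<^const>\<open>coboundary\<close> collapse, since every
  bracket of basis elements is a multiple of one basis element. This evaluates those over the value of a bracket.\<close>

lemma eig_row:
  fixes n i j :: nat and h :: "cga_gen \<Rightarrow> complex"
  defines "S a b \<equiv> \<Sum>d\<in>eig_gens n. eig_struct n a b d * h d"
  shows "S gC gC = 0" "S gC gD = 2 * h gC" "S gC gH = h gD" "S gC gM = 0"
    "i \<le> n \<Longrightarrow> S gC (gP i) = (of_nat n - of_nat i) * h (gP (i + 1))"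
    "i \<le> n \<Longrightarrow> S gC (gQ i) = (of_nat n - of_nat i) * h (gQ (i + 1))"
    "S gD gC = - 2 * h gC" "S gD gD = 0" "S gD gH = 2 * h gH" "S gD gM = 0"
    "i \<le> n \<Longrightarrow> S gD (gP i) = (of_nat n - 2 * of_nat i) * h (gP i)"
    "i \<le> n \<Longrightarrow> S gD (gQ i) = (of_nat n - 2 * of_nat i) * h (gQ i)"
    "S gH gC = - h gD" "S gH gD = - 2 * h gH" "S gH gH = 0" "S gH gM = 0"
    "i \<le> n \<Longrightarrow> S gH (gP i) = - of_nat i * h (gP (i - 1))"
    "i \<le> n \<Longrightarrow> S gH (gQ i) = - of_nat i * h (gQ (i - 1))"
    "S gM gC = 0" "S gM gD = 0" "S gM gH = 0" "S gM gM = 0"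
    "i \<le> n \<Longrightarrow> S gM (gP i) = \<i> * h (gP i)" "i \<le> n \<Longrightarrow> S gM (gQ i) = - \<i> * h (gQ i)"
    "i \<le> n \<Longrightarrow> S (gP i) gC = (of_nat i - of_nat n) * h (gP (i + 1))"
    "i \<le> n \<Longrightarrow> S (gQ i) gC = (of_nat i - of_nat n) * h (gQ (i + 1))"
    "i \<le> n \<Longrightarrow> S (gP i) gD = (2 * of_nat i - of_nat n) * h (gP i)"
    "i \<le> n \<Longrightarrow> S (gQ i) gD = (2 * of_nat i - of_nat n) * h (gQ i)"
    "i \<le> n \<Longrightarrow> S (gP i) gH = of_nat i * h (gP (i - 1))"
    "i \<le> n \<Longrightarrow> S (gQ i) gH = of_nat i * h (gQ (i - 1))"
    "i \<le> n \<Longrightarrow> S (gP i) gM = - \<i> * h (gP i)" "i \<le> n \<Longrightarrow> S (gQ i) gM = \<i> * h (gQ i)"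
    "S (gP i) (gP j) = 0" "S (gP i) (gQ j) = 0" "S (gQ i) (gP j) = 0" "S (gQ i) (gQ j) = 0"
  unfolding S_def eig_struct_cases
  by (subst sum_cga_term; auto simp: le_less)+

text \<open>The coordinate \<open>k\<close> of the bracket of \<open>a\<close> with the vector \<open>v\<close>.\<close>

lemma eig_col:
  fixes n i j :: nat and v :: "cga_gen \<Rightarrow> complex"
  defines "S a k \<equiv> \<Sum>d\<in>eig_gens n. v d * eig_struct n a d k"
  shows "S gC gC = 2 * v gD" "S gC gD = v gH" "S gC gH = 0" "S gC gM = 0"
    "j \<le> n \<Longrightarrow> S gC (gP j) = (if j = 0 then 0 else (of_nat n - of_nat j + 1) * v (gP (j - 1)))"
    "j \<le> n \<Longrightarrow> S gC (gQ j) = (if j = 0 then 0 else (of_nat n - of_nat j + 1) * v (gQ (j - 1)))"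
    "S gD gC = - 2 * v gC" "S gD gD = 0" "S gD gH = 2 * v gH" "S gD gM = 0"
    "j \<le> n \<Longrightarrow> S gD (gP j) = (of_nat n - 2 * of_nat j) * v (gP j)"
    "j \<le> n \<Longrightarrow> S gD (gQ j) = (of_nat n - 2 * of_nat j) * v (gQ j)"
    "S gH gC = 0" "S gH gD = - v gC" "S gH gH = - 2 * v gD" "S gH gM = 0"
    "j \<le> n \<Longrightarrow> S gH (gP j) = (if j = n then 0 else - (of_nat j + 1) * v (gP (j + 1)))"
    "j \<le> n \<Longrightarrow> S gH (gQ j) = (if j = n then 0 else - (of_nat j + 1) * v (gQ (j + 1)))"
    "S gM gC = 0" "S gM gD = 0" "S gM gH = 0" "S gM gM = 0"
    "j \<le> n \<Longrightarrow> S gM (gP j) = \<i> * v (gP j)" "j \<le> n \<Longrightarrow> S gM (gQ j) = - \<i> * v (gQ j)"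
    "S (gP i) gC = 0" "S (gP i) gD = 0" "S (gP i) gH = 0" "S (gP i) gM = 0"
    "S (gP i) (gQ j) = 0"
    "S (gP i) (gP j) = (if j = i + 1 then (of_nat i - of_nat n) * v gC else 0)
      + (if j = i then (2 * of_nat i - of_nat n) * v gD - \<i> * v gM else 0)
      + (if i = j + 1 then of_nat i * v gH else 0)"
    "S (gQ i) gC = 0" "S (gQ i) gD = 0" "S (gQ i) gH = 0" "S (gQ i) gM = 0"
    "S (gQ i) (gP j) = 0"
    "S (gQ i) (gQ j) = (if j = i + 1 then (of_nat i - of_nat n) * v gC else 0)
      + (if j = i then (2 * of_nat i - of_nat n) * v gD + \<i> * v gM else 0)
      + (if i = j + 1 then of_nat i * v gH else 0)"
proof -
  show "j \<le> n \<Longrightarrow> S gC (gP j) = (if j = 0 then 0 else (of_nat n - of_nat j + 1) * v (gP (j - 1)))"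
    "j \<le> n \<Longrightarrow> S gC (gQ j) = (if j = 0 then 0 else (of_nat n - of_nat j + 1) * v (gQ (j - 1)))"
    unfolding S_def sum_eig_gens eig_struct_cases
    by (cases j; simp add: cga_term_def if_distrib[of "\<lambda>t. _ * t"] cong: if_cong)+
  show "j \<le> n \<Longrightarrow> S gH (gP j) = (if j = n then 0 else - (of_nat j + 1) * v (gP (j + 1)))"
     "j \<le> n \<Longrightarrow> S gH (gQ j) = (if j = n then 0 else - (of_nat j + 1) * v (gQ (j + 1)))"
  proof -
    have *: "(\<Sum>i\<le>n. v' i * (if j = i - 1 then - of_nat i else 0)) = (if j = n then 0 else - (of_nat j + 1) * v' (j + 1))"
      if "j \<le> n" for v' :: "nat \<Rightarrow> complex"
    proof -
      have "(\<Sum>i\<le>n. v' i * (if j = i - 1 then - of_nat i else 0)) = (\<Sum>i\<le>n. if i = Suc j then - (of_nat j + 1) * v' (j + 1) else 0)"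
        by (intro sum.cong refl) auto
      then show ?thesis using that by auto
    qed
    show "j \<le> n \<Longrightarrow> S gH (gP j) = (if j = n then 0 else - (of_nat j + 1) * v (gP (j + 1)))"
     "j \<le> n \<Longrightarrow> S gH (gQ j) = (if j = n then 0 else - (of_nat j + 1) * v (gQ (j + 1)))"
      unfolding S_def sum_eig_gens eig_struct_cases using *[of "\<lambda>i. v (gP i)"] *[of "\<lambda>i. v (gQ i)"]
      by (simp_all add: cga_term_def)
  qed
qed (unfold S_def sum_eig_gens eig_struct_cases,
    simp_all add: cga_term_def if_distrib[of "\<lambda>t. _ * t"] cong: if_cong, (cases i; simp)+)

text \<open>Eigenvalues of \<open>D + M\<close>. Those of \<open>D\<close> are real and those of \<open>M\<close> are imaginary, so weight zero means weight
  zero for both \<open>D\<close> and \<open>M\<close>.\<close>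

definition wt :: "nat \<Rightarrow> cga_gen \<Rightarrow> complex" where
  "wt n a = (case a of gC \<Rightarrow> - 2 | gD \<Rightarrow> 0 | gH \<Rightarrow> 2 | gM \<Rightarrow> 0
    | gP i \<Rightarrow> of_nat n - 2 * of_nat i + \<i> | gQ i \<Rightarrow> of_nat n - 2 * of_nat i - \<i>)"

lemma eig_homogeneous:
  assumes "eig_struct n a b c \<noteq> 0"
  shows "wt n c = wt n a + wt n b"
  using assms
  by (cases a; cases b) (auto simp: eig_struct_cases cga_term_def wt_def of_nat_diff Suc_le_eq split: if_splits)

section \<open>Normalised cocycles of weight zero\<close>

text \<open>The remaining coefficients are eliminated by the cocycle identities. On \<open>r\<close> they vanish at once. On
  \<open>r \<times> V\<close>, the identity on \<open>C\<close> and \<open>D\<close> makes the coefficient \<open>\<delta>\<close> of \<open>F D R\<^sub>i\<close> at \<open>R\<^sub>i\<close>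
  independent of \<open>i\<close>, and \<open>D = [C, H]\<close> makes it \<open>0\<close>, as commutators have trace zero. On \<open>V \<times> V\<close> the cochain is
  an invariant map \<open>V\<^sup>+ \<times> V\<^sup>- \<rightarrow> r\<close>; since \<open>C\<close> moves \<open>R\<^sup>+\<^sub>i\<close> to multiples of \<open>R\<^sup>+\<^bsub>i+1\<^esub>\<close>, it is
  determined by its values on \<open>R\<^sup>+\<^sub>0\<close>, and these reduce to the one on \<open>(R\<^sup>+\<^sub>0, R\<^sup>-\<^sub>n)\<close> by
  weights and invariance under \<open>H\<close>.\<close>

lemma normalised_cocycle_zero:
  fixes F :: "cga_gen \<Rightarrow> cga_gen \<Rightarrow> cga_gen \<Rightarrow> complex" and n :: nat
  defines "I \<equiv> eig_gens n"
  assumes alt: "alternating_on I F"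
    and coc: "\<And>a b c k. \<lbrakk>a \<in> I; b \<in> I; c \<in> I; k \<in> I\<rbrakk> \<Longrightarrow> cocycle_defect I (eig_struct n) F a b c k = 0"
    and wt0: "\<And>a b k. \<lbrakk>a \<in> I; b \<in> I; k \<in> I; wt n k \<noteq> wt n a + wt n b\<rbrakk> \<Longrightarrow> F a b k = 0"
    and N: "F gD gC gC = 0" "F gC gH gD = 0" "F gC gH gM = 0" "F gM gC gC = 0"
      "F gM (gP 0) (gP 0) = 0" "F gM (gQ 0) (gQ 0) = 0"
    and ladder: "\<And>i. i < n \<Longrightarrow> F gC (gP i) (gP (Suc i)) = 0" "\<And>i. i < n \<Longrightarrow> F gC (gQ i) (gQ (Suc i)) = 0"
    and top: "n \<le> 2 \<Longrightarrow> F (gP 0) (gQ n) gM = 0"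
    and abk: "a \<in> I" "b \<in> I" "k \<in> I"
  shows "F a b k = 0"
proof -
  have sw: "F x y k = - F y x k" if "x \<in> I" "y \<in> I" "k \<in> I" for x y k
    using alt that unfolding alternating_on_def by blast
  have diag: "F x x k = 0" if "x \<in> I" "k \<in> I" for x k
    using alt that unfolding alternating_on_def by blast
  \<comment> \<open>one orientation for each unordered pair, so that equations simplify to canonical form\<close>
  note orient = sw[of gH gC] sw[of gC gD] sw[of gH gD] sw[of gC gM] sw[of gD gM] sw[of gH gM]
    sw[of "gP _" gC] sw[of "gP _" gD] sw[of "gP _" gH] sw[of "gP _" gM]
    sw[of "gQ _" gC] sw[of "gQ _" gD] sw[of "gQ _" gH] sw[of "gQ _" gM] sw[of "gQ _" "gP _"]
  note orient = orient[unfolded I_def, simplified eig_gens_iff simp_thms]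
  note diag = diag[unfolded I_def]
  have cd: "cocycle_defect (eig_gens n) (eig_struct n) F a b c k = 0"
    if "a \<in> eig_gens n" "b \<in> eig_gens n" "c \<in> eig_gens n" "k \<in> eig_gens n" for a b c k
    using coc that by (simp add: I_def)
  note wt0 = wt0[unfolded I_def]
  note wsimps = wt_def complex_eq_iff
  note ev = cocycle_defect_def sum_negf eig_row eig_col orient diag N ladder
  have DH: "F gD gH gH = 0"
    using cd[of gD gC gH gD] by (simp add: ev)
  have MH: "F gM gD gM = 0" "F gM gH gH = F gM gD gD"
    using cd[of gM gC gH gM] cd[of gM gC gH gD] by (simp_all add: ev)
  have MD: "F gM gD gD = 0"
    using cd[of gM gD gC gC] by (simp add: ev)
  have nz: "of_nat n - of_nat i \<noteq> (0::complex)" if "i < n" for i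
    using that by simp
  have V: "F gD (R i) (R i) = 0 \<and> F gM (R i) (R i) = 0 \<and> (i > 0 \<longrightarrow> F gH (R i) (R (i - 1)) = 0)"
    if R: "R = gP \<or> R = gQ" and i: "i \<le> n" for R i
  proof -
    have step: "F gD (R (Suc i)) (R (Suc i)) = F gD (R i) (R i)"
        "F gM (R (Suc i)) (R (Suc i)) = F gM (R i) (R i)" if "i < n" for i
    proof -
      have "(of_nat n - of_nat i) * (F gD (R i) (R i) - F gD (R (Suc i)) (R (Suc i))) = 0"
        using R that cd[of gC gD "R i" "R (Suc i)"] by (auto simp: ev; simp add: algebra_simps)
      then show "F gD (R (Suc i)) (R (Suc i)) = F gD (R i) (R i)" using nz[OF that] by simp
      have "(of_nat n - of_nat i) * (F gM (R i) (R i) - F gM (R (Suc i)) (R (Suc i))) = 0"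
        using R that cd[of gC gM "R i" "R (Suc i)"] by (auto simp: ev; simp add: algebra_simps)
      then show "F gM (R (Suc i)) (R (Suc i)) = F gM (R i) (R i)" using nz[OF that] by simp
    qed
    define \<delta> where "\<delta> = F gD (R 0) (R 0)"
    have D: "F gD (R j) (R j) = \<delta>" if "j \<le> n" for j
      using that by (induction j) (auto simp: \<delta>_def step)
    have M: "F gM (R j) (R j) = 0" if "j \<le> n" for j
      using that R by (induction j) (auto simp: step N)
    \<comment> \<open>the coefficients \<open>u\<close> of \<open>H\<close> telescope: \<open>D = [C, H]\<close> gives \<open>u (j + 1) = u j - \<delta>\<close>, while \<open>u\<close> vanishes at both ends\<close>
    define u where "u j = (if j = 0 \<or> j > n then 0 else (of_nat n - of_nat j + 1) * F gH (R j) (R (j - 1)))" for j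
    have ustep: "u (Suc j) = u j - \<delta>" if "j \<le> n" for j
    proof (cases "j = n")
      case True
      then show ?thesis using R D[of n] cd[of gC gH "R n" "R n"]
        by (cases n; auto simp: ev u_def; simp add: algebra_simps)
    next
      case False
      then show ?thesis using R that D[of j] cd[of gC gH "R j" "R j"]
        by (cases j; auto simp: ev u_def; simp add: algebra_simps)
    qed
    have u: "u j = - of_nat j * \<delta>" if "j \<le> Suc n" for j
      using that by (induction j) (auto simp: u_def[of 0] ustep algebra_simps)
    have "of_nat (Suc n) * \<delta> = 0" using u[of "Suc n"] by (simp add: u_def del: of_nat_Suc)
    then have \<delta>0: "\<delta> = 0" by (simp del: of_nat_Suc)
    have "F gH (R i) (R (i - 1)) = 0" if "i > 0"
    proof -
      have "(of_nat n - of_nat i + 1) * F gH (R i) (R (i - 1)) = 0"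
        using u[of i] \<delta>0 that i by (auto simp: u_def)
      moreover have "of_nat n - of_nat i + 1 = (of_nat (Suc n - i) :: complex)"
        using i by (simp add: of_nat_diff)
      ultimately show ?thesis using i by (auto simp del: of_nat_diff)
    qed
    then show ?thesis using D[OF i] M[OF i] \<delta>0 by simp
  qed
  \<comment> \<open>invariance under \<open>C\<close>\<close>
  have C_eq: "(of_nat n - of_nat i) * F (gP (Suc i)) (gQ j) k = (\<Sum>d\<in>eig_gens n. F (gP i) (gQ j) d * eig_struct n gC d k)
      - (of_nat n - of_nat j) * F (gP i) (gQ (Suc j)) k"
    if "i < n" "j \<le> n" "k \<in> {gC, gD, gH, gM}" for i j k
    using that cd[of gC "gP i" "gQ j" k]
    by (cases "j = n"; auto simp: ev; simp add: algebra_simps)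
  \<comment> \<open>invariance under \<open>H\<close> at the corner \<open>(R\<^sup>+\<^sub>0, R\<^sup>-\<^sub>n)\<close>\<close>
  have H_eq: "of_nat n * F (gP 0) (gQ (n - 1)) gH = 2 * F (gP 0) (gQ n) gD"
    using cd[of gH "gP 0" "gQ n" gH] by (auto simp: ev; simp add: algebra_simps)
  \<comment> \<open>for \<open>n \<ge> 1\<close>, the identity on two elements of \<open>V\<^sup>+\<close> and \<open>R\<^sup>-\<^sub>n\<close> relates the two corner coefficients\<close>
  have corner: "F (gP 0) (gQ n) gD = 0 \<and> F (gP 0) (gQ n) gM = 0"
  proof -
    consider "n = 0" | "n = 1" | "n = 2" | "n \<ge> 3" by linarith
    then show ?thesis
    proof cases
      case 1
      then show ?thesis using H_eq top by simp
    next
      case 2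
      then have "F (gP 1) (gQ 1) gC = 2 * F (gP 0) (gQ 1) gD"
        using C_eq[of 0 1 gC] by (simp add: eig_col)
      then show ?thesis using 2 top cd[of "gP 0" "gP 1" "gQ 1" "gP 1"] by (simp add: ev; simp add: algebra_simps)
    next
      case 3
      then show ?thesis using top cd[of "gP 0" "gP 2" "gQ 2" "gP 2"] by (simp add: ev; simp add: algebra_simps)
    next
      case 4
      then show ?thesis using cd[of "gP 0" "gP 2" "gQ n" "gP 2"] cd[of "gP 0" "gP 3" "gQ n" "gP 3"]
        by (simp add: ev; simp add: algebra_simps)
    qed
  qed
  have PQ: "F (gP i) (gQ j) k = 0" if "i \<le> n" "j \<le> n" "k \<in> {gC, gD, gH, gM}" for i j k
    using that
  proof (induction i arbitrary: j k)
    case 0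
    show ?case
    proof (cases "wt n k = wt n (gP 0) + wt n (gQ j)")
      case True
      then have "k = gH \<and> Suc j = n \<or> k \<in> {gD, gM} \<and> j = n"
        using 0 by (auto simp: wsimps)
      then show ?thesis using corner H_eq by auto
    qed (use 0 in \<open>auto intro: wt0\<close>)
  next
    case (Suc i)
    have "(\<Sum>d\<in>eig_gens n. F (gP i) (gQ j) d * eig_struct n gC d k) = 0"
      using Suc by (auto simp: eig_col)
    then have "(of_nat n - of_nat i) * F (gP (Suc i)) (gQ j) k = 0"
      using C_eq[of i j k] Suc by (cases "j = n") auto
    then show ?case using nz[of i] Suc.prems by simp
  qed
  have rV: "F x (R i) k = 0"
    if R: "R = gP \<or> R = gQ" and i: "i \<le> n" and x: "x \<in> {gC, gD, gH, gM}" and k: "k \<in> eig_gens n" for R i x k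
  proof (cases "wt n k = wt n x + wt n (R i)")
    case True
    obtain j where j: "k = R j"
      using R x True by (cases k) (auto simp: wsimps)
    have jC: "j = Suc i" if "x = gC"
    proof -
      have "real j = real (Suc i)" using R True that j by (auto simp: wsimps)
      then show ?thesis by simp
    qed
    have jH: "i = Suc j" if "x = gH"
    proof -
      have "real i = real (Suc j)" using R True that j by (auto simp: wsimps)
      then show ?thesis by simp
    qed
    have jD: "j = i" if "x = gD \<or> x = gM"
      using R True that j by (auto simp: wsimps)
    from x consider "x = gC" | "x = gH" | "x = gD \<or> x = gM" by blast
    then show ?thesis
    proof cases
      case 1
      then have "Suc i \<le> n" using R k j jC by auto
      then show ?thesis using 1 R j jC ladder[of i] by auto
    next
      case 2
      then show ?thesis using j jH V[OF R i] by simp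
    next
      case 3
      then show ?thesis using j jD V[OF R i] by blast
    qed
  qed (use R i x k in \<open>auto intro: wt0\<close>)
  have VV: "F (R i) (R' j) k = 0"
    if "R = gP \<or> R = gQ" "R' = gP \<or> R' = gQ" "i \<le> n" "j \<le> n" "k \<in> eig_gens n" for R R' i j k
  proof (cases "wt n k = wt n (R i) + wt n (R' j)")
    case True
    then show ?thesis
      using that PQ[of i j k] PQ[of j i k] orient(15)[of i j k] by (cases k) (auto simp: wsimps)
  qed (use that in \<open>auto intro: wt0\<close>)
  have rr: "F a b k = 0" if "(a, b) \<in> {(gD, gC), (gC, gH), (gD, gH), (gM, gC), (gM, gD), (gM, gH)}"
    and k: "k \<in> eig_gens n" for a b k
  proof (cases "wt n k = wt n a + wt n b")
    case True
    then show ?thesis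
      using that N DH MH MD by (cases k) (auto simp: wsimps)
  qed (use that in \<open>auto intro: wt0\<close>)
  note fin = abk[unfolded I_def] rr rV[of gP] rV[of gQ] VV[of gP gP] VV[of gP gQ] VV[of gQ gP] VV[of gQ gQ]
    diag orient
  show ?thesis
    using abk[unfolded I_def] by (cases a; cases b; simp add: fin)
qed

section \<open>The conformal Galilei algebra in the eigenbasis\<close>

text \<open>Coordinates with respect to the eigenbasis, and the vector with given coordinates: \<open>u P\<^sup>+ + v P\<^sup>-\<close> with
  \<open>P\<^sup>\<plusminus> = P \<plusminus> \<i> Q\<close> has \<open>P\<close>-coordinate \<open>u + v\<close> and \<open>Q\<close>-coordinate \<open>\<i> (u - v)\<close>.\<close>

definition eig_co :: "(cga_gen \<Rightarrow> complex) \<Rightarrow> cga_gen \<Rightarrow> complex" where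
  "eig_co x a = (case a of gP i \<Rightarrow> (x (gP i) - \<i> * x (gQ i)) / 2
     | gQ i \<Rightarrow> (x (gP i) + \<i> * x (gQ i)) / 2 | _ \<Rightarrow> x a)"

definition eig_vec :: "nat \<Rightarrow> (cga_gen \<Rightarrow> complex) \<Rightarrow> cga_gen \<Rightarrow> complex" where
  "eig_vec n u a = (if a \<in> eig_gens n then (case a of gP i \<Rightarrow> u (gP i) + u (gQ i)
     | gQ i \<Rightarrow> \<i> * (u (gP i) - u (gQ i)) | _ \<Rightarrow> u a) else 0)"

locale cga_eigenbasis =
  fixes l :: real and n :: nat
  assumes two_l: "2 * l = real n"
begin

lemma gens: "cga_gens l = eig_gens n"
  by (rule cga_gens_eq) (rule two_l)

sublocale lie_coordinates "cga l" "eig_gens n" eig_co "eig_vec n"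
proof -
  have "2 * l \<in> \<nat>" using two_l by simp
  then interpret lie_algebra class_ring "cga l" by (rule cga_lie_algebra)
  show "lie_coordinates (cga l) (eig_gens n) eig_co (eig_vec n)"
  proof
    show "finite (eig_gens n)" by simp
    show "eig_vec n u \<in> carrier (cga l)" for u
      by (simp add: cga_def eig_vec_def gens)
    show "eig_co (eig_vec n u) i = u i" if "i \<in> eig_gens n" for u i
      using that by (cases i) (auto simp: eig_co_def eig_vec_def algebra_simps)
    show "eig_co (x \<oplus>\<^bsub>cga l\<^esub> y) i = eig_co x i + eig_co y i" for x y i
      by (cases i) (auto simp: eig_co_def cga_def algebra_simps add_divide_distrib diff_divide_distrib)
    show "eig_co (c \<odot>\<^bsub>cga l\<^esub> x) i = c * eig_co x i" for c x i
      by (cases i) (auto simp: eig_co_def cga_def algebra_simps)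
    fix x y assume xy: "x \<in> carrier (cga l)" "y \<in> carrier (cga l)"
      and eq: "\<And>i. i \<in> eig_gens n \<Longrightarrow> eig_co x i = eig_co y i"
    show "x = y"
    proof
      fix a
      show "x a = y a"
      proof (cases "a \<in> eig_gens n")
        case False
        then show ?thesis using xy by (simp add: cga_def gens)
      next
        case True
        have "x (gP i) = y (gP i) \<and> x (gQ i) = y (gQ i)" if "i \<le> n" for i
          using eq[of "gP i"] eq[of "gQ i"] that by (simp add: eig_co_def complex_eq_iff)
        then show ?thesis using eq[OF True] True by (cases a) (auto simp: eig_co_def)
      qed
    qed
  qed
qed

lemma struct_co_eig:
  assumes "a \<in> eig_gens n" "b \<in> eig_gens n" "k \<in> eig_gens n"
  shows "struct_co a b k = eig_struct n a b k"
proof -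
  let ?g = "cga_term 1"
  have lin: "\<langle>\<lambda>c. x c + s * x' c, y\<rangle>\<^bsub>cga l\<^esub> = (\<lambda>c. \<langle>x, y\<rangle>\<^bsub>cga l\<^esub> c + s * \<langle>x', y\<rangle>\<^bsub>cga l\<^esub> c)"
     "\<langle>y, \<lambda>c. x c + s * x' c\<rangle>\<^bsub>cga l\<^esub> = (\<lambda>c. \<langle>y, x\<rangle>\<^bsub>cga l\<^esub> c + s * \<langle>y, x'\<rangle>\<^bsub>cga l\<^esub> c)" for x x' y s
    by (simp_all add: cga_def fun_eq_iff distrib_left distrib_right sum.distrib sum_distrib_left mult_ac)
  have ebas: "e gC = ?g gC" "e gD = ?g gD" "e gH = ?g gH" "e gM = ?g gM"
    "i \<le> n \<Longrightarrow> e (gP i) = (\<lambda>c. ?g (gP i) c + \<i> * ?g (gQ i) c)"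
    "i \<le> n \<Longrightarrow> e (gQ i) = (\<lambda>c. ?g (gP i) c + (- \<i>) * ?g (gQ i) c)" for i
    unfolding e_def eig_vec_def cga_term_def by (auto simp: fun_eq_iff split: cga_gen.splits)
  have w: "complex_of_real (2 * (l - real i)) = of_nat n - 2 * of_nat i"
    "complex_of_real (2 * l - real i) = of_nat n - of_nat i" for i
  proof -
    have "complex_of_real (2 * (l - real i)) = complex_of_real (real n - 2 * real i)"
      using two_l by (simp add: right_diff_distrib)
    then show "complex_of_real (2 * (l - real i)) = of_nat n - 2 * of_nat i" by simp
    show "complex_of_real (2 * l - real i) = of_nat n - of_nat i"
      unfolding two_l by simp
  qed
  have bg: "\<langle>?g a, ?g b\<rangle>\<^bsub>cga l\<^esub> = cga_struct l a b" if "a \<in> eig_gens n" "b \<in> eig_gens n" for a b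
    using that by (simp add: cga_bracket_gens gens)
  show ?thesis
    unfolding struct_co_def using assms
    by (cases a; cases b; cases k;
        simp only: ebas lin bg eig_gens_iff; simp add: cga_struct_cases[where l = l, unfolded w] eig_struct_cases eig_co_def cga_term_def algebra_simps)
qed

lemma cocycle_defect_struct_co:
  assumes "a \<in> eig_gens n" "b \<in> eig_gens n" "c \<in> eig_gens n" "k \<in> eig_gens n"
  shows "cocycle_defect (eig_gens n) struct_co F a b c k = cocycle_defect (eig_gens n) (eig_struct n) F a b c k"
  using assms by (simp add: cocycle_defect_def struct_co_eig cong: sum.cong)

lemma coboundary_struct_co:
  assumes "a \<in> eig_gens n" "b \<in> eig_gens n" "k \<in> eig_gens n"
  shows "coboundary (eig_gens n) struct_co \<psi> a b k = coboundary (eig_gens n) (eig_struct n) \<psi> a b k"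
  using assms by (simp add: coboundary_def struct_co_eig cong: sum.cong)

lemma eig_defect_coboundary:
  assumes "a \<in> eig_gens n" "b \<in> eig_gens n" "c \<in> eig_gens n" "k \<in> eig_gens n"
  shows "cocycle_defect (eig_gens n) (eig_struct n) (coboundary (eig_gens n) (eig_struct n) \<psi>) a b c k = 0"
proof -
  have "cocycle_defect (eig_gens n) (eig_struct n) (coboundary (eig_gens n) (eig_struct n) \<psi>) a b c k
      = cocycle_defect (eig_gens n) struct_co (coboundary (eig_gens n) struct_co \<psi>) a b c k"
    using assms by (simp add: cocycle_defect_def struct_co_eig coboundary_struct_co cong: sum.cong)
  then show ?thesis using cocycle_defect_coboundary[OF assms] by simp
qed

end

section \<open>Cocycles without class are coboundaries\<close>

lemma cocycle_defect_diff:
  "cocycle_defect I t (\<lambda>a b k. F a b k - G a b k) a b c k = cocycle_defect I t F a b c k - cocycle_defect I t G a b c k"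
  by (simp add: cocycle_defect_def left_diff_distrib right_diff_distrib sum_subtractf)

lemma coboundary_add:
  "coboundary I t (\<lambda>a k. \<psi> a k + \<psi>' a k) a b k = coboundary I t \<psi> a b k + coboundary I t \<psi>' a b k"
  by (simp add: coboundary_def distrib_left distrib_right sum.distrib)

lemma alternating_coboundary: "alternating_on I (coboundary I (eig_struct n) \<psi>)"
  by (auto simp: alternating_on_def coboundary_def eig_struct_def sum_negf left_diff_distrib right_diff_distrib sum_subtractf)

lemma alternating_diff:
  assumes "alternating_on I F" "alternating_on I G"
  shows "alternating_on I (\<lambda>a b k. F a b k - G a b k)"
  unfolding alternating_on_def
proof (intro ballI conjI)
  fix a b k assume "a \<in> I" "b \<in> I" "k \<in> I"
  then have "F a a k = 0" "G a a k = 0" "F a b k = - F b a k" "G a b k = - G b a k"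
    using assms unfolding alternating_on_def by blast+
  then show "F a a k - G a a k = 0" "F a b k - G a b k = - (F b a k - G b a k)" by simp_all
qed

text \<open>The first detecting functional: the mean factor by which \<open>M\<close> scales the top vectors \<open>R\<^sup>\<plusminus>\<^sub>0\<close> under the cochain. Opposite
  factors cancel, as they come from replacing \<open>M\<close> by a multiple. Replacing \<open>M\<close> by \<open>M + m D\<close> adds \<open>m n\<close> to both
  factors and \<open>-2 m\<close> to the coefficient of \<open>C\<close> at \<open>(M, C)\<close>, which the last term compensates.\<close>

definition scaling_class :: "nat \<Rightarrow> (cga_gen \<Rightarrow> cga_gen \<Rightarrow> cga_gen \<Rightarrow> complex) \<Rightarrow> complex" where
  "scaling_class n F = (F gM (gP 0) (gP 0) + F gM (gQ 0) (gQ 0) + of_nat n * F gM gC gC) / 2"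

lemma scaling_class_coboundary: "scaling_class n (coboundary (eig_gens n) (eig_struct n) \<psi>) = 0"
  by (simp add: scaling_class_def coboundary_def eig_row eig_col)

text \<open>The second detecting functional is the case \<open>i = 0\<close>, \<open>j = n\<close>. It vanishes since all brackets with \<open>V\<close> lie in
  \<open>V\<close> and \<open>V\<close> is abelian.\<close>

lemma pairing_class_coboundary: "coboundary (eig_gens n) (eig_struct n) \<psi> (gP i) (gQ j) gM = 0"
  by (simp add: coboundary_def eig_row eig_col)

text \<open>After the reduction to weight zero, a diagonal cochain makes \<open>C\<close> act on \<open>V\<close> unchanged, and a
  change of \<open>D\<close>, \<open>H\<close> and \<open>M\<close> normalises the brackets inside \<open>r\<close> and balances the factors of \<open>M\<close> on
  \<open>R\<^sup>+\<^sub>0\<close> and \<open>R\<^sup>-\<^sub>0\<close>.\<close>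

lemma (in cga_eigenbasis) cocycle_is_coboundary:
  fixes F :: "cga_gen \<Rightarrow> cga_gen \<Rightarrow> cga_gen \<Rightarrow> complex"
  defines "I \<equiv> eig_gens n"
  assumes alt: "alternating_on I F"
    and coc: "\<And>a b c k. \<lbrakk>a \<in> I; b \<in> I; c \<in> I; k \<in> I\<rbrakk> \<Longrightarrow> cocycle_defect I (eig_struct n) F a b c k = 0"
    and scal: "scaling_class n F = 0"
    and pair: "n \<le> 2 \<Longrightarrow> F (gP 0) (gQ n) gM = 0"
  shows "\<exists>\<psi>. \<forall>a\<in>I. \<forall>b\<in>I. \<forall>k\<in>I. F a b k = coboundary I (eig_struct n) \<psi> a b k"
proof -
  have I [simp]: "gC \<in> I" "gD \<in> I" "gH \<in> I" "gM \<in> I" "gP i \<in> I \<longleftrightarrow> i \<le> n" "gQ i \<in> I \<longleftrightarrow> i \<le> n" for i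
    by (simp_all add: I_def)
  define \<tau> :: "cga_gen \<Rightarrow> complex" where "\<tau> x = (if x = gD \<or> x = gM then 1 else 0)" for x
  have torus: "(\<Sum>x\<in>I. \<tau> x * eig_struct n x b k) = (if k = b then wt n b else 0)" if "b \<in> I" "k \<in> I" for b k
  proof -
    have "(\<Sum>x\<in>I. \<tau> x * eig_struct n x b k) = eig_struct n gD b k + eig_struct n gM b k"
      by (simp add: I_def sum_eig_gens \<tau>_def)
    also have "\<dots> = (if k = b then wt n b else 0)"
      by (cases b) (auto simp: eig_struct_cases cga_term_def wt_def)
    finally show ?thesis .
  qed
  obtain \<psi>\<^sub>1 where \<psi>\<^sub>1: "\<And>a b k. \<lbrakk>a \<in> I; b \<in> I; k \<in> I\<rbrakk> \<Longrightarrow>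
      coboundary I (eig_struct n) \<psi>\<^sub>1 a b k = (if wt n k = wt n a + wt n b then 0 else F a b k)"
  proof (rule weight_zero_representative[of I F "eig_struct n" \<tau> "wt n"])
    show "finite I" by (simp add: I_def)
  qed (rule alt, rule coc, assumption+, rule torus, assumption+, rule eig_homogeneous, assumption, blast)
  define F\<^sub>1 where "F\<^sub>1 a b k = F a b k - coboundary I (eig_struct n) \<psi>\<^sub>1 a b k" for a b k
  \<comment> \<open>the coefficients of the weight-preserving cochain are found by solving for the normalisations below\<close>
  define d where "d = - F\<^sub>1 gD gC gC / 2"
  define d' where "d' = - F\<^sub>1 gC gH gM"
  define h where "h = F\<^sub>1 gC gH gD + d"
  define m where "m = - F\<^sub>1 gM gC gC / 2"
  define m' where "m' = (F\<^sub>1 gM (gP 0) (gP 0) - F\<^sub>1 gM (gQ 0) (gQ 0)) / (2 * \<i>)"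
  define p where "p R i = - (\<Sum>j<i. F\<^sub>1 gC (R j) (R (Suc j)) / (of_nat n - of_nat j))" for R :: "nat \<Rightarrow> cga_gen" and i
  define \<psi>\<^sub>2 where "\<psi>\<^sub>2 a = (case a of gC \<Rightarrow> (\<lambda>_. 0)
      | gD \<Rightarrow> (\<lambda>b. cga_term d gD b + cga_term d' gM b) | gH \<Rightarrow> cga_term h gH
      | gM \<Rightarrow> (\<lambda>b. cga_term m gD b + cga_term m' gM b)
      | gP i \<Rightarrow> cga_term (p gP i) (gP i) | gQ i \<Rightarrow> cga_term (p gQ i) (gQ i))" for a
  define F\<^sub>2 where "F\<^sub>2 a b k = F\<^sub>1 a b k - coboundary I (eig_struct n) \<psi>\<^sub>2 a b k" for a b k
  have alt2: "alternating_on I F\<^sub>2"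
    unfolding F\<^sub>2_def F\<^sub>1_def by (intro alternating_diff alt alternating_coboundary)
  have coc2: "cocycle_defect I (eig_struct n) F\<^sub>2 a b c k = 0" if "a \<in> I" "b \<in> I" "c \<in> I" "k \<in> I" for a b c k
    using that coc eig_defect_coboundary
    unfolding F\<^sub>2_def F\<^sub>1_def cocycle_defect_diff by (simp add: I_def)
  have wt1: "F\<^sub>1 a b k = 0" if "a \<in> I" "b \<in> I" "k \<in> I" "wt n k \<noteq> wt n a + wt n b" for a b k
    using that \<psi>\<^sub>1 by (simp add: F\<^sub>1_def)
  have "wt n b = wt n a" if "\<psi>\<^sub>2 a b \<noteq> 0" for a b
    using that by (cases a) (auto simp: \<psi>\<^sub>2_def cga_term_def wt_def split: if_splits)
  then have wt2: "F\<^sub>2 a b k = 0" if "a \<in> I" "b \<in> I" "k \<in> I" "wt n k \<noteq> wt n a + wt n b" for a b k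
    using that wt1 coboundary_homogeneous[of I "eig_struct n" "wt n" \<psi>\<^sub>2 a b k] eig_homogeneous
    unfolding F\<^sub>2_def by fastforce
  have \<psi>\<^sub>2: "\<psi>\<^sub>2 gC = (\<lambda>_. 0)" "\<psi>\<^sub>2 gD = (\<lambda>b. cga_term d gD b + cga_term d' gM b)" "\<psi>\<^sub>2 gH = cga_term h gH"
    "\<psi>\<^sub>2 gM = (\<lambda>b. cga_term m gD b + cga_term m' gM b)"
    "\<And>i. \<psi>\<^sub>2 (gP i) = cga_term (p gP i) (gP i)" "\<And>i. \<psi>\<^sub>2 (gQ i) = cga_term (p gQ i) (gQ i)"
    by (simp_all add: \<psi>\<^sub>2_def)
  note ev = F\<^sub>2_def coboundary_def I_def eig_row eig_col
  note ev2 = \<psi>\<^sub>2 cga_term_def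
  have "scaling_class n F\<^sub>2 = scaling_class n F"
    using scaling_class_coboundary[of n \<psi>\<^sub>1] scaling_class_coboundary[of n \<psi>\<^sub>2]
    unfolding scaling_class_def F\<^sub>2_def F\<^sub>1_def I_def by (simp add: algebra_simps)
  then have "F\<^sub>2 gM (gP 0) (gP 0) + F\<^sub>2 gM (gQ 0) (gQ 0) + of_nat n * F\<^sub>2 gM gC gC = 0"
    unfolding scal by (simp add: scaling_class_def)
  moreover have N: "F\<^sub>2 gD gC gC = 0" "F\<^sub>2 gC gH gD = 0" "F\<^sub>2 gC gH gM = 0" "F\<^sub>2 gM gC gC = 0"
    "F\<^sub>2 gM (gP 0) (gP 0) = F\<^sub>2 gM (gQ 0) (gQ 0)"
    by (simp add: ev; simp add: ev2 d_def d'_def h_def m_def m'_def field_simps)+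
  ultimately have M: "F\<^sub>2 gM (gP 0) (gP 0) = 0" "F\<^sub>2 gM (gQ 0) (gQ 0) = 0" by simp_all
  have L: "F\<^sub>2 gC (gP i) (gP (Suc i)) = 0" "F\<^sub>2 gC (gQ i) (gQ (Suc i)) = 0" if "i < n" for i
    using that by (simp add: ev; simp add: ev2 p_def field_simps)+
  have "F\<^sub>2 (gP 0) (gQ n) gM = F (gP 0) (gQ n) gM"
    unfolding F\<^sub>2_def F\<^sub>1_def I_def by (simp add: pairing_class_coboundary)
  then have "F\<^sub>2 a b k = 0" if "a \<in> I" "b \<in> I" "k \<in> I" for a b k
    using normalised_cocycle_zero[of n F\<^sub>2, folded I_def, OF alt2 coc2 wt2 N(1-4) M L] pair that by simp
  then have "F a b k = coboundary I (eig_struct n) (\<lambda>a k. \<psi>\<^sub>1 a k + \<psi>\<^sub>2 a k) a b k" if "a \<in> I" "b \<in> I" "k \<in> I" for a b k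
    using that unfolding coboundary_add F\<^sub>2_def F\<^sub>1_def by (simp add: algebra_simps)
  then show ?thesis by blast
qed

section \<open>The two standard cocycles\<close>

text \<open>The infinitesimal deformation that adds a multiple of the identity to the action of \<open>M\<close> on \<open>V\<close>.\<close>

definition scaling_cocycle :: "cga_gen \<Rightarrow> cga_gen \<Rightarrow> cga_gen \<Rightarrow> complex" where
  "scaling_cocycle a b = (case (a, b) of
      (gM, gP i) \<Rightarrow> cga_term 1 (gP i) | (gP i, gM) \<Rightarrow> cga_term (- 1) (gP i)
    | (gM, gQ i) \<Rightarrow> cga_term 1 (gQ i) | (gQ i, gM) \<Rightarrow> cga_term (- 1) (gQ i)
    | _ \<Rightarrow> (\<lambda>_. 0))"

text \<open>The invariant map \<open>V\<^sup>+ \<times> V\<^sup>- \<rightarrow> r\<close> on \<open>(R\<^sup>+\<^sub>i, R\<^sup>-\<^sub>j)\<close>. Invariance and the cocycle identity on \<open>V\<close> fix the corner value on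
  \<open>(R\<^sup>+\<^sub>0, R\<^sup>-\<^sub>n)\<close> up to a factor, namely \<open>M\<close>, \<open>\<i> D + 3 M\<close> and \<open>\<i> D + 2 M\<close> for \<open>n = 0, 1, 2\<close>; invariance
  under \<open>C\<close> and \<open>H\<close> produces the other entries.\<close>

definition pairing :: "nat \<Rightarrow> nat \<Rightarrow> nat \<Rightarrow> cga_gen \<Rightarrow> complex" where
  "pairing n i j =
    (if n = 0 then cga_term 1 gM
     else if n = 1 then
       (if i = 0 \<and> j = 0 then cga_term (2 * \<i>) gH
        else if i = 0 \<and> j = 1 then (\<lambda>k. cga_term \<i> gD k + cga_term 3 gM k)
        else if i = 1 \<and> j = 0 then (\<lambda>k. cga_term \<i> gD k + cga_term (- 3) gM k)
        else if i = 1 \<and> j = 1 then cga_term (2 * \<i>) gC else (\<lambda>_. 0))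
     else if n = 2 then
       (if i = 0 \<and> j = 1 then cga_term \<i> gH
        else if i = 1 \<and> j = 0 then cga_term (- \<i>) gH
        else if i = 0 \<and> j = 2 then (\<lambda>k. cga_term \<i> gD k + cga_term 2 gM k)
        else if i = 1 \<and> j = 1 then cga_term (- 1) gM
        else if i = 2 \<and> j = 0 then (\<lambda>k. cga_term (- \<i>) gD k + cga_term 2 gM k)
        else if i = 1 \<and> j = 2 then cga_term \<i> gC
        else if i = 2 \<and> j = 1 then cga_term (- \<i>) gC else (\<lambda>_. 0))
     else (\<lambda>_. 0))"

definition pairing_cocycle :: "nat \<Rightarrow> cga_gen \<Rightarrow> cga_gen \<Rightarrow> cga_gen \<Rightarrow> complex" where
  "pairing_cocycle n a b k = (case (a, b) of
      (gP i, gQ j) \<Rightarrow> pairing n i j k | (gQ j, gP i) \<Rightarrow> - pairing n i j k | _ \<Rightarrow> 0)"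

lemma scaling_cocycle_alternating: "alternating_on I scaling_cocycle"
  by (auto simp: alternating_on_def scaling_cocycle_def cga_term_def split: cga_gen.split)

lemma pairing_cocycle_alternating: "alternating_on I (pairing_cocycle n)"
  by (auto simp: alternating_on_def pairing_cocycle_def split: cga_gen.split)

text \<open>The cocycle is the exterior product of the functional \<open>\<mu>\<close>, the \<open>M\<close>-coordinate, which vanishes on brackets, and of the
  derivation with eigenvalues \<open>\<delta>\<close>, the projection onto \<open>V\<close>. Both facts appear as \<open>t0\<close> and \<open>deg\<close>.\<close>

lemma scaling_cocycle_defect:
  assumes "a \<in> eig_gens n" "b \<in> eig_gens n" "c \<in> eig_gens n" "k \<in> eig_gens n"
  shows "cocycle_defect (eig_gens n) (eig_struct n) scaling_cocycle a b c k = 0"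
proof -
  define \<mu> where "\<mu> a = (if a = gM then 1 else 0 :: complex)" for a
  define \<delta> where "\<delta> a = (case a of gP _ \<Rightarrow> 1 | gQ _ \<Rightarrow> 1 | _ \<Rightarrow> (0 :: complex))" for a
  have F: "scaling_cocycle a b k = cga_term (\<mu> a * \<delta> b) b k - cga_term (\<mu> b * \<delta> a) a k" for a b k
    by (cases a; cases b) (auto simp: scaling_cocycle_def \<mu>_def \<delta>_def cga_term_def)
  have skew: "eig_struct n a b k = - eig_struct n b a k" and t0: "eig_struct n a b gM = 0" for a b k
    by (simp add: eig_struct_def) (cases a; cases b; simp add: eig_struct_cases cga_term_def)
  have deg: "(\<delta> k - \<delta> a - \<delta> b) * eig_struct n a b k = 0" for a b k
    by (cases a; cases b) (auto simp: eig_struct_cases cga_term_def \<delta>_def)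
  have col: "(\<Sum>d\<in>eig_gens n. scaling_cocycle b c d * eig_struct n a d k)
      = \<mu> b * \<delta> c * eig_struct n a c k - \<mu> c * \<delta> b * eig_struct n a b k" if "b \<in> eig_gens n" "c \<in> eig_gens n" for a b c
    using that by (simp add: F left_diff_distrib sum_subtractf sum_cga_term)
  have row: "(\<Sum>d\<in>eig_gens n. eig_struct n a b d * scaling_cocycle d c k) = - \<mu> c * \<delta> k * eig_struct n a b k"
    if "c \<in> eig_gens n" for a b c
  proof -
    have "(\<Sum>d\<in>eig_gens n. eig_struct n a b d * scaling_cocycle d c k)
       = (\<Sum>d\<in>eig_gens n. if d = k then - \<mu> c * \<delta> k * eig_struct n a b k else 0)"
      by (intro sum.cong refl) (auto simp: F cga_term_def t0 \<mu>_def)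
    then show ?thesis using assms by simp
  qed
  have "cocycle_defect (eig_gens n) (eig_struct n) scaling_cocycle a b c k =
     \<mu> c * ((\<delta> k - \<delta> a - \<delta> b) * eig_struct n a b k) - \<mu> b * ((\<delta> k - \<delta> a - \<delta> c) * eig_struct n a c k)
     + \<mu> a * ((\<delta> k - \<delta> b - \<delta> c) * eig_struct n b c k)"
    using assms unfolding cocycle_defect_def
    by (simp add: col row skew[of b a] skew[of c a] skew[of c b]; simp add: algebra_simps)
  then show ?thesis by (simp add: deg)
qed

lemma pairing_cocycle_simps:
  "pairing_cocycle n (gP i) (gQ j) k = pairing n i j k"
  "pairing_cocycle n (gQ j) (gP i) k = - pairing n i j k"
  "pairing_cocycle n (gP i) (gP j) k = 0" "pairing_cocycle n (gQ i) (gQ j) k = 0"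
  "pairing_cocycle n gC b k = 0" "pairing_cocycle n gD b k = 0"
  "pairing_cocycle n gH b k = 0" "pairing_cocycle n gM b k = 0"
  "pairing_cocycle n a gC k = 0" "pairing_cocycle n a gD k = 0"
  "pairing_cocycle n a gH k = 0" "pairing_cocycle n a gM k = 0"
  by (simp_all add: pairing_cocycle_def split: cga_gen.split)

lemma pairing_table:
  shows "pairing 0 i j = cga_term 1 gM"
    "pairing 1 0 0 = cga_term (2 * \<i>) gH" "pairing 1 0 1 = (\<lambda>k. cga_term \<i> gD k + cga_term 3 gM k)" "pairing 1 0 2 = (\<lambda>_. 0)"
    "pairing 1 1 0 = (\<lambda>k. cga_term \<i> gD k + cga_term (- 3) gM k)" "pairing 1 1 1 = cga_term (2 * \<i>) gC" "pairing 1 1 2 = (\<lambda>_. 0)"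
    "pairing 1 2 0 = (\<lambda>_. 0)" "pairing 1 2 1 = (\<lambda>_. 0)"
    "pairing 2 0 0 = (\<lambda>_. 0)" "pairing 2 0 1 = cga_term \<i> gH" "pairing 2 0 2 = (\<lambda>k. cga_term \<i> gD k + cga_term 2 gM k)" "pairing 2 0 3 = (\<lambda>_. 0)"
    "pairing 2 1 0 = cga_term (- \<i>) gH" "pairing 2 1 1 = cga_term (- 1) gM" "pairing 2 1 2 = cga_term \<i> gC" "pairing 2 1 3 = (\<lambda>_. 0)"
    "pairing 2 2 0 = (\<lambda>k. cga_term (- \<i>) gD k + cga_term 2 gM k)" "pairing 2 2 1 = cga_term (- \<i>) gC" "pairing 2 2 2 = (\<lambda>_. 0)" "pairing 2 2 3 = (\<lambda>_. 0)"
    "pairing 2 3 0 = (\<lambda>_. 0)" "pairing 2 3 1 = (\<lambda>_. 0)" "pairing 2 3 2 = (\<lambda>_. 0)"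
  by (simp_all add: pairing_def)

text \<open>Only triples that meet both \<open>V\<^sup>+\<close> and \<open>V\<^sup>-\<close> contribute. With a third element in \<open>r\<close> the identity is invariance
  of the pairing; with a third element in \<open>V\<close> it is a symmetry of the resulting triple product on \<open>V\<close>. Both are
  read off from the table.\<close>

lemma pairing_cocycle_defect:
  assumes n: "n \<le> 2"
    and abck: "a \<in> eig_gens n" "b \<in> eig_gens n" "c \<in> eig_gens n" "k \<in> eig_gens n"
  shows "cocycle_defect (eig_gens n) (eig_struct n) (pairing_cocycle n) a b c k = 0"
proof -
  have n': "n = 0 \<or> n = 1 \<or> n = 2" using n by auto
  have S: "{..0} = {0::nat}" "{..1} = {0::nat, 1}" "{..2} = {0::nat, 1, 2}" by auto
  have pV: "pairing n i j (gP i') = 0" "pairing n i j (gQ i') = 0" for i j i'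
    by (simp_all add: pairing_def cga_term_def)
  \<comment> \<open>invariance under \<open>C\<close>, \<open>D\<close> and \<open>H\<close>\<close>
  have inv: "\<forall>i\<in>{..n}. \<forall>j\<in>{..n}. \<forall>k\<in>{gC, gD, gH, gM}.
      (\<Sum>d\<in>eig_gens n. pairing n i j d * eig_struct n gC d k)
        = (of_nat n - of_nat i) * pairing n (Suc i) j k + (of_nat n - of_nat j) * pairing n i (Suc j) k
    \<and> (\<Sum>d\<in>eig_gens n. pairing n i j d * eig_struct n gD d k)
        = (of_nat n - 2 * of_nat i) * pairing n i j k + (of_nat n - 2 * of_nat j) * pairing n i j k
    \<and> (\<Sum>d\<in>eig_gens n. pairing n i j d * eig_struct n gH d k)
        = - of_nat i * pairing n (i - Suc 0) j k - of_nat j * pairing n i (j - Suc 0) k"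
    using n'
  proof (elim disjE)
    assume "n = 0" then show ?thesis by (simp only: S) (simp add: eig_col pairing_table cga_term_def One_nat_def[symmetric] del: One_nat_def)
  next
    assume "n = 1" then show ?thesis by (simp only: S) (simp add: eig_col pairing_table cga_term_def One_nat_def[symmetric] del: One_nat_def)
  next
    assume "n = 2" then show ?thesis by (simp only: S) (simp add: eig_col pairing_table cga_term_def One_nat_def[symmetric] del: One_nat_def)
  qed
  have EC: "(\<Sum>d\<in>eig_gens n. pairing n i j d * eig_struct n gC d k)
      = (of_nat n - of_nat i) * pairing n (Suc i) j k + (of_nat n - of_nat j) * pairing n i (Suc j) k"
    and ED: "(\<Sum>d\<in>eig_gens n. pairing n i j d * eig_struct n gD d k)
      = (of_nat n - 2 * of_nat i) * pairing n i j k + (of_nat n - 2 * of_nat j) * pairing n i j k"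
    and EH: "(\<Sum>d\<in>eig_gens n. pairing n i j d * eig_struct n gH d k)
      = - of_nat i * pairing n (i - Suc 0) j k - of_nat j * pairing n i (j - Suc 0) k"
    and EM: "(\<Sum>d\<in>eig_gens n. pairing n i j d * eig_struct n gM d k) = 0"
    if "i \<le> n" "j \<le> n" "k \<in> eig_gens n" for i j k
    using inv that by (cases k; simp add: eig_col pV)+
  \<comment> \<open>symmetry of the triple product in its two arguments of the same sign\<close>
  have sym: "\<forall>i\<in>{..n}. \<forall>i'\<in>{..n}. \<forall>j\<in>{..n}. \<forall>m\<in>{..n}.
      (\<Sum>d\<in>eig_gens n. pairing n i' j d * eig_struct n (gP i) d (gP m))
        = (\<Sum>d\<in>eig_gens n. pairing n i j d * eig_struct n (gP i') d (gP m))
    \<and> (\<Sum>d\<in>eig_gens n. pairing n j i' d * eig_struct n (gQ i) d (gQ m))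
        = (\<Sum>d\<in>eig_gens n. pairing n j i d * eig_struct n (gQ i') d (gQ m))"
    using n'
  proof (elim disjE)
    assume "n = 0" then show ?thesis by (simp only: S) (simp add: eig_col pairing_table cga_term_def One_nat_def[symmetric] del: One_nat_def)
  next
    assume "n = 1" then show ?thesis by (simp only: S) (simp add: eig_col pairing_table cga_term_def One_nat_def[symmetric] del: One_nat_def)
  next
    assume "n = 2" then show ?thesis by (simp only: S) (simp add: eig_col pairing_table cga_term_def One_nat_def[symmetric] del: One_nat_def)
  qed
  have EPP: "(\<Sum>d\<in>eig_gens n. pairing n i' j d * eig_struct n (gP i) d k)
      = (\<Sum>d\<in>eig_gens n. pairing n i j d * eig_struct n (gP i') d k)"
    if "i \<le> n" "i' \<le> n" "j \<le> n" "k \<in> eig_gens n" for i i' j k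
  proof (cases k)
    case (gP m)
    then show ?thesis using sym[rule_format, of i i' j m] that by simp
  qed (simp_all add: eig_col)
  have EQQ: "(\<Sum>d\<in>eig_gens n. pairing n i j' d * eig_struct n (gQ j) d k)
      = (\<Sum>d\<in>eig_gens n. pairing n i j d * eig_struct n (gQ j') d k)"
    if "i \<le> n" "j \<le> n" "j' \<le> n" "k \<in> eig_gens n" for i j j' k
  proof (cases k)
    case (gQ m)
    then show ?thesis using sym[rule_format, of j j' i m] that by simp
  qed (simp_all add: eig_col)
  show ?thesis
    by (insert abck, cases a; cases b; cases c;
        simp add: cocycle_defect_def pairing_cocycle_simps sum_negf eig_row EC ED EH EM;
        (rule EPP; assumption | rule EQQ; assumption | simp add: algebra_simps))
qed

section \<open>The dimension of the second cohomology space\<close>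

context cga_eigenbasis
begin

abbreviation C2 where "C2 \<equiv> ce_C2 class_ring (cga l)"
abbreviation Z2 where "Z2 \<equiv> ce_Z2 class_ring (cga l)"
abbreviation B2 where "B2 \<equiv> ce_B2 class_ring (cga l)"

lemma cochain_co_add:
  assumes "f \<in> carrier C2" "g \<in> carrier C2" "k \<in> eig_gens n"
  shows "cochain_co (f \<oplus>\<^bsub>C2\<^esub> g) a b k = cochain_co f a b k + cochain_co g a b k"
proof -
  have "(f \<oplus>\<^bsub>C2\<^esub> g) (e a) (e b) = f (e a) (e b) \<oplus>\<^bsub>cga l\<^esub> g (e a) (e b)"
    by (simp add: ce_C2_def)
  then show ?thesis using assms by (simp add: cochain_co_def co_add C2_closed)
qed

lemma cochain_co_smult:
  assumes "f \<in> carrier C2" "k \<in> eig_gens n"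
  shows "cochain_co (c \<odot>\<^bsub>C2\<^esub> f) a b k = c * cochain_co f a b k"
proof -
  have "(c \<odot>\<^bsub>C2\<^esub> f) (e a) (e b) = c \<odot>\<^bsub>cga l\<^esub> f (e a) (e b)"
    by (simp add: ce_C2_def)
  then show ?thesis using assms by (simp add: cochain_co_def co_smult C2_closed)
qed

lemma cocycle_iff:
  "f \<in> Z2 \<longleftrightarrow> f \<in> carrier C2 \<and> (\<forall>a\<in>eig_gens n. \<forall>b\<in>eig_gens n. \<forall>c\<in>eig_gens n. \<forall>k\<in>eig_gens n.
    cocycle_defect (eig_gens n) (eig_struct n) (cochain_co f) a b c k = 0)"
  by (simp add: Z2_iff cocycle_defect_struct_co)

lemma coboundary_iff:
  "f \<in> B2 \<longleftrightarrow> f \<in> carrier C2 \<and> (\<exists>\<psi>. \<forall>a\<in>eig_gens n. \<forall>b\<in>eig_gens n. \<forall>k\<in>eig_gens n.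
    cochain_co f a b k = coboundary (eig_gens n) (eig_struct n) \<psi> a b k)"
  by (simp add: B2_iff coboundary_struct_co)

definition standard_cocycle :: "complex \<Rightarrow> complex \<Rightarrow> cga_gen \<Rightarrow> cga_gen \<Rightarrow> cga_gen \<Rightarrow> complex" where
  "standard_cocycle \<alpha> \<beta> a b k = \<alpha> * scaling_cocycle a b k + \<beta> * pairing_cocycle n a b k"

lemma standard_cocycle_C2: "cochain_of (standard_cocycle \<alpha> \<beta>) \<in> carrier C2"
proof (rule cochain_of_C2)
  show "alternating_on (eig_gens n) (standard_cocycle \<alpha> \<beta>)"
    unfolding alternating_on_def standard_cocycle_def
  proof (intro ballI conjI)
    fix a b k assume abk: "a \<in> eig_gens n" "b \<in> eig_gens n" "k \<in> eig_gens n"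
    have "scaling_cocycle a a k = 0" "scaling_cocycle a b k = - scaling_cocycle b a k"
      "pairing_cocycle n a a k = 0" "pairing_cocycle n a b k = - pairing_cocycle n b a k"
      using scaling_cocycle_alternating[of "eig_gens n"] pairing_cocycle_alternating[of "eig_gens n" n] abk
      unfolding alternating_on_def by blast+
    then show "\<alpha> * scaling_cocycle a a k + \<beta> * pairing_cocycle n a a k = 0"
      "\<alpha> * scaling_cocycle a b k + \<beta> * pairing_cocycle n a b k
        = - (\<alpha> * scaling_cocycle b a k + \<beta> * pairing_cocycle n b a k)" by simp_all
  qed
qed

lemma standard_cocycle_Z2:
  assumes "n \<le> 2 \<or> \<beta> = 0"
  shows "cochain_of (standard_cocycle \<alpha> \<beta>) \<in> Z2"
  unfolding cocycle_iff
proof (intro conjI ballI standard_cocycle_C2)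
  fix a b c k assume abck: "a \<in> eig_gens n" "b \<in> eig_gens n" "c \<in> eig_gens n" "k \<in> eig_gens n"
  have "cocycle_defect (eig_gens n) (eig_struct n) (cochain_co (cochain_of (standard_cocycle \<alpha> \<beta>))) a b c k
      = cocycle_defect (eig_gens n) (eig_struct n) (standard_cocycle \<alpha> \<beta>) a b c k"
    using abck by (simp add: cocycle_defect_def cochain_co_of cong: sum.cong)
  also have "\<dots> = \<alpha> * cocycle_defect (eig_gens n) (eig_struct n) scaling_cocycle a b c k
      + \<beta> * cocycle_defect (eig_gens n) (eig_struct n) (pairing_cocycle n) a b c k"
    unfolding cocycle_defect_def standard_cocycle_def distrib_left distrib_right sum.distrib
      right_diff_distrib sum_distrib_left by (simp add: mult_ac)
  also have "\<dots> = 0"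
    using abck assms by (auto simp: scaling_cocycle_defect pairing_cocycle_defect)
  finally show "cocycle_defect (eig_gens n) (eig_struct n) (cochain_co (cochain_of (standard_cocycle \<alpha> \<beta>))) a b c k = 0" .
qed

lemma standard_cocycle_classes:
  "scaling_class n (standard_cocycle \<alpha> \<beta>) = \<alpha>"
  "n \<le> 2 \<Longrightarrow> standard_cocycle \<alpha> \<beta> (gP 0) (gQ n) gM = \<beta> * pairing n 0 n gM"
  by (simp_all add: standard_cocycle_def scaling_class_def scaling_cocycle_def pairing_cocycle_def cga_term_def)

lemma pairing_corner: "n \<le> 2 \<Longrightarrow> pairing n 0 n gM \<noteq> 0"
  by (auto simp: pairing_def cga_term_def le_Suc_eq numeral_2_eq_2)

lemma scaling_class_cong:
  "(\<And>a b k. \<lbrakk>a \<in> eig_gens n; b \<in> eig_gens n; k \<in> eig_gens n\<rbrakk> \<Longrightarrow> F a b k = G a b k)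
    \<Longrightarrow> scaling_class n F = scaling_class n G"
  by (simp add: scaling_class_def)

text \<open>The standard cocycles are parametrised linearly by \<open>\<complex>\<^sup>2\<close> if \<open>n \<le> 2\<close> and by \<open>\<complex>\<close> otherwise. The two functionals
  recover the parameters, so the parametrisation hits every class and no nonzero parameter gives a coboundary.\<close>

lemma H2_dim:
  "vectorspace.fin_dim class_ring (ce_H2 class_ring (cga l)) \<and>
    vectorspace.dim class_ring (ce_H2 class_ring (cga l)) = (if n \<le> 2 then 2 else 1)"
proof -
  define d :: nat where "d = (if n \<le> 2 then 2 else 1)"
  define \<beta> where "\<beta> v = (if n \<le> 2 then v $ 1 else 0)" for v :: "complex vec"
  define s where "s v = cochain_of (standard_cocycle (v $ 0) (\<beta> v))" for v
  let ?V = "C2\<lparr>carrier := Z2\<rparr>"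
  let ?U = "module_vec TYPE(complex) d"
  interpret C: vectorspace class_ring C2
    by (rule ce_C2_vectorspace) (rule vectorspace_axioms)
  interpret Z: vectorspace class_ring ?V
    by (rule C.subspace_is_vs[OF ce_Z2_subspace])
  have sZ: "s v \<in> Z2" for v
    unfolding s_def by (rule standard_cocycle_Z2) (simp add: \<beta>_def)
  have ZC: "f \<in> carrier C2" if "f \<in> Z2" for f
    using that by (simp add: ce_Z2_def)
  have co_s: "cochain_co (s v) a b k = standard_cocycle (v $ 0) (\<beta> v) a b k"
    if "a \<in> eig_gens n" "b \<in> eig_gens n" "k \<in> eig_gens n" for v a b k
    using that by (simp add: s_def cochain_co_of)
  have hom: "s \<in> LinearCombinations.module_hom class_ring ?U ?V"
    unfolding LinearCombinations.module_hom_def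
  proof (intro CollectI conjI Pi_I allI impI; (elim conjE)?)
    fix u v assume "u \<in> carrier ?U" "v \<in> carrier ?U"
    then have uv: "(u + v) $ 0 = u $ 0 + v $ 0" "\<beta> (u + v) = \<beta> u + \<beta> v"
      by (auto simp: module_vec_def d_def \<beta>_def split: if_splits)
    have "s (u + v) = s u \<oplus>\<^bsub>C2\<^esub> s v"
      by (rule C2_eqI) (simp_all add: ZC sZ co_s cochain_co_add uv standard_cocycle_def algebra_simps)
    then show "s (u \<oplus>\<^bsub>?U\<^esub> v) = s u \<oplus>\<^bsub>?V\<^esub> s v" by (simp add: module_vec_def)
  next
    fix c v assume "v \<in> carrier ?U"
    then have v: "(c \<cdot>\<^sub>v v) $ 0 = c * v $ 0" "\<beta> (c \<cdot>\<^sub>v v) = c * \<beta> v"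
      by (auto simp: module_vec_def d_def \<beta>_def split: if_splits)
    have "s (c \<cdot>\<^sub>v v) = c \<odot>\<^bsub>C2\<^esub> s v"
      by (rule C2_eqI) (simp_all add: ZC sZ co_s cochain_co_smult v standard_cocycle_def algebra_simps)
    then show "s (c \<odot>\<^bsub>?U\<^esub> v) = c \<odot>\<^bsub>?V\<^esub> s v" by (simp add: module_vec_def)
  qed (simp add: sZ)
  have "vectorspace.fin_dim class_ring (quotient_module ?V B2) \<and>
    vectorspace.dim class_ring (quotient_module ?V B2) = vectorspace.dim class_ring ?U"
  proof (rule quotient_dim_by_section[OF Z.vectorspace_axioms ce_B2_subspace vec_vs _ hom])
    show "vectorspace.fin_dim class_ring ?U" by (rule vec_space.fin_dim)
  next
    fix f assume "f \<in> carrier ?V"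
    then have f: "f \<in> Z2" by simp
    define \<alpha> where "\<alpha> = scaling_class n (cochain_co f)"
    define \<gamma> where "\<gamma> = cochain_co f (gP 0) (gQ n) gM / pairing n 0 n gM"
    define u where "u = vec d (\<lambda>i. if i = 0 then \<alpha> else \<gamma>)"
    have u: "u \<in> carrier ?U" "u $ 0 = \<alpha>" "n \<le> 2 \<Longrightarrow> \<beta> u = \<gamma>"
      by (simp_all add: u_def d_def module_vec_def \<beta>_def)
    define g where "g = f \<ominus>\<^bsub>?V\<^esub> s u"
    have gZ: "g \<in> Z2"
      using Z.M.minus_closed[of f "s u"] f sZ by (simp add: g_def)
    have "g = f \<oplus>\<^bsub>C2\<^esub> (- 1) \<odot>\<^bsub>C2\<^esub> s u"
      using Z.smult_minus_1[of "s u"] sZ by (simp add: g_def a_minus_def class_ring_simps)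
    then have co_g: "cochain_co g a b k = cochain_co f a b k - standard_cocycle \<alpha> (\<beta> u) a b k"
      if "a \<in> eig_gens n" "b \<in> eig_gens n" "k \<in> eig_gens n" for a b k
      using that f sZ ZC by (simp add: cochain_co_add cochain_co_smult co_s u)
    have "\<exists>\<psi>. \<forall>a\<in>eig_gens n. \<forall>b\<in>eig_gens n. \<forall>k\<in>eig_gens n.
        cochain_co g a b k = coboundary (eig_gens n) (eig_struct n) \<psi> a b k"
    proof (rule cocycle_is_coboundary)
      show "alternating_on (eig_gens n) (cochain_co g)" by (rule C2_alternating[OF ZC[OF gZ]])
      show "cocycle_defect (eig_gens n) (eig_struct n) (cochain_co g) a b c k = 0"
        if "a \<in> eig_gens n" "b \<in> eig_gens n" "c \<in> eig_gens n" "k \<in> eig_gens n" for a b c k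
        using gZ that by (simp add: cocycle_iff)
      have "scaling_class n (cochain_co g) = scaling_class n (cochain_co f) - scaling_class n (standard_cocycle \<alpha> (\<beta> u))"
        by (simp add: scaling_class_def co_g diff_divide_distrib add_divide_distrib algebra_simps)
      then show "scaling_class n (cochain_co g) = 0" by (simp add: standard_cocycle_classes \<alpha>_def)
      show "cochain_co g (gP 0) (gQ n) gM = 0" if "n \<le> 2"
        using that pairing_corner by (simp add: co_g standard_cocycle_classes u \<gamma>_def)
    qed
    then have "g \<in> B2" using ZC[OF gZ] by (simp add: coboundary_iff)
    then show "\<exists>u\<in>carrier ?U. f \<ominus>\<^bsub>?V\<^esub> s u \<in> B2" using u(1) unfolding g_def by blast
  next
    fix u assume u: "u \<in> carrier ?U" and "s u \<in> B2"
    then obtain \<psi> where \<psi>: "\<And>a b k. \<lbrakk>a \<in> eig_gens n; b \<in> eig_gens n; k \<in> eig_gens n\<rbrakk> \<Longrightarrow>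
        standard_cocycle (u $ 0) (\<beta> u) a b k = coboundary (eig_gens n) (eig_struct n) \<psi> a b k"
      unfolding coboundary_iff by (metis co_s)
    have "scaling_class n (standard_cocycle (u $ 0) (\<beta> u)) = scaling_class n (coboundary (eig_gens n) (eig_struct n) \<psi>)"
      by (rule scaling_class_cong) (rule \<psi>)
    then have "u $ 0 = 0" by (simp add: standard_cocycle_classes scaling_class_coboundary)
    moreover have "u $ 1 = 0" if n: "n \<le> 2"
    proof -
      have "\<beta> u * pairing n 0 n gM = 0"
        using \<psi>[of "gP 0" "gQ n" gM] n by (simp add: standard_cocycle_classes pairing_class_coboundary)
      then show ?thesis using pairing_corner n by (simp add: \<beta>_def)
    qed
    ultimately have "u = 0\<^sub>v d"
      using u by (intro eq_vecI) (auto simp: module_vec_def d_def less_Suc_eq numeral_2_eq_2 split: if_splits)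
    then show "u = \<zero>\<^bsub>?U\<^esub>" by (simp add: module_vec_def)
  qed
  moreover have "vectorspace.dim class_ring ?U = d" by (rule vec_space.dim_is_n)
  ultimately show ?thesis by (simp add: ce_H2_def d_def)
qed

end

theorem theorem4p7:
  fixes l :: real
  assumes "2 * l \<in> \<nat>"
  shows "vectorspace.fin_dim class_ring (ce_H2 class_ring (cga l)) \<and>
    vectorspace.dim class_ring (ce_H2 class_ring (cga l)) = (if l \<in> {0, 1/2, 1} then 2 else 1)"
proof -
  obtain n where n: "2 * l = real n" using assms by (auto simp: Nats_def)
  interpret cga_eigenbasis l n by unfold_locales (rule n)
  have l: "l = real n / 2" using n by simp
  have "l \<in> {0, 1/2, 1} \<longleftrightarrow> n \<le> 2"
    unfolding l by auto
  then show ?thesis using H2_dim by simp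
qed

end
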